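(* Suppose that the $T$-periodic system $\dot x(t)=A(t)x(t)+B(t)u(t)$ with unconstrained controls is controllable. Let $D^a\subset\mathbb{S}^1\times\mathbb{R}^d$ denote the unique control set with nonvoid interior of the autonomized system on $\mathbb{S}^1\times\mathbb{R}^d$ with controls $u\in\mathcal{U}$. (i) The projections to $\mathbb{S}^1\times\mathbb{S}^{d,+}$ of the reachable and controllable sets of the autonomized system satisfy $$\overline{e_P(\mathrm{int}\,\mathbf{R}^a(0,0))}\cap(\mathbb{S}^1\times\mathbb{S}^{d,0})=\overline{e_P(\mathcal{E}^{+,0})}\cap(\mathbb{S}^1\times\mathbb{S}^{d,0}),$$ $$\overline{e_P(\mathrm{int}\,\mathbf{C}^a(0,0))}\cap(\mathbb{S}^1\times\mathbb{S}^{d,0})=\overline{e_P(\mathcal{E}^{-,0})}\cap(\mathbb{S}^1\times\mathbb{S}^{d,0}).$$ (ii) The induced system on $\mathbb{S}^1\times\mathbb{S}^{d,+}$ has a unique control set with nonvoid interior; it is given by $D^a_P=e_P(D^a)$ and satisfies $$\overline{\mathrm{int}\,D^a_P}\cap(\mathbb{S}^1\times\mathbb{S}^{d,0})=\overline{e_P(\mathcal{E}^0)}\cap(\mathbb{S}^1\times\mathbb{S}^{d,0}).$$ In particular, $\mathrm{int}\,D^a$ is bounded if and only if $\overline{\mathrm{int}\,D^a_P}\subset\mathbb{S}^1\times\mathbb{S}^{d,+}$.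
   Context: Setting. Let $T>0$, let $A\in L^\infty(\mathbb{R},\mathbb{R}^{d\times d})$ and $B\in L^\infty(\mathbb{R},\mathbb{R}^{d\times m})$ be $T$-periodic, $B(t)$ with columns $b_1(t),\ldots,b_m(t)$, let $U\subset\mathbb{R}^m$ be a bounded convex neighborhood of the origin, and $\mathcal{U}=\{u\in L^\infty(\mathbb{R},\mathbb{R}^m): u(t)\in U\text{ for a.a. }t\}$. For the control system $\dot x(t)=A(t)x(t)+B(t)u(t)$ let $\varphi(t;t_0,x_0,u)$, $t\in\mathbb{R}$, be the (Carathéodory) solution with $x(t_0)=x_0$. $X(t,s)$ is the principal fundamental solution of $\dot x=A(t)x$, $X(s,s)=I_d$. The system with unconstrained controls is called controllable if for any $x_1,x_2\in\mathbb{R}^d$ and $t_0\in\mathbb{R}$ there are $t_1>t_0$ and $u\in L^\infty([t_0,t_1],\mathbb{R}^m)$ with $\varphi(t_1;t_0,x_1,u)=x_2$. Autonomized system. $\mathbb{S}^1$ is the circle parametrized by $\tau\in[0,T)$ (i.e. $\mathbb{R}/T\mathbb{Z}$). The autonomized system $\dot\tau=1\bmod T$, $\dot x=A(\tau)x+B(\tau)u$ on $\mathbb{S}^1\times\mathbb{R}^d$ has solutions $\varphi^a(t;(\tau_0,x_0),u)=(\tau_0+t\bmod T,\ \varphi(\tau_0+t;\tau_0,x_0,u))$, $u\in\mathcal{U}$. Its reachable and controllable sets are $\mathbf{R}^a(\tau,x)=\{\varphi^a(t;(\tau,x),u): t\ge0,u\in\mathcal{U}\}$ and $\mathbf{C}^a(\tau,x)=\{(\sigma,y):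 \exists t\ge0,u\in\mathcal{U},\ \varphi^a(t;(\sigma,y),u)=(\tau,x)\}$. Control set. A nonvoid subset $D$ of the state space of an autonomous control system is a control set if (i) for every point $p\in D$ there is $u\in\mathcal{U}$ such that the trajectory from $p$ with control $u$ stays in $D$ for all $t\ge0$; (ii) for every $p\in D$, $D$ is contained in the closure of the reachable set from $p$; (iii) $D$ is maximal (w.r.t. inclusion) with properties (i) and (ii). Under the controllability hypothesis the autonomized system on $\mathbb{S}^1\times\mathbb{R}^d$ has exactly one control set $D^a$ with nonvoid interior, and $D^a=\overline{\mathbf{R}^a(0,0)}\cap\mathbf{C}^a(0,0)$. Spectral subbundles. For $\tau\in[0,T)$ let $E^-_\tau,E^0_\tau,E^+_\tau\subset\mathbb{R}^d$ be the direct sums of the real generalized eigenspaces of $X(T+\tau,\tau)$ for the eigenvalues $\mu$ with $|\mu|<1$, $|\mu|=1$, $|\mu|>1$, respectively, and $E^{\pm,0}_\tau=E^\pm_\tau\oplus E^0_\tau$. Put $\mathcal{E}^0=\{(\tau,x)\in\mathbb{S}^1\times\mathbb{R}^d:x\in E^0_\tau\}$ and $\mathcal{E}^{\pm,0}=\{(\tau,x)\in\mathbb{S}^1\times\mathbb{R}^d:x\in E^{\pm,0}_\tau\}$. Poincaré sphere. $\mathbb{S}^d\subset\mathbb{R}^{d+1}$ is the unit sphere, $\mathbb{S}^{d,+}=\{s\in\mathbb{S}^d:s_{d+1}>0\}$ the open upper hemisphere, $\mathbb{S}^{d,0}=\{s\in\mathbb{S}^d:s_{d+1}=0\}$ the equator.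 The map $e_P:\mathbb{S}^1\times\mathbb{R}^d\to\mathbb{S}^1\times\mathbb{S}^{d,+}$ is $e_P(\tau,x)=\left(\tau,\frac{(x,1)}{\sqrt{1+\|x\|^2}}\right)$. The induced control system on $\mathbb{S}^d$ is, for $(s,s_{d+1})\in\mathbb{S}^d$ with $s\in\mathbb{R}^d$, $$\dot s=[A-s^\top As\cdot I_d]s+\sum_{i=1}^m u_i(-s^\top b_is_{d+1}s+b_is_{d+1}),\qquad \dot s_{d+1}=-s^\top As\,s_{d+1}-\sum_{i=1}^m u_i s^\top b_is_{d+1}^2,$$ with $A=A(t)$, $b_i=b_i(t)$, $u=u(t)$; adding the phase $\tau\in\mathbb{S}^1$ (with $\dot\tau=1\bmod T$ and $A,b_i$ evaluated at $\tau$) gives an autonomous control system on $\mathbb{S}^1\times\mathbb{S}^d$, which leaves $\mathbb{S}^1\times\mathbb{S}^{d,+}$ invariant; its restriction is the induced system on $\mathbb{S}^1\times\mathbb{S}^{d,+}$. Closures of subsets of $\mathbb{S}^1\times\mathbb{S}^{d,+}$ in the claim are taken in $\mathbb{S}^1\times\mathbb{S}^d$. *)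

theory Defs
  imports "HOL-Analysis.Analysis"
begin

section \<open>Essentially bounded functions and Caratheodory solutions\<close>

text \<open>Elements of an \<open>L\<^sup>\<infinity>\<close> space are represented by functions; all conditions on them are
  insensitive to changes on Lebesgue null sets.\<close>

definition L_infty_on :: "real set \<Rightarrow> (real \<Rightarrow> 'a::euclidean_space) set" where
  "L_infty_on I = {f. f \<in> borel_measurable (lebesgue_on I) \<and>
     (\<exists>C. AE t in lebesgue_on I. norm (f t) \<le> C)}"

definition ae_periodic :: "real \<Rightarrow> (real \<Rightarrow> 'a) \<Rightarrow> bool" where
  "ae_periodic T f \<longleftrightarrow> (AE t in lebesgue. f (t + T) = f t)"

text \<open>Caratheodory solutions on the whole real line, characterized by the (Lebesgue) integral
  equation; the integral is oriented, so times before \<open>t0\<close> are covered as well.\<close>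

definition caratheodory_solution ::
    "(real \<Rightarrow> 'a \<Rightarrow> 'a::euclidean_space) \<Rightarrow> real \<Rightarrow> 'a \<Rightarrow> (real \<Rightarrow> 'a) \<Rightarrow> bool" where
  "caratheodory_solution f t0 x0 x \<longleftrightarrow>
     (\<forall>t. interval_lebesgue_integrable lebesgue (ereal t0) (ereal t) (\<lambda>r. f r (x r)) \<and>
          x t = x0 + interval_lebesgue_integral lebesgue (ereal t0) (ereal t) (\<lambda>r. f r (x r)))"

definition ode_solution ::
    "(real \<Rightarrow> 'a \<Rightarrow> 'a::euclidean_space) \<Rightarrow> real \<Rightarrow> real \<Rightarrow> 'a \<Rightarrow> 'a" where
  "ode_solution f t t0 x0 = (THE x. caratheodory_solution f t0 x0 x) t"


section \<open>The linear periodic control system\<close>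

definition admissible_controls :: "(real^'m) set \<Rightarrow> (real \<Rightarrow> real^'m) set" where
  "admissible_controls U = {u \<in> L_infty_on UNIV. AE t in lebesgue. u t \<in> U}"

definition lin_rhs ::
    "(real \<Rightarrow> real^'d^'d) \<Rightarrow> (real \<Rightarrow> real^'m^'d) \<Rightarrow> (real \<Rightarrow> real^'m) \<Rightarrow>
     real \<Rightarrow> real^'d \<Rightarrow> real^'d" where
  "lin_rhs A B u t x = A t *v x + B t *v u t"

definition phi ::
    "(real \<Rightarrow> real^'d^'d) \<Rightarrow> (real \<Rightarrow> real^'m^'d) \<Rightarrow>
     real \<Rightarrow> real \<Rightarrow> real^'d \<Rightarrow> (real \<Rightarrow> real^'m) \<Rightarrow> real^'d" where
  "phi A B t t0 x0 u = ode_solution (lin_rhs A B u) t t0 x0"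

definition fundamental_solution :: "(real \<Rightarrow> real^'d^'d) \<Rightarrow> real \<Rightarrow> real \<Rightarrow> real^'d^'d" where
  "fundamental_solution A t s = ode_solution (\<lambda>r Y. A r ** Y) t s (mat 1)"

text \<open>Controllability with unconstrained controls. A control on \<open>[t0, t1]\<close> is extended by zero
  to the real line; the state at time \<open>t1\<close> depends on its values on \<open>[t0, t1]\<close> only.\<close>

definition controllable :: "(real \<Rightarrow> real^'d^'d) \<Rightarrow> (real \<Rightarrow> real^'m^'d) \<Rightarrow> bool" where
  "controllable A B \<longleftrightarrow> (\<forall>x1 x2 t0. \<exists>t1>t0. \<exists>u \<in> L_infty_on {t0..t1}.
     phi A B t1 t0 x1 (\<lambda>t. if t \<in> {t0..t1} then u t else 0) = x2)"


section \<open>Control sets of autonomous control systems\<close>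

text \<open>A control system is given by its state space (a topology), a set of controls and the map
  \<open>\<Phi> t p u\<close> yielding the state at time \<open>t\<close> of the trajectory from \<open>p\<close> under the control \<open>u\<close>.\<close>

definition reachable_set ::
    "(real \<Rightarrow> 'p \<Rightarrow> 'u \<Rightarrow> 'p) \<Rightarrow> 'u set \<Rightarrow> 'p \<Rightarrow> 'p set" where
  "reachable_set \<Phi> \<U> p = {\<Phi> t p u | t u. t \<ge> 0 \<and> u \<in> \<U>}"

definition controllable_set ::
    "'p topology \<Rightarrow> (real \<Rightarrow> 'p \<Rightarrow> 'u \<Rightarrow> 'p) \<Rightarrow> 'u set \<Rightarrow> 'p \<Rightarrow> 'p set" where
  "controllable_set M \<Phi> \<U> p = {q \<in> topspace M. \<exists>t\<ge>0. \<exists>u\<in>\<U>. \<Phi> t q u = p}"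

definition weakly_invariant_and_approx_controllable ::
    "'p topology \<Rightarrow> (real \<Rightarrow> 'p \<Rightarrow> 'u \<Rightarrow> 'p) \<Rightarrow> 'u set \<Rightarrow> 'p set \<Rightarrow> bool" where
  "weakly_invariant_and_approx_controllable M \<Phi> \<U> D \<longleftrightarrow>
     (\<forall>p\<in>D. \<exists>u\<in>\<U>. \<forall>t\<ge>0. \<Phi> t p u \<in> D) \<and>
     (\<forall>p\<in>D. D \<subseteq> M closure_of reachable_set \<Phi> \<U> p)"

definition control_set ::
    "'p topology \<Rightarrow> (real \<Rightarrow> 'p \<Rightarrow> 'u \<Rightarrow> 'p) \<Rightarrow> 'u set \<Rightarrow> 'p set \<Rightarrow> bool" where
  "control_set M \<Phi> \<U> D \<longleftrightarrow>
     D \<noteq> {} \<and> D \<subseteq> topspace M \<and> weakly_invariant_and_approx_controllable M \<Phi> \<U> D \<and>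
     (\<forall>D'. D \<subseteq> D' \<and> D' \<subseteq> topspace M \<and> weakly_invariant_and_approx_controllable M \<Phi> \<U> D'
        \<longrightarrow> D' = D)"

definition control_set_nonvoid_interior ::
    "'p topology \<Rightarrow> (real \<Rightarrow> 'p \<Rightarrow> 'u \<Rightarrow> 'p) \<Rightarrow> 'u set \<Rightarrow> 'p set \<Rightarrow> bool" where
  "control_set_nonvoid_interior M \<Phi> \<U> D \<longleftrightarrow> control_set M \<Phi> \<U> D \<and> M interior_of D \<noteq> {}"


section \<open>The circle of phases and autonomized systems\<close>

text \<open>The circle \<open>\<real>/T\<int>\<close> is realized as the complex unit circle, with \<open>\<tau> \<in> [0, T)\<close> corresponding to
  the point of argument \<open>2 \<pi> \<tau> / T\<close>. Thus \<open>circ T\<close> incorporates the reduction mod \<open>T\<close>, and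
  \<open>phase T\<close> yields the representative in \<open>[0, T)\<close>.\<close>

definition circ :: "real \<Rightarrow> real \<Rightarrow> complex" where
  "circ T \<tau> = cis (2 * pi * \<tau> / T)"

definition phase :: "real \<Rightarrow> complex \<Rightarrow> real" where
  "phase T z = T * Arg2pi z / (2 * pi)"

abbreviation S1 :: "complex set" where
  "S1 \<equiv> sphere 0 1"

text \<open>Given the solution map \<open>\<psi> t t0 x0 u\<close> of a \<open>T\<close>-periodic system, the solution map of its
  autonomization. Controls refer to absolute time, i.e. \<open>u (\<tau>0 + t)\<close> acts after time \<open>t\<close>.\<close>

definition autonomized ::
    "real \<Rightarrow> (real \<Rightarrow> real \<Rightarrow> 'x \<Rightarrow> 'u \<Rightarrow> 'x) \<Rightarrow> real \<Rightarrow> complex \<times> 'x \<Rightarrow> 'u \<Rightarrow> complex \<times> 'x" where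
  "autonomized T \<psi> t p u =
     (let \<tau>0 = phase T (fst p) in (circ T (\<tau>0 + t), \<psi> (\<tau>0 + t) \<tau>0 (snd p) u))"

definition cylinder :: "(complex \<times> (real^'d)) topology" where
  "cylinder = top_of_set (S1 \<times> UNIV)"

definition phi_a ::
    "real \<Rightarrow> (real \<Rightarrow> real^'d^'d) \<Rightarrow> (real \<Rightarrow> real^'m^'d) \<Rightarrow>
     real \<Rightarrow> complex \<times> (real^'d) \<Rightarrow> (real \<Rightarrow> real^'m) \<Rightarrow> complex \<times> (real^'d)" where
  "phi_a T A B = autonomized T (phi A B)"

definition Reach_a ::
    "real \<Rightarrow> (real \<Rightarrow> real^'d^'d) \<Rightarrow> (real \<Rightarrow> real^'m^'d) \<Rightarrow> (real^'m) set \<Rightarrow>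
     real \<Rightarrow> real^'d \<Rightarrow> (complex \<times> (real^'d)) set" where
  "Reach_a T A B U \<tau> x = reachable_set (phi_a T A B) (admissible_controls U) (circ T \<tau>, x)"

definition Contr_a ::
    "real \<Rightarrow> (real \<Rightarrow> real^'d^'d) \<Rightarrow> (real \<Rightarrow> real^'m^'d) \<Rightarrow> (real^'m) set \<Rightarrow>
     real \<Rightarrow> real^'d \<Rightarrow> (complex \<times> (real^'d)) set" where
  "Contr_a T A B U \<tau> x =
     controllable_set cylinder (phi_a T A B) (admissible_controls U) (circ T \<tau>, x)"

definition D_a ::
    "real \<Rightarrow> (real \<Rightarrow> real^'d^'d) \<Rightarrow> (real \<Rightarrow> real^'m^'d) \<Rightarrow> (real^'m) set \<Rightarrow>
     (complex \<times> (real^'d)) set" where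
  "D_a T A B U =
     (THE D. control_set_nonvoid_interior cylinder (phi_a T A B) (admissible_controls U) D)"


section \<open>Spectral subbundles\<close>

definition complexify :: "real^'n^'n \<Rightarrow> complex^'n^'n" where
  "complexify M = (\<chi> i j. complex_of_real (M $ i $ j))"

definition eigenvalues :: "real^'n^'n \<Rightarrow> complex set" where
  "eigenvalues M = {\<mu>. \<exists>v. v \<noteq> 0 \<and> complexify M *v v = \<mu> *s v}"

definition gen_eigenspace :: "real^'n^'n \<Rightarrow> complex \<Rightarrow> (complex^'n) set" where
  "gen_eigenspace M \<mu> = {v. \<exists>k. ((\<lambda>w. complexify M *v w - \<mu> *s w) ^^ k) v = 0}"

text \<open>The real generalized eigenspace is generated by the real and imaginary parts of the
  complex generalized eigenvectors; it is the same for \<open>\<mu>\<close> and its complex conjugate.\<close>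

definition real_gen_eigenspace :: "real^'n^'n \<Rightarrow> complex \<Rightarrow> (real^'n) set" where
  "real_gen_eigenspace M \<mu> =
     span ((\<lambda>v. \<chi> i. Re (v $ i)) ` gen_eigenspace M \<mu> \<union> (\<lambda>v. \<chi> i. Im (v $ i)) ` gen_eigenspace M \<mu>)"

text \<open>The sum of the real generalized eigenspaces over all eigenvalues whose modulus satisfies
  \<open>P\<close>; it is automatically direct (over the classes of conjugate eigenvalues).\<close>

definition spectral_subspace :: "(real \<Rightarrow> bool) \<Rightarrow> real^'n^'n \<Rightarrow> (real^'n) set" where
  "spectral_subspace P M =
     span (\<Union>\<mu> \<in> {\<mu> \<in> eigenvalues M. P (cmod \<mu>)}. real_gen_eigenspace M \<mu>)"

definition E_minus :: "real \<Rightarrow> (real \<Rightarrow> real^'d^'d) \<Rightarrow> real \<Rightarrow> (real^'d) set" where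
  "E_minus T A \<tau> = spectral_subspace (\<lambda>r. r < 1) (fundamental_solution A (T + \<tau>) \<tau>)"

definition E_zero :: "real \<Rightarrow> (real \<Rightarrow> real^'d^'d) \<Rightarrow> real \<Rightarrow> (real^'d) set" where
  "E_zero T A \<tau> = spectral_subspace (\<lambda>r. r = 1) (fundamental_solution A (T + \<tau>) \<tau>)"

definition E_plus :: "real \<Rightarrow> (real \<Rightarrow> real^'d^'d) \<Rightarrow> real \<Rightarrow> (real^'d) set" where
  "E_plus T A \<tau> = spectral_subspace (\<lambda>r. r > 1) (fundamental_solution A (T + \<tau>) \<tau>)"

definition E_minus_zero :: "real \<Rightarrow> (real \<Rightarrow> real^'d^'d) \<Rightarrow> real \<Rightarrow> (real^'d) set" where
  "E_minus_zero T A \<tau> = {x + y | x y. x \<in> E_minus T A \<tau> \<and> y \<in> E_zero T A \<tau>}"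

definition E_plus_zero :: "real \<Rightarrow> (real \<Rightarrow> real^'d^'d) \<Rightarrow> real \<Rightarrow> (real^'d) set" where
  "E_plus_zero T A \<tau> = {x + y | x y. x \<in> E_plus T A \<tau> \<and> y \<in> E_zero T A \<tau>}"

definition subbundle :: "real \<Rightarrow> (real \<Rightarrow> (real^'d) set) \<Rightarrow> (complex \<times> (real^'d)) set" where
  "subbundle T E = {(circ T \<tau>, x) | \<tau> x. \<tau> \<in> {0..<T} \<and> x \<in> E \<tau>}"


section \<open>The Poincare sphere and the induced system\<close>

text \<open>\<open>\<real>\<^sup>d\<^sup>+\<^sup>1\<close> is \<open>\<real>\<^sup>d \<times> \<real>\<close>, whose norm is the Euclidean one; the last coordinate is \<open>snd\<close>.\<close>

definition Sd :: "((real^'d) \<times> real) set" where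
  "Sd = sphere 0 1"

definition Sd_upper :: "((real^'d) \<times> real) set" where
  "Sd_upper = {s \<in> Sd. snd s > 0}"

definition Sd_equator :: "((real^'d) \<times> real) set" where
  "Sd_equator = {s \<in> Sd. snd s = 0}"

definition e_P :: "complex \<times> (real^'d) \<Rightarrow> complex \<times> ((real^'d) \<times> real)" where
  "e_P p = (fst p, (1 / sqrt (1 + (norm (snd p))\<^sup>2)) *\<^sub>R (snd p, 1))"

definition sphere_rhs ::
    "(real \<Rightarrow> real^'d^'d) \<Rightarrow> (real \<Rightarrow> real^'m^'d) \<Rightarrow> (real \<Rightarrow> real^'m) \<Rightarrow>
     real \<Rightarrow> (real^'d) \<times> real \<Rightarrow> (real^'d) \<times> real" where
  "sphere_rhs A B u t = (\<lambda>(s, \<sigma>).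
     (A t *v s - (s \<bullet> (A t *v s)) *\<^sub>R s
        + (\<Sum>i\<in>UNIV. (u t $ i) *\<^sub>R
            (- ((s \<bullet> column i (B t)) * \<sigma>) *\<^sub>R s + \<sigma> *\<^sub>R column i (B t))),
      - (s \<bullet> (A t *v s)) * \<sigma> - (\<Sum>i\<in>UNIV. (u t $ i) * (s \<bullet> column i (B t)) * \<sigma>\<^sup>2)))"

definition phi_P ::
    "(real \<Rightarrow> real^'d^'d) \<Rightarrow> (real \<Rightarrow> real^'m^'d) \<Rightarrow>
     real \<Rightarrow> real \<Rightarrow> (real^'d) \<times> real \<Rightarrow> (real \<Rightarrow> real^'m) \<Rightarrow> (real^'d) \<times> real" where
  "phi_P A B t t0 s0 u = ode_solution (sphere_rhs A B u) t t0 s0"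

definition phi_P_a ::
    "real \<Rightarrow> (real \<Rightarrow> real^'d^'d) \<Rightarrow> (real \<Rightarrow> real^'m^'d) \<Rightarrow>
     real \<Rightarrow> complex \<times> ((real^'d) \<times> real) \<Rightarrow> (real \<Rightarrow> real^'m) \<Rightarrow> complex \<times> ((real^'d) \<times> real)" where
  "phi_P_a T A B = autonomized T (phi_P A B)"

definition sphere_bundle :: "(complex \<times> ((real^'d) \<times> real)) topology" where
  "sphere_bundle = top_of_set (S1 \<times> Sd)"

definition upper_bundle :: "(complex \<times> ((real^'d) \<times> real)) topology" where
  "upper_bundle = top_of_set (S1 \<times> Sd_upper)"

end

theory Submission
  imports Defs "HOL-Computational_Algebra.Fundamental_Theorem_Algebra"
begin

text \<open>
  Let \<open>M = X T 0\<close>. The points reachable from \<open>0\<close> at times \<open>n T\<close> form increasing convex sets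
  \<open>Q + M Q + \<dots> + M\<^sup>n\<^sup>-\<^sup>1 Q\<close>, where \<open>Q\<close> is bounded and, by controllability, some of these sets contain a ball.
  A functional \<open>p\<close> bounded above on their union satisfies \<open>\<Sum>\<^sub>j \<bar>(M\<^sup>*)\<^sup>N\<^sup>j p\<bar> < \<infinity>\<close>, hence annihilates the
  generalized eigenspaces of \<open>M\<close> for \<open>\<bar>\<mu>\<bar> \<ge> 1\<close>. So no point of their sum can be separated from the reachable
  set, which therefore contains it. Conversely, if \<open>p\<close> annihilates this sum, then \<open>\<Sum>\<^sub>k \<bar>p M\<^sup>k q\<bar>\<close> converges
  uniformly on \<open>Q\<close> and \<open>p\<close> is bounded on the reachable set, so that limits of directions going to infinity lie in
  the sum. Controllability to \<open>0\<close> is treated in the same way with \<open>M\<^sup>-\<^sup>1\<close>.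

  The reachable set \<open>\<R>\<close> and the controllable set \<open>\<C>\<close> of \<open>(0, 0)\<close> are open, and
  \<open>\<R> \<inter> \<C> \<subseteq> D\<^sup>a = closure \<R> \<inter> \<C>\<close>, which gives the limits of \<open>D\<^sup>a\<close> at the equator. The map \<open>e\<^sub>P\<close>
  is a homeomorphism that conjugates the two systems, so it transports control sets.
\<close>

section \<open>Caratheodory solutions\<close>

text \<open>The coefficients are only measurable in time, so trajectories are handled through the
  integral equation \<open>solves\<close> on the whole line. Points of the cylinder are lifted to
  absolute time: the relation \<open>rch s x t y\<close> can be concatenated, convexly combined and
  translated by \<open>T\<close>, and phases return only through \<open>circ\<close>. Small
  combinations of unconstrained controls lie in the neighbourhood \<open>U\<close>; this is the
  origin of the ball of reachable points. It is available after some number \<open>N\<close> of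
  periods, perhaps not after one, so the spectral argument has to work with the power
  \<open>M^N\<close>. At the equator the bundle is pulled back to the fibre over phase 0 by
  \<open>X 0 \<tau>\<close>, which makes the spectral subspaces constant; a functional bounded on
  the pulled-back set vanishes on limit directions because the heights on the sphere tend to 0.
  Uniqueness of the control set hinges on meeting \<open>\<R> \<inter> \<C>\<close>, although a
  point of a control set is only approximately returned to. Contracting it towards 0 frees a part of
  the control range that corrects the error, and an interior point leaves room for the
  contraction.\<close>

lemma integral_dominated_continuous:
  fixes g :: "real \<Rightarrow> 'a::euclidean_space"
  assumes g: "g \<in> borel_measurable lebesgue" and h: "continuous_on {a..b} h"
    and b: "AE r in lebesgue. r \<in> {a..b} \<longrightarrow> norm (g r) \<le> h r"
  shows "g absolutely_integrable_on {a..b}"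
    and "norm (integral {a..b} g) \<le> integral {a..b} h"
proof -
  have hi: "h absolutely_integrable_on {a..b}"
    using h by (rule absolutely_integrable_continuous_real)
  show gi: "g absolutely_integrable_on {a..b}"
    unfolding set_integrable_def
  proof (rule Bochner_Integration.integrable_bound)
    show "integrable lebesgue (\<lambda>x. indicat_real {a..b} x *\<^sub>R h x)"
      using hi by (simp add: set_integrable_def)
    show "(\<lambda>x. indicat_real {a..b} x *\<^sub>R g x) \<in> borel_measurable lebesgue"
      using g by (intro borel_measurable_scaleR borel_measurable_indicator) auto
    show "AE x in lebesgue. norm (indicat_real {a..b} x *\<^sub>R g x) \<le> norm (indicat_real {a..b} x *\<^sub>R h x)"
      using b by eventually_elim (auto simp: indicator_def)
  qed
  have "norm (integral {a..b} g) = norm (set_lebesgue_integral lebesgue {a..b} g)"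
    using set_lebesgue_integral_eq_integral(2)[OF gi] by simp
  also have "\<dots> \<le> set_lebesgue_integral lebesgue {a..b} h"
    unfolding set_lebesgue_integral_def
  proof (rule order_trans[OF integral_norm_bound], rule integral_mono_AE)
    show "integrable lebesgue (\<lambda>x. norm (indicat_real {a..b} x *\<^sub>R g x))"
      using gi unfolding set_integrable_def by (rule integrable_norm)
    show "integrable lebesgue (\<lambda>x. indicat_real {a..b} x *\<^sub>R h x)"
      using hi by (simp add: set_integrable_def)
    show "AE x in lebesgue. norm (indicat_real {a..b} x *\<^sub>R g x) \<le> indicat_real {a..b} x *\<^sub>R h x"
      using b by eventually_elim (auto simp: indicator_def)
  qed
  also have "\<dots> = integral {a..b} h"
    using set_lebesgue_integral_eq_integral(2)[OF hi] by simp
  finally show "norm (integral {a..b} g) \<le> integral {a..b} h" .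
qed

lemma integral_exp_scaled:
  fixes c :: real
  assumes "c \<noteq> 0" "a \<le> b"
  shows "integral {a..b} (\<lambda>r. exp (c * r + d)) = (exp (c * b + d) - exp (c * a + d)) / c"
proof -
  have "((\<lambda>r. exp (c * r + d)) has_integral exp (c * b + d) / c - exp (c * a + d) / c) {a..b}"
    using assms
    by (intro fundamental_theorem_of_calculus)
       (auto intro!: derivative_eq_intros simp: has_real_derivative_iff_has_vector_derivative[symmetric])
  then show ?thesis by (simp add: integral_unique diff_divide_distrib)
qed

text \<open>Weigh the norm by \<open>exp (- 2 L (t - a))\<close> and evaluate the inequality at a
  maximum point \<open>s\<close> of the weighted function. With the rate \<open>2 L\<close> the
  Lipschitz term costs at most half of the maximum and is absorbed on the left; this produces both
  factors 2 in the bound, which is cruder than the classical one.\<close>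

lemma gronwall_forward:
  fixes x :: "real \<Rightarrow> 'a::euclidean_space"
  assumes L: "L > 0" and b: "b \<ge> 0" and ac: "a \<le> c"
    and cont: "continuous_on {a..c} x"
    and inc: "\<And>t. t \<in> {a..c} \<Longrightarrow> norm (x t - x a) \<le> integral {a..t} (\<lambda>r. L * norm (x r) + b)"
  shows "norm (x c) \<le> 2 * (norm (x a) + b * (c - a)) * exp (2 * L * (c - a))"
proof -
  define w where "w = (\<lambda>t. norm (x t) * exp (- (2 * L * (t - a))))"
  have "continuous_on {a..c} w"
    unfolding w_def using cont by (intro continuous_intros)
  moreover have "compact {a..c}" "{a..c} \<noteq> {}" using ac by auto
  ultimately obtain s where s: "s \<in> {a..c}" and smax: "\<And>t. t \<in> {a..c} \<Longrightarrow> w t \<le> w s"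
    using continuous_attains_sup[of "{a..c}" w] by auto
  have wn: "norm (x t) = w t * exp (2 * L * (t - a))" for t
    unfolding w_def mult.assoc exp_add[symmetric] by simp
  have w0: "0 \<le> w s" by (simp add: w_def)
  have sub: "{a..s} \<subseteq> {a..c}" using s by auto
  have "norm (x s) \<le> norm (x a) + norm (x s - x a)"
    using norm_triangle_ineq[of "x a" "x s - x a"] by simp
  also have "norm (x s - x a) \<le> integral {a..s} (\<lambda>r. L * norm (x r) + b)"
    using inc s by auto
  also have "\<dots> \<le> integral {a..s} (\<lambda>r. L * w s * exp (2 * L * r + - (2 * L * a)) + b)"
  proof (rule integral_le)
    show "(\<lambda>r. L * norm (x r) + b) integrable_on {a..s}"
      using continuous_on_subset[OF cont sub] by (intro integrable_continuous_real continuous_intros)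
    show "(\<lambda>r. L * w s * exp (2 * L * r + - (2 * L * a)) + b) integrable_on {a..s}"
      by (intro integrable_continuous_real continuous_intros)
    fix r assume "r \<in> {a..s}"
    then have "w r \<le> w s" using smax sub by auto
    then have "norm (x r) \<le> w s * exp (2 * L * (r - a))" unfolding wn[of r]
      by (intro mult_right_mono) auto
    then show "L * norm (x r) + b \<le> L * w s * exp (2 * L * r + - (2 * L * a)) + b"
      using L by (simp add: algebra_simps)
  qed
  also have "\<dots> = L * w s * integral {a..s} (\<lambda>r. exp (2 * L * r + - (2 * L * a))) + b * (s - a)"
    using s by (subst Henstock_Kurzweil_Integration.integral_add)
      (auto intro!: integrable_continuous_real continuous_intros)
  also have "integral {a..s} (\<lambda>r. exp (2 * L * r + - (2 * L * a))) = (exp (2 * L * (s - a)) - 1) / (2 * L)"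
    using s L by (subst integral_exp_scaled) (auto simp: algebra_simps)
  also have "L * w s * ((exp (2 * L * (s - a)) - 1) / (2 * L)) = w s / 2 * exp (2 * L * (s - a)) - w s / 2"
    using L by (simp add: field_simps)
  finally have "w s * exp (2 * L * (s - a)) / 2 \<le> norm (x a) + b * (s - a)"
    using w0 wn[of s] by (simp add: algebra_simps)
  then have "w s * exp (2 * L * (s - a)) \<le> 2 * (norm (x a) + b * (s - a))" by simp
  moreover have "w s * 1 \<le> w s * exp (2 * L * (s - a))"
    using w0 L s by (intro mult_left_mono) auto
  moreover have "b * (s - a) \<le> b * (c - a)" using b s by (intro mult_left_mono) auto
  ultimately have "w s \<le> 2 * (norm (x a) + b * (c - a))" by (simp only: mult_1_right) argo
  then have "w c \<le> 2 * (norm (x a) + b * (c - a))" using smax[of c] ac by auto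
  then show ?thesis unfolding wn[of c] by (intro mult_right_mono) auto
qed

text \<open>The hypothesis on increments is symmetric in the two endpoints, so the case
  \<open>t < s\<close> follows from the forward estimate by reflecting time.\<close>

lemma gronwall:
  fixes x :: "real \<Rightarrow> 'a::euclidean_space"
  assumes L: "L > 0" and b: "b \<ge> 0"
    and cont: "continuous_on {p..q} x"
    and inc: "\<And>s t. p \<le> s \<Longrightarrow> s \<le> t \<Longrightarrow> t \<le> q \<Longrightarrow>
        norm (x t - x s) \<le> integral {s..t} (\<lambda>r. L * norm (x r) + b)"
    and s: "s \<in> {p..q}" and t: "t \<in> {p..q}"
  shows "norm (x t) \<le> 2 * (norm (x s) + b * \<bar>t - s\<bar>) * exp (2 * L * \<bar>t - s\<bar>)"
proof (cases "s \<le> t")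
  case True
  have "norm (x t) \<le> 2 * (norm (x s) + b * (t - s)) * exp (2 * L * (t - s))"
    using s t inc by (intro gronwall_forward L b True continuous_on_subset[OF cont]) auto
  then show ?thesis using True by simp
next
  case False
  define y where "y = (\<lambda>r. x (- r))"
  have "norm (y (-t)) \<le> 2 * (norm (y (-s)) + b * (-t - - s)) * exp (2 * L * (-t - - s))"
  proof (rule gronwall_forward[OF L b])
    show "-s \<le> -t" using False by simp
    show "continuous_on {-s..-t} y" unfolding y_def
      using s t by (intro continuous_on_compose2[OF cont] continuous_intros) auto
    fix r assume r: "r \<in> {-s..-t}"
    have "norm (y r - y (-s)) = norm (x s - x (-r))" by (simp add: y_def norm_minus_commute)
    also have "\<dots> \<le> integral {-r..s} (\<lambda>r. L * norm (x r) + b)"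
      using r s t by (intro inc) auto
    also have "\<dots> = integral {-s..r} (\<lambda>r. L * norm (y r) + b)"
      using Henstock_Kurzweil_Integration.integral_reflect_real[of r "-s" "\<lambda>r. L * norm (y r) + b"]
      unfolding y_def minus_minus .
    finally show "norm (y r - y (-s)) \<le> integral {-s..r} (\<lambda>r. L * norm (y r) + b)" .
  qed
  then show ?thesis using False by (simp add: y_def)
qed

lemma absolutely_integrable_on_subinterval_real:
  fixes g :: "real \<Rightarrow> 'a::euclidean_space"
  assumes "g absolutely_integrable_on {a..b}" "a \<le> c" "d \<le> b"
  shows "g absolutely_integrable_on {c..d}"
  by (rule set_integrable_subset[OF assms(1)]) (use assms in auto)

text \<open>The integral equation without a distinguished initial time and with unoriented
  integrals. In this form restarting, shifting and superposing solutions require no case distinction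
  on the order of times.\<close>

definition solves :: "(real \<Rightarrow> 'a \<Rightarrow> 'a::euclidean_space) \<Rightarrow> (real \<Rightarrow> 'a) \<Rightarrow> bool" where
  "solves f x \<longleftrightarrow> (\<forall>a b. (\<lambda>r. f r (x r)) absolutely_integrable_on {a..b}) \<and>
     (\<forall>s t. s \<le> t \<longrightarrow> x t - x s = integral {s..t} (\<lambda>r. f r (x r)))"

lemma einterval_ereal: "einterval (ereal a) (ereal b) = {a<..<b}"
  by (auto simp: einterval_def)

lemma interval_lebesgue_integrable_iff:
  fixes g :: "real \<Rightarrow> 'a::euclidean_space"
  shows "interval_lebesgue_integrable lebesgue (ereal a) (ereal b) g \<longleftrightarrow>
    g absolutely_integrable_on {min a b..max a b}"
  by (auto simp: interval_lebesgue_integrable_def einterval_ereal min_def max_def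
    absolutely_integrable_on_open_interval[of a b for a b :: real, unfolded box_real])

lemma interval_lebesgue_integral_eq_integral:
  fixes g :: "real \<Rightarrow> 'a::euclidean_space"
  assumes "g absolutely_integrable_on {min a b..max a b}"
  shows "interval_lebesgue_integral lebesgue (ereal a) (ereal b) g =
    (if a \<le> b then integral {a..b} g else - integral {b..a} g)"
proof -
  have "g absolutely_integrable_on {min a b<..<max a b}"
    by (rule set_integrable_subset[OF assms]) auto
  from set_lebesgue_integral_eq_integral(2)[OF this] show ?thesis
    by (auto simp: interval_lebesgue_integral_def einterval_ereal min_def max_def
     integral_open_interval_real split: if_splits)
qed

text \<open>With a right-hand side that ignores the state, \<open>solves\<close> just says that a
  function is an antiderivative of \<open>h\<close>. This serves the comparison with
  \<open>caratheodory_solution\<close> as well as Picard iteration.\<close>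

lemma solves_oriented_integral:
  fixes h :: "real \<Rightarrow> 'a::euclidean_space"
  assumes h: "\<And>a b. h absolutely_integrable_on {a..b}"
  shows "solves (\<lambda>r _. h r) (\<lambda>t. x0 + (if t0 \<le> t then integral {t0..t} h else - integral {t..t0} h))"
    (is "solves _ ?H")
proof -
  have int: "h integrable_on {a..b}" for a b
    using h by (simp add: set_lebesgue_integral_eq_integral(1))
  note c = Henstock_Kurzweil_Integration.integral_combine[OF _ _ int]
  have "?H t - ?H s = integral {s..t} h" if st: "s \<le> t" for s t
  proof -
    consider "t0 \<le> s" | "s < t0" "t0 \<le> t" | "s < t0" "t < t0" by linarith
    then show ?thesis
    proof cases
      case 1
      then show ?thesis using c[of t0 s t] st by (simp add: algebra_simps)
    next
      case 2
      then show ?thesis using c[of s t0 t] st by (simp add: algebra_simps)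
    next
      case 3
      then show ?thesis using c[of s t t0] st by (simp add: algebra_simps)
    qed
  qed
  then show ?thesis unfolding solves_def using h by blast
qed

lemma caratheodory_solution_iff_solves:
  "caratheodory_solution f t0 x0 x \<longleftrightarrow> solves f x \<and> x t0 = x0"
proof
  assume sol: "caratheodory_solution f t0 x0 x"
  let ?g = "\<lambda>r. f r (x r)"
  have i0: "interval_lebesgue_integrable lebesgue (ereal t0) (ereal t) ?g"
    and e0: "x t = x0 + interval_lebesgue_integral lebesgue (ereal t0) (ereal t) ?g" for t
    using sol unfolding caratheodory_solution_def by blast+
  have i: "?g absolutely_integrable_on {min t0 t..max t0 t}" for t
    using i0 unfolding interval_lebesgue_integrable_iff .
  have e: "x t = x0 + (if t0 \<le> t then integral {t0..t} ?g else - integral {t..t0} ?g)" for t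
    using e0[of t] unfolding interval_lebesgue_integral_eq_integral[OF i] .
  have ab: "?g absolutely_integrable_on {a..b}" for a b
  proof -
    \<comment> \<open>Integrability is given only on intervals with endpoint \<open>t0\<close>; the
      two that lead to \<open>a\<close> and to \<open>b\<close> together cover
      \<open>{a..b}\<close>.\<close>
    have "?g absolutely_integrable_on ({min t0 a..max t0 a} \<union> {min t0 b..max t0 b})"
      using i[of a] i[of b] by (intro absolutely_integrable_Un) auto
    then show ?thesis by (rule set_integrable_subset) auto
  qed
  have "solves (\<lambda>r _. ?g r) x"
    using solves_oriented_integral[of ?g x0 t0, OF ab] unfolding e[symmetric] .
  then have "solves f x" by (simp add: solves_def)
  moreover have "x t0 = x0" using e[of t0] by simp
  ultimately show "solves f x \<and> x t0 = x0" ..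
next
  assume *: "solves f x \<and> x t0 = x0"
  have ab: "(\<lambda>r. f r (x r)) absolutely_integrable_on {a..b}"
    and d: "s \<le> t \<Longrightarrow> x t - x s = integral {s..t} (\<lambda>r. f r (x r))" and x0: "x t0 = x0" for a b s t
    using * unfolding solves_def by blast+
  show "caratheodory_solution f t0 x0 x"
    unfolding caratheodory_solution_def
  proof (intro allI conjI)
    fix t
    show "interval_lebesgue_integrable lebesgue (ereal t0) (ereal t) (\<lambda>r. f r (x r))"
      unfolding interval_lebesgue_integrable_iff by (rule ab)
    show "x t = x0 + interval_lebesgue_integral lebesgue (ereal t0) (ereal t) (\<lambda>r. f r (x r))"
      unfolding interval_lebesgue_integral_eq_integral[OF ab]
      using d[of t0 t] d[of t t0] unfolding x0 by (cases "t0 \<le> t") (simp_all add: eq_diff_eq diff_eq_eq add.commute)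
  qed
qed

lemma solves_continuous:
  assumes "solves f x"
  shows "continuous_on S x"
proof -
  have "isCont x t" for t
  proof -
    have i: "(\<lambda>r. f r (x r)) integrable_on {t-1..t+1}"
      using assms by (auto simp: solves_def intro: set_lebesgue_integral_eq_integral(1))
    have "continuous_on {t-1..t+1} (\<lambda>s. x (t-1) + integral {t-1..s} (\<lambda>r. f r (x r)))"
      using indefinite_integral_continuous_1[OF i] by (intro continuous_intros)
    moreover have "x (t-1) + integral {t-1..s} (\<lambda>r. f r (x r)) = x s" if "s \<in> {t-1..t+1}" for s
    proof -
      have "t - 1 \<le> s" using that by simp
      then have "x s - x (t-1) = integral {t-1..s} (\<lambda>r. f r (x r))"
        using assms unfolding solves_def by blast
      then show ?thesis by (simp add: algebra_simps)
    qed
    ultimately have "continuous_on {t-1..t+1} x" by (rule continuous_on_eq)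
    then have "continuous_on {t-1<..<t+1} x" by (rule continuous_on_subset) auto
    then show ?thesis by (simp add: continuous_on_eq_continuous_at)
  qed
  then show ?thesis by (simp add: continuous_at_imp_continuous_on)
qed

text \<open>Only a Lipschitz condition on bounded sets is asked for, because the field on the sphere
  is not globally Lipschitz; trajectories are continuous and hence bounded on the interval. Allowing
  two fields that agree almost everywhere there makes the same lemma show that a state depends only
  on the control values between the two times.\<close>

lemma solves_unique_interval:
  assumes x: "solves f x" and y: "solves g y"
    and fg: "AE r in lebesgue. r \<in> {a..b} \<longrightarrow> f r = g r"
    and lip: "\<And>K. \<exists>L. AE r in lebesgue. \<forall>u v. norm u \<le> K \<longrightarrow> norm v \<le> K \<longrightarrow>
       norm (f r u - f r v) \<le> L * norm (u - v)"
    and s: "s \<in> {a..b}" and t: "t \<in> {a..b}" and eq: "x s = y s"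
  shows "x t = y t"
proof -
  let ?z = "\<lambda>r. x r - y r"
  have cx: "continuous_on {a..b} x" and cy: "continuous_on {a..b} y"
    using x y by (auto intro: solves_continuous)
  have "bounded (x ` {a..b})" "bounded (y ` {a..b})"
    using cx cy by (auto intro!: compact_imp_bounded compact_continuous_image)
  then obtain K1 K2 where "\<forall>r\<in>{a..b}. norm (x r) \<le> K1" "\<forall>r\<in>{a..b}. norm (y r) \<le> K2"
    unfolding bounded_iff by auto
  then have K: "norm (x r) \<le> max K1 K2" "norm (y r) \<le> max K1 K2" if "r \<in> {a..b}" for r
    using that by (auto intro: max.coboundedI1 max.coboundedI2)
  obtain L where L: "AE r in lebesgue. \<forall>u v. norm u \<le> max K1 K2 \<longrightarrow> norm v \<le> max K1 K2 \<longrightarrow>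
       norm (f r u - f r v) \<le> L * norm (u - v)"
    using lip by blast
  define M where "M = max L 1"
  have "norm (?z t) \<le> 2 * (norm (?z s) + 0 * \<bar>t - s\<bar>) * exp (2 * M * \<bar>t - s\<bar>)"
  proof (rule gronwall[OF _ _ _ _ s t])
    show "M > 0" by (simp add: M_def)
    show "continuous_on {a..b} ?z" using cx cy by (intro continuous_intros)
    fix p q assume pq: "a \<le> p" "p \<le> q" "q \<le> b"
    let ?F = "\<lambda>r. f r (x r)" and ?G = "\<lambda>r. g r (y r)"
    have ai: "?F absolutely_integrable_on {p..q}" "?G absolutely_integrable_on {p..q}"
      using x y by (auto simp: solves_def)
    have ii: "?F integrable_on {p..q}" "?G integrable_on {p..q}"
      using ai by (auto intro: set_lebesgue_integral_eq_integral(1))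
    \<comment> \<open>Cutting off outside \<open>{p..q}\<close> yields a function measurable on the
      whole line, as the domination lemma requires.\<close>
    define h where "h = (\<lambda>r. indicat_real {p..q} r *\<^sub>R (?F r - ?G r))"
    have hm: "h \<in> borel_measurable lebesgue"
      using borel_measurable_diff[OF borel_measurable_integrable[OF ai(1)[unfolded set_integrable_def]]
          borel_measurable_integrable[OF ai(2)[unfolded set_integrable_def]]]
      by (simp add: h_def scaleR_diff_right)
    have "norm (integral {p..q} h) \<le> integral {p..q} (\<lambda>r. M * norm (?z r) + 0)"
    proof (rule integral_dominated_continuous(2)[OF hm])
      show "continuous_on {p..q} (\<lambda>r. M * norm (?z r) + 0)"
        using cx cy pq by (intro continuous_intros; elim continuous_on_subset) auto
      show "AE r in lebesgue. r \<in> {p..q} \<longrightarrow> norm (h r) \<le> M * norm (?z r) + 0"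
        using L fg
      proof eventually_elim
        case (elim r)
        show ?case
        proof
          assume r: "r \<in> {p..q}"
          then have rab: "r \<in> {a..b}" using pq by auto
          then have "g r = f r" using elim by auto
          then have "norm (h r) = norm (f r (x r) - f r (y r))" using r by (simp add: h_def)
          also have "\<dots> \<le> L * norm (?z r)" using elim K[OF rab] by blast
          also have "\<dots> \<le> M * norm (?z r)" by (intro mult_right_mono) (auto simp: M_def)
          finally show "norm (h r) \<le> M * norm (?z r) + 0" by simp
        qed
      qed
    qed
    moreover have "integral {p..q} h = integral {p..q} (\<lambda>r. ?F r - ?G r)"
      by (rule Henstock_Kurzweil_Integration.integral_cong) (simp add: h_def)
    moreover have "\<dots> = ?z q - ?z p"
      using x y pq ii by (simp add: Henstock_Kurzweil_Integration.integral_diff solves_def algebra_simps)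
    ultimately show "norm (?z q - ?z p) \<le> integral {p..q} (\<lambda>r. M * norm (?z r) + 0)" by simp
  qed simp
  then show ?thesis using eq by simp
qed

lemma continuous_imp_borel_measurable_lebesgue:
  assumes "continuous_on UNIV f"
  shows "f \<in> borel_measurable lebesgue"
proof -
  have "f \<in> borel_measurable lborel"
    using borel_measurable_continuous_onI[OF assms] by simp
  then show ?thesis by (rule measurable_completion)
qed

lemma integral_exp_abs_weight:
  fixes c :: real
  assumes "c > 0"
  shows "integral {min s t..max s t} (\<lambda>r. K * exp (c * \<bar>r - s\<bar>)) = K / c * (exp (c * \<bar>t - s\<bar>) - 1)"
proof (cases "s \<le> t")
  case True
  have "integral {s..t} (\<lambda>r. exp (c * \<bar>r - s\<bar>)) = integral {s..t} (\<lambda>r. exp (c * r + - (c * s)))"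
    by (rule Henstock_Kurzweil_Integration.integral_cong) (simp add: algebra_simps)
  also have "\<dots> = (exp (c * \<bar>t - s\<bar>) - 1) / c"
    using True assms by (subst integral_exp_scaled) (auto simp: algebra_simps)
  finally show ?thesis using True by simp
next
  case False
  have "integral {t..s} (\<lambda>r. exp (c * \<bar>r - s\<bar>)) = integral {t..s} (\<lambda>r. exp ((- c) * r + c * s))"
    by (rule Henstock_Kurzweil_Integration.integral_cong) (simp add: algebra_simps)
  also have "\<dots> = (exp (c * \<bar>t - s\<bar>) - 1) / c"
    using False assms by (subst integral_exp_scaled) (auto simp: algebra_simps minus_divide_left)
  finally show ?thesis using False by simp
qed

text \<open>Picard's operator is a contraction for the weighted norm
  \<open>sup\<^sub>t exp (- 2 L \<bar>t - t0\<bar>) \<bar>x t\<bar>\<close>, which yields a solution on the whole line at once.\<close>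

lemma solves_exists:
  fixes f :: "real \<Rightarrow> 'a \<Rightarrow> 'a::euclidean_space"
  assumes L: "L > 0"
    and meas: "\<And>x. continuous_on UNIV x \<Longrightarrow> (\<lambda>r. f r (x r)) \<in> borel_measurable lebesgue"
    and lip: "AE r in lebesgue. \<forall>u v. norm (f r u - f r v) \<le> L * norm (u - v)"
    and bnd: "AE r in lebesgue. norm (f r 0) \<le> G"
  obtains x where "solves f x" "x t0 = x0"
proof -
  define c where "c = 2 * L"
  have c: "c > 0" using L by (simp add: c_def)
  define W where "W = (\<lambda>t. exp (c * \<bar>t - t0\<bar>))"
  have W: "W t > 0" "W t \<ge> 1" for t using c by (auto simp: W_def)
  have contW: "continuous_on S W" for S unfolding W_def by (intro continuous_intros)
  define O' where "O' = (\<lambda>(h::real \<Rightarrow> 'a) t. if t0 \<le> t then integral {t0..t} h else - integral {t..t0} h)"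
  have bound: "h absolutely_integrable_on {a..b}" "norm (O' h t) \<le> K / c * (W t - 1)"
    if h: "h \<in> borel_measurable lebesgue" "AE r in lebesgue. norm (h r) \<le> K * W r" for h K t a b
  proof -
    have cK: "continuous_on S (\<lambda>r. K * W r)" for S using contW by (intro continuous_intros)
    have ae: "AE r in lebesgue. r \<in> {a..b} \<longrightarrow> norm (h r) \<le> K * W r" for a b
      using h(2) by eventually_elim auto
    show "h absolutely_integrable_on {a..b}"
      by (rule integral_dominated_continuous(1)[OF h(1) cK ae])
    have "norm (O' h t) = norm (integral {min t0 t..max t0 t} h)" by (simp add: O'_def)
    also have "\<dots> \<le> integral {min t0 t..max t0 t} (\<lambda>r. K * W r)"
      by (rule integral_dominated_continuous(2)[OF h(1) cK ae])
    also have "\<dots> = K / c * (W t - 1)" unfolding W_def by (rule integral_exp_abs_weight[OF c])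
    finally show "norm (O' h t) \<le> K / c * (W t - 1)" .
  qed
  \<comment> \<open>The unknown is the bounded continuous function \<open>z = x / W\<close>, so that
    the weighted norm becomes the supremum norm of a complete space; \<open>g z\<close> is the
    right-hand side along \<open>x = W z\<close>.\<close>
  define g where "g = (\<lambda>(z :: real \<Rightarrow>\<^sub>C 'a) r. f r (W r *\<^sub>R z r))"
  have gm: "g z \<in> borel_measurable lebesgue" for z
    unfolding g_def using contW by (intro meas continuous_intros) auto
  have gb: "AE r in lebesgue. norm (g z r) \<le> (L * norm z + \<bar>G\<bar>) * W r" for z
    using lip bnd
  proof eventually_elim
    case (elim r)
    have "norm (g z r) \<le> norm (f r (W r *\<^sub>R z r) - f r 0) + norm (f r 0)"
      unfolding g_def using norm_triangle_ineq[of "f r (W r *\<^sub>R z r) - f r 0" "f r 0"] by simp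
    also have "\<dots> \<le> L * norm (W r *\<^sub>R z r) + \<bar>G\<bar>"
      using elim(1)[rule_format, of "W r *\<^sub>R z r" 0] elim(2) by auto
    also have "norm (W r *\<^sub>R z r) \<le> W r * norm z"
      using W[of r] norm_bounded[of z r] by simp
    also have "L * (W r * norm z) + \<bar>G\<bar> \<le> L * (W r * norm z) + \<bar>G\<bar> * W r"
      using W(2)[of r] mult_left_mono[of 1 "W r" "\<bar>G\<bar>"] by simp
    finally show ?case using L by (simp add: algebra_simps)
  qed
  have gd: "AE r in lebesgue. norm (g z r - g w r) \<le> (L * dist z w) * W r" for z w
    using lip
  proof eventually_elim
    case (elim r)
    have "norm (g z r - g w r) \<le> L * norm (W r *\<^sub>R z r - W r *\<^sub>R w r)"
      using elim unfolding g_def by blast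
    also have "norm (W r *\<^sub>R z r - W r *\<^sub>R w r) = W r * dist (z r) (w r)"
      using W[of r] by (simp add: dist_norm scaleR_diff_right[symmetric])
    also have "\<dots> \<le> W r * dist z w" using W[of r] by (intro mult_left_mono dist_bounded) auto
    finally show ?case using L by (simp add: algebra_simps)
  qed
  note gi = bound(1)[OF gm gb]
  have sol: "solves (\<lambda>r _. g z r) (\<lambda>t. x0 + O' (g z) t)" for z
    using solves_oriented_integral[OF gi, of z x0 t0] by (simp add: O'_def)
  define P where "P = (\<lambda>z t. (1 / W t) *\<^sub>R (x0 + O' (g z) t))"
  have P: "P z \<in> bcontfun" for z
  proof (rule bcontfun_normI)
    show "continuous_on UNIV (P z)"
      unfolding P_def
    proof (intro continuous_on_scaleR continuous_on_divide contW continuous_on_const solves_continuous[OF sol] ballI)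
      show "W t \<noteq> 0" for t using W(1)[of t] by simp
    qed
    fix t
    have "norm (P z t) = norm (x0 + O' (g z) t) / W t" using W(1)[of t] by (simp add: P_def)
    also have "\<dots> \<le> (norm x0 * W t + (L * norm z + \<bar>G\<bar>) / c * W t) / W t"
    proof (rule divide_right_mono)
      have "norm (x0 + O' (g z) t) \<le> norm x0 + (L * norm z + \<bar>G\<bar>) / c * (W t - 1)"
        using norm_triangle_ineq[of x0 "O' (g z) t"] bound(2)[OF gm gb, of z t] by linarith
      also have "\<dots> \<le> norm x0 * W t + (L * norm z + \<bar>G\<bar>) / c * W t"
        using W(2)[of t] c L mult_left_mono[of 1 "W t" "norm x0"] by (intro add_mono mult_left_mono) auto
      finally show "norm (x0 + O' (g z) t) \<le> norm x0 * W t + (L * norm z + \<bar>G\<bar>) / c * W t" .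
    qed (use W in \<open>simp add: less_imp_le\<close>)
    also have "\<dots> = norm x0 + (L * norm z + \<bar>G\<bar>) / c"
      using W(1)[of t] by (simp add: add_divide_distrib)
    finally show "norm (P z t) \<le> norm x0 + (L * norm z + \<bar>G\<bar>) / c" .
  qed
  define F where "F = (\<lambda>z. Bcontfun (P z))"
  have F: "apply_bcontfun (F z) = P z" for z unfolding F_def by (rule Bcontfun_inverse[OF P])
  have "\<exists>!z. F z = z"
  proof (rule banach_fix_type[where c = "1/2"])
    show "\<forall>z w. dist (F z) (F w) \<le> 1/2 * dist z w"
    proof (intro allI dist_bound)
      fix z w t
      have "x0 + O' (g z) t - (x0 + O' (g w) t) = O' (\<lambda>r. g z r - g w r) t"
        unfolding O'_def using gi
        by (simp add: Henstock_Kurzweil_Integration.integral_diff set_lebesgue_integral_eq_integral(1))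
      then have "dist (F z t) (F w t) = norm (O' (\<lambda>r. g z r - g w r) t) / W t"
        using W(1)[of t] by (simp add: F P_def dist_norm scaleR_diff_right[symmetric])
      also have "\<dots> \<le> (L * dist z w / c * W t) / W t"
      proof (rule divide_right_mono)
        have "norm (O' (\<lambda>r. g z r - g w r) t) \<le> L * dist z w / c * (W t - 1)"
          by (rule bound(2)[OF _ gd]) (intro borel_measurable_diff gm)
        also have "\<dots> \<le> L * dist z w / c * W t" using c L by (intro mult_left_mono) auto
        finally show "norm (O' (\<lambda>r. g z r - g w r) t) \<le> L * dist z w / c * W t" .
      qed (use W in \<open>simp add: less_imp_le\<close>)
      \<comment> \<open>The contraction constant is \<open>L / c\<close> with
        \<open>c = 2 L\<close>.\<close>
      also have "\<dots> = 1/2 * dist z w" using W(1)[of t] L by (simp add: c_def)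
      finally show "dist (F z t) (F w t) \<le> 1/2 * dist z w" .
    qed
  qed auto
  then obtain z where z: "F z = z" by blast
  define x where "x = (\<lambda>t. W t *\<^sub>R z t)"
  have x: "x t = x0 + O' (g z) t" for t
    using W(1)[of t] F[of z] z by (simp add: x_def P_def)
  have "g z = (\<lambda>r. f r (x r))" by (simp add: g_def x_def)
  then have "solves f x" using sol[of z] unfolding x[symmetric] solves_def by simp
  moreover have "x t0 = x0" by (simp add: x O'_def)
  ultimately show ?thesis by (rule that)
qed

lemma ode_solution_eqI:
  assumes "solves f x"
    and "\<And>K. \<exists>L. AE r in lebesgue. \<forall>u v. norm u \<le> K \<longrightarrow> norm v \<le> K \<longrightarrow>
       norm (f r u - f r v) \<le> L * norm (u - v)"
  shows "ode_solution f t t0 (x t0) = x t"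
proof -
  have "(THE y. caratheodory_solution f t0 (x t0) y) = x"
  proof (rule the_equality)
    show "caratheodory_solution f t0 (x t0) x" using assms by (simp add: caratheodory_solution_iff_solves)
    fix y assume "caratheodory_solution f t0 (x t0) y"
    then have y: "solves f y" "y t0 = x t0" by (auto simp: caratheodory_solution_iff_solves)
    show "y = x"
    proof
      fix t show "y t = x t"
        by (rule solves_unique_interval[OF y(1) assms(1) _ assms(2), of "min t0 t" "max t0 t" t0 t])
          (use y in auto)
    qed
  qed
  then show ?thesis by (simp add: ode_solution_def)
qed

text \<open>The difference of \<open>F \<circ> x\<close> and the candidate integral has derivative zero at every point,
  although \<open>x\<close> itself need not be differentiable.\<close>

lemma solves_chain_rule:
  fixes F :: "'a::euclidean_space \<Rightarrow> 'b::euclidean_space" and F' :: "'a \<Rightarrow> 'a \<Rightarrow>\<^sub>L 'b"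
  assumes x: "solves f x"
    and bnd: "\<And>a b. \<exists>K. AE r in lebesgue. r \<in> {a..b} \<longrightarrow> norm (f r (x r)) \<le> K"
    and der: "\<And>y. (F has_derivative F' y) (at y)"
    and cont: "continuous_on UNIV F'"
    and st: "s \<le> t"
  shows "(\<lambda>r. F' (x r) (f r (x r))) absolutely_integrable_on {s..t}"
    and "F (x t) - F (x s) = integral {s..t} (\<lambda>r. F' (x r) (f r (x r)))"
proof -
  let ?g = "\<lambda>r. f r (x r)" and ?h = "\<lambda>r. F' (x r) (f r (x r))"
  have gi: "?g absolutely_integrable_on {a..b}" and dx: "a \<le> b \<Longrightarrow> x b - x a = integral {a..b} ?g" for a b
    using x unfolding solves_def by blast+
  have cx: "continuous_on S x" for S using x by (rule solves_continuous)
  have cF': "continuous_on S (\<lambda>r. F' (x r))" for S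
    using cx by (rule continuous_on_compose2[OF cont]) auto
  obtain K0 where K0: "AE r in lebesgue. r \<in> {s..t} \<longrightarrow> norm (?g r) \<le> K0" using bnd by blast
  define K where "K = max K0 0"
  have K: "AE r in lebesgue. r \<in> {s..t} \<longrightarrow> norm (?g r) \<le> K" and K0: "K \<ge> 0"
    using K0 by (auto simp: K_def elim!: eventually_mono)
  define g where "g = (\<lambda>r. indicat_real {s..t} r *\<^sub>R ?g r)"
  have gm: "g \<in> borel_measurable lebesgue"
    unfolding g_def using borel_measurable_integrable[OF gi[unfolded set_integrable_def]] .
  have geq: "g r = ?g r" if "r \<in> {s..t}" for r using that by (simp add: g_def)
  \<comment> \<open>The error in the integrand when the derivative is frozen to a fixed map
    \<open>P\<close>. With \<open>P = 0\<close> it is the chain-rule integrand itself, with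
    \<open>P = F' (x q)\<close> it is small near \<open>q\<close>.\<close>
  define D where "D = (\<lambda>(P::'a \<Rightarrow>\<^sub>L 'b) r. (F' (x r) - P) (g r))"
  have Dm: "D P \<in> borel_measurable lebesgue" for P
  proof -
    have "D P = (\<lambda>r. \<Sum>i\<in>Basis. (g r \<bullet> i) *\<^sub>R (F' (x r) - P) i)"
    proof
      fix r
      have "(F' (x r) - P) (\<Sum>i\<in>Basis. (g r \<bullet> i) *\<^sub>R i) = (\<Sum>i\<in>Basis. (g r \<bullet> i) *\<^sub>R (F' (x r) - P) i)"
        by (simp add: blinfun.sum_right blinfun.scaleR_right)
      then show "D P r = (\<Sum>i\<in>Basis. (g r \<bullet> i) *\<^sub>R (F' (x r) - P) i)"
        by (simp add: D_def euclidean_representation)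
    qed
    moreover have "(\<lambda>r. (F' (x r) - P) i) \<in> borel_measurable lebesgue" for i
    proof -
      have "continuous_on UNIV (\<lambda>r. (F' (x r) - P) i)"
        using cF' by (intro continuous_intros)
      then show ?thesis by (rule continuous_imp_borel_measurable_lebesgue)
    qed
    ultimately show ?thesis
      using gm by (auto intro!: borel_measurable_sum borel_measurable_scaleR borel_measurable_inner)
  qed
  have Dint: "D P absolutely_integrable_on {a..b}" "norm (integral {a..b} (D P)) \<le> M * K * (b - a)"
    if ab: "s \<le> a" "a \<le> b" "b \<le> t" and M: "\<And>r. r \<in> {a..b} \<Longrightarrow> norm (F' (x r) - P) \<le> M" for a b P M
  proof -
    have c: "continuous_on {a..b} (\<lambda>_. M * K)" by simp
    have ae: "AE r in lebesgue. r \<in> {a..b} \<longrightarrow> norm (D P r) \<le> M * K"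
      using K
    proof eventually_elim
      case (elim r)
      show ?case
      proof
        assume r: "r \<in> {a..b}"
        then have "norm (D P r) \<le> norm (F' (x r) - P) * norm (g r)"
          by (simp add: D_def norm_blinfun)
        also have "\<dots> \<le> M * K"
          using r ab elim M[OF r] geq[of r] norm_ge_zero[of "F' (x r) - P"]
          by (intro mult_mono) (auto intro: order_trans[OF norm_ge_zero])
        finally show "norm (D P r) \<le> M * K" .
      qed
    qed
    show "D P absolutely_integrable_on {a..b}"
      by (rule integral_dominated_continuous(1)[OF Dm c ae])
    show "norm (integral {a..b} (D P)) \<le> M * K * (b - a)"
      using integral_dominated_continuous(2)[OF Dm c ae] ab by (simp add: mult.commute mult.left_commute)
  qed
  have "bounded ((\<lambda>r. F' (x r)) ` {s..t})"
    by (intro compact_imp_bounded compact_continuous_image cF') auto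
  then obtain M where "\<forall>y\<in>(\<lambda>r. F' (x r)) ` {s..t}. norm y \<le> M" unfolding bounded_iff by blast
  then have M: "\<And>r. r \<in> {s..t} \<Longrightarrow> norm (F' (x r)) \<le> M" by blast
  have "D 0 absolutely_integrable_on {s..t}"
    by (rule Dint(1)[of s t 0 M]) (use st M in auto)
  moreover have "?h absolutely_integrable_on {s..t} \<longleftrightarrow> D 0 absolutely_integrable_on {s..t}"
    by (rule set_integrable_cong) (auto simp: D_def geq)
  ultimately show hi: "?h absolutely_integrable_on {s..t}" by simp
  have hi': "?h absolutely_integrable_on {a..b}" if "s \<le> a" "b \<le> t" for a b
    using absolutely_integrable_on_subinterval_real[OF hi that] .
  note ii = set_lebesgue_integral_eq_integral(1)
  define G where "G = (\<lambda>p. F (x p) - integral {s..p} ?h)"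
  \<comment> \<open>\<open>P\<close> may be inserted freely, since \<open>x b - x a\<close> is the
    integral of the velocity and a linear map commutes with the integral. Choosing
    \<open>P = F' (x q)\<close> leaves a differentiation error of \<open>F\<close> and a continuity
    error of \<open>F'\<close>, both of order \<open>e\<close>.\<close>
  have dG: "G b - G a = F (x b) - F (x a) - P (x b - x a) - integral {a..b} (D P)"
    if ab: "s \<le> a" "a \<le> b" "b \<le> t" for a b and P :: "'a \<Rightarrow>\<^sub>L 'b"
  proof -
    have "integral {a..b} (D P) = integral {a..b} (\<lambda>r. ?h r - P (?g r))"
      by (rule Henstock_Kurzweil_Integration.integral_cong)
        (use ab in \<open>simp add: D_def geq blinfun.diff_left\<close>)
    also have "\<dots> = integral {a..b} ?h - integral {a..b} (\<lambda>r. P (?g r))"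
      using ab by (intro Henstock_Kurzweil_Integration.integral_diff ii hi'
        integrable_linear[OF ii[OF gi], unfolded o_def] blinfun.bounded_linear_right) auto
    also have "integral {a..b} (\<lambda>r. P (?g r)) = P (x b - x a)"
      unfolding dx[OF ab(2)]
      using integral_linear[OF ii[OF gi] blinfun.bounded_linear_right, of a b P] by (simp add: o_def)
    finally have "integral {a..b} (D P) + P (x b - x a) = integral {a..b} ?h" by simp
    moreover have "integral {s..a} ?h + integral {a..b} ?h = integral {s..b} ?h"
      using ab by (intro Henstock_Kurzweil_Integration.integral_combine ii hi') auto
    ultimately show ?thesis by (simp add: G_def algebra_simps)
  qed
  have xl: "norm (x b - x a) \<le> K * (b - a)" if ab: "s \<le> a" "a \<le> b" "b \<le> t" for a b
  proof -
    have "AE r in lebesgue. r \<in> {a..b} \<longrightarrow> norm (g r) \<le> K"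
      using K by eventually_elim (use ab geq in auto)
    from integral_dominated_continuous(2)[OF gm continuous_on_const this]
    have "norm (integral {a..b} g) \<le> K * (b - a)" using ab by (simp add: mult.commute)
    moreover have "integral {a..b} g = integral {a..b} ?g"
      by (rule Henstock_Kurzweil_Integration.integral_cong) (use ab geq in auto)
    ultimately show ?thesis using dx[OF ab(2)] by simp
  qed
  have "(G has_derivative (\<lambda>_. 0)) (at q within {s..t})" if q: "q \<in> {s..t}" for q
    unfolding has_derivative_within_alt
  proof (intro conjI allI impI bounded_linear_zero)
    fix e :: real assume e: "e > 0"
    \<comment> \<open>\<open>K\<close> is a Lipschitz constant of \<open>x\<close> on
      \<open>{s..t}\<close>, so each of the two errors amounts to at most \<open>e1 * K\<close>,
      that is, half of \<open>e\<close>, per unit of time; \<open>K + 1\<close> avoids a division by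
      zero.\<close>
    define e1 where "e1 = e / (2 * (K + 1))"
    have e1: "e1 > 0" "e1 * K \<le> e / 2"
    proof -
      show "e1 > 0" using e K0 by (simp add: e1_def)
      then have "e1 * K \<le> e1 * (K + 1)" by (intro mult_left_mono) auto
      also have "\<dots> = e / 2" using K0 by (simp add: e1_def field_simps)
      finally show "e1 * K \<le> e / 2" .
    qed
    obtain d1 where d1: "d1 > 0" and F1: "\<And>y. norm (y - x q) < d1 \<Longrightarrow>
        norm (F y - F (x q) - F' (x q) (y - x q)) \<le> e1 * norm (y - x q)"
      using der[of "x q"] e1 unfolding has_derivative_at_alt by blast
    have "isCont (\<lambda>r. F' (x r)) q"
      using cF'[of UNIV] by (simp add: continuous_on_eq_continuous_at)
    then obtain d2 where d2: "d2 > 0" and F2: "\<And>r. dist r q < d2 \<Longrightarrow> dist (F' (x r)) (F' (x q)) < e1"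
      using e1 unfolding continuous_at_eps_delta by blast
    have "\<forall>p\<in>{s..t}. norm (p - q) < min d2 (d1 / (K + 1)) \<longrightarrow> norm (G p - G q - 0) \<le> e * norm (p - q)"
    proof (intro ballI impI)
      fix p assume p: "p \<in> {s..t}" and pq: "norm (p - q) < min d2 (d1 / (K + 1))"
      define a b where "a = min p q" and "b = max p q"
      have ab: "s \<le> a" "a \<le> b" "b \<le> t" "b - a = norm (p - q)"
        using p q by (auto simp: a_def b_def)
      have nx: "norm (x p - x q) \<le> K * norm (p - q)"
        using xl[OF ab(1-3)] ab(4) by (auto simp: a_def b_def min_def max_def norm_minus_commute split: if_splits)
      also have "\<dots> \<le> (K + 1) * norm (p - q)" by (intro mult_right_mono) auto
      also have "\<dots> < d1" using pq K0 by (simp add: field_simps)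
      finally have "norm (F (x p) - F (x q) - F' (x q) (x p - x q)) \<le> e1 * norm (x p - x q)"
        by (rule F1)
      also have "\<dots> \<le> e1 * (K * norm (p - q))" using nx e1 by (intro mult_left_mono) auto
      also have "\<dots> \<le> e / 2 * norm (p - q)"
        using mult_right_mono[OF e1(2), of "norm (p - q)"] by (simp add: mult.assoc)
      finally have 1: "norm (F (x p) - F (x q) - F' (x q) (x p - x q)) \<le> e / 2 * norm (p - q)" .
      have "norm (integral {a..b} (D (F' (x q)))) \<le> e1 * K * (b - a)"
      proof (rule Dint(2)[OF ab(1-3)])
        fix r assume "r \<in> {a..b}"
        then have "dist r q < d2" using pq by (auto simp: a_def b_def dist_real_def)
        then show "norm (F' (x r) - F' (x q)) \<le> e1" using F2 by (simp add: dist_norm less_imp_le)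
      qed
      also have "\<dots> \<le> e / 2 * norm (p - q)"
        unfolding ab(4) using e1(2) by (rule mult_right_mono) auto
      finally have 2: "norm (integral {a..b} (D (F' (x q)))) \<le> e / 2 * norm (p - q)" .
      have "norm (G p - G q) = norm (G b - G a)"
        by (auto simp: a_def b_def min_def max_def norm_minus_commute)
      also have "\<dots> \<le> norm (F (x b) - F (x a) - F' (x q) (x b - x a)) + norm (integral {a..b} (D (F' (x q))))"
        unfolding dG[OF ab(1-3), of "F' (x q)"] by (rule norm_triangle_ineq4)
      also have "norm (F (x b) - F (x a) - F' (x q) (x b - x a)) =
          norm (F (x p) - F (x q) - F' (x q) (x p - x q))"
      proof (cases "p \<le> q")
        case True
        have "F (x q) - F (x p) - F' (x q) (x q - x p) = - (F (x p) - F (x q) - F' (x q) (x p - x q))"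
          by (simp add: blinfun.diff_right)
        then have "norm (F (x q) - F (x p) - F' (x q) (x q - x p)) = norm (F (x p) - F (x q) - F' (x q) (x p - x q))"
          by (metis norm_minus_cancel)
        moreover have "a = p" "b = q" using True by (auto simp: a_def b_def)
        ultimately show ?thesis by (simp only:)
      next
        case False
        then show ?thesis by (simp add: a_def b_def min_def max_def)
      qed
      finally show "norm (G p - G q - 0) \<le> e * norm (p - q)" using 1 2 by simp
    qed
    then show "\<exists>d>0. \<forall>p\<in>{s..t}. norm (p - q) < d \<longrightarrow> norm (G p - G q - 0) \<le> e * norm (p - q)"
      using d1 d2 K0 by (intro exI[of _ "min d2 (d1 / (K + 1))"]) auto
  qed
  then have "\<exists>c. \<forall>q\<in>{s..t}. G q = c"
    using has_derivative_zero_constant[of "{s..t}" G] by (auto simp: )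
  then have "G t = G s" using st by auto
  then show "F (x t) - F (x s) = integral {s..t} ?h" by (simp add: G_def algebra_simps)
qed

section \<open>Generalized eigenspaces\<close>

definition shift_op :: "complex^'n^'n \<Rightarrow> complex \<Rightarrow> complex^'n \<Rightarrow> complex^'n" where
  "shift_op N \<mu> w = N *v w - \<mu> *s w"

text \<open>The generalized eigenspace of an arbitrary complex matrix, so that the purely algebraic
  part carries no real structure.\<close>

definition gen_eig :: "complex^'n^'n \<Rightarrow> complex \<Rightarrow> (complex^'n) set" where
  "gen_eig N \<mu> = {v. \<exists>k. (shift_op N \<mu> ^^ k) v = 0}"

lemma gen_eigenspace_eq: "gen_eigenspace M \<mu> = gen_eig (complexify M) \<mu>"
  unfolding gen_eigenspace_def gen_eig_def shift_op_def[abs_def] ..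

lemma shift_op_add: "shift_op N \<mu> (v + w) = shift_op N \<mu> v + shift_op N \<mu> w"
  by (simp add: shift_op_def matrix_vector_right_distrib vector_add_ldistrib)

lemma shift_op_smult: "shift_op N \<mu> (c *s w) = c *s shift_op N \<mu> w"
  by (simp add: shift_op_def vector_scalar_commute vector_ssub_ldistrib vector_smult_assoc mult.commute)

lemma shift_op_diff: "shift_op N \<mu> (v - w) = shift_op N \<mu> v - shift_op N \<mu> w"
  by (simp add: shift_op_def matrix_vector_mult_diff_distrib vector_ssub_ldistrib)

lemma shift_op_mult: "shift_op N \<mu> (N *v w) = N *v shift_op N \<mu> w"
  by (simp add: shift_op_def matrix_vector_mult_diff_distrib vector_scalar_commute)

lemma shift_op_commute: "shift_op N \<mu> (shift_op N \<nu> w) = shift_op N \<nu> (shift_op N \<mu> w)"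
  unfolding shift_op_def[of N \<nu>] by (simp add: shift_op_mult shift_op_diff shift_op_smult)

lemma shift_op_zero [simp]: "shift_op N \<mu> 0 = 0"
  by (simp add: shift_op_def)

lemma shift_op_pow_zero [simp]: "(shift_op N \<mu> ^^ k) 0 = 0"
  by (induction k) auto

lemma shift_op_pow_add: "(shift_op N \<mu> ^^ k) (v + w) = (shift_op N \<mu> ^^ k) v + (shift_op N \<mu> ^^ k) w"
  by (induction k) (auto simp: shift_op_add)

lemma shift_op_pow_smult: "(shift_op N \<mu> ^^ k) (c *s w) = c *s (shift_op N \<mu> ^^ k) w"
  by (induction k) (auto simp: shift_op_smult)

lemma shift_op_pow_mult: "(shift_op N \<mu> ^^ k) (N *v w) = N *v (shift_op N \<mu> ^^ k) w"
  by (induction k) (auto simp: shift_op_mult)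

lemma shift_op_pow_commute:
  "(shift_op N \<mu> ^^ k) (shift_op N \<nu> w) = shift_op N \<nu> ((shift_op N \<mu> ^^ k) w)"
  by (induction k) (auto simp: shift_op_commute)

lemma gen_eig_zero [simp]: "0 \<in> gen_eig N \<mu>"
  unfolding gen_eig_def by (auto intro: exI[of _ 0])

lemma gen_eig_add:
  assumes "v \<in> gen_eig N \<mu>" "w \<in> gen_eig N \<mu>"
  shows "v + w \<in> gen_eig N \<mu>"
proof -
  obtain k l where "(shift_op N \<mu> ^^ k) v = 0" "(shift_op N \<mu> ^^ l) w = 0"
    using assms by (auto simp: gen_eig_def)
  then have "(shift_op N \<mu> ^^ (l + k)) v = 0" "(shift_op N \<mu> ^^ (k + l)) w = 0"
    by (auto simp only: funpow_add o_apply shift_op_pow_zero)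
  then have "(shift_op N \<mu> ^^ (k + l)) (v + w) = 0" by (simp add: shift_op_pow_add add.commute)
  then show ?thesis unfolding gen_eig_def by blast
qed

lemma gen_eig_smult: "v \<in> gen_eig N \<mu> \<Longrightarrow> c *s v \<in> gen_eig N \<mu>"
  unfolding gen_eig_def by (auto simp: shift_op_pow_smult)

lemma gen_eig_shift: "v \<in> gen_eig N \<mu> \<Longrightarrow> shift_op N \<nu> v \<in> gen_eig N \<mu>"
  unfolding gen_eig_def mem_Collect_eq shift_op_pow_commute by (elim ex_forward) simp

lemma gen_eig_mult: "v \<in> gen_eig N \<mu> \<Longrightarrow> N *v v \<in> gen_eig N \<mu>"
  unfolding gen_eig_def mem_Collect_eq shift_op_pow_mult by (elim ex_forward) simp

lemma gen_eig_diff: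
  assumes "v \<in> gen_eig N \<mu>" "w \<in> gen_eig N \<mu>"
  shows "v - w \<in> gen_eig N \<mu>"
  using gen_eig_add[OF assms(1) gen_eig_smult[OF assms(2), of "-1"]] by (simp add: vector_sneg_minus1[symmetric])

lemma gen_eig_pow_mult: "v \<in> gen_eig N \<mu> \<Longrightarrow> ((*v) N ^^ n) v \<in> gen_eig N \<mu>"
  by (induction n) (auto simp: gen_eig_mult)

text \<open>On the eigenspace of \<open>\<nu>\<close> the map \<open>N - \<mu>\<close> is the
  nonzero scalar \<open>\<nu> - \<mu>\<close> plus a nilpotent part. The preimage is built by
  induction on the nilpotency index instead of by a Neumann series.\<close>

lemma gen_eig_shift_surj:
  assumes "v \<in> gen_eig N \<nu>" "\<nu> \<noteq> \<mu>"
  shows "\<exists>w\<in>gen_eig N \<nu>. shift_op N \<mu> w = v"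
proof -
  obtain k where "(shift_op N \<nu> ^^ k) v = 0" using assms by (auto simp: gen_eig_def)
  then show ?thesis using assms(1)
  proof (induction k arbitrary: v)
    case 0
    then show ?case by (intro bexI[of _ 0]) auto
  next
    case (Suc k)
    have "(shift_op N \<nu> ^^ k) (shift_op N \<nu> v) = 0" using Suc.prems by (simp add: funpow_swap1)
    then obtain w where w: "w \<in> gen_eig N \<nu>" "shift_op N \<mu> w = shift_op N \<nu> v"
      using Suc.IH gen_eig_shift[OF Suc.prems(2)] by blast
    have e: "shift_op N \<mu> v = (\<nu> - \<mu>) *s v + shift_op N \<nu> v"
      by (simp add: shift_op_def vector_sub_rdistrib)
    \<comment> \<open>\<open>w\<close> is the preimage of the nilpotent part of \<open>v\<close>;
      subtracting it leaves exactly the scalar part.\<close>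
    let ?u = "inverse (\<nu> - \<mu>) *s (v - w)"
    have "shift_op N \<mu> ?u = inverse (\<nu> - \<mu>) *s ((\<nu> - \<mu>) *s v)"
      unfolding shift_op_smult shift_op_diff e w(2) by simp
    also have "\<dots> = v" using assms(2) unfolding vector_smult_assoc by simp
    finally show ?case
      using gen_eig_smult[OF gen_eig_diff[OF Suc.prems(2) w(1)]] by blast
  qed
qed

text \<open>On a vector in the kernel of \<open>N - \<mu>\<close> the map \<open>N - \<nu>\<close>
  acts as the nonzero scalar \<open>\<mu> - \<nu>\<close>, so no power of it can vanish unless the
  vector does.\<close>

lemma gen_eig_shift_inj:
  assumes "v \<in> gen_eig N \<nu>" "\<nu> \<noteq> \<mu>" "shift_op N \<mu> v = 0"
  shows "v = 0"
proof -
  have e: "shift_op N \<nu> v = (\<mu> - \<nu>) *s v"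
    using assms(3) by (simp add: shift_op_def vector_sub_rdistrib)
  have "(shift_op N \<nu> ^^ k) v = (\<mu> - \<nu>)^k *s v" for k
    by (induction k) (simp_all only: funpow.simps o_apply shift_op_smult e vector_smult_assoc power_Suc2, simp_all)
  then show ?thesis using assms by (auto simp: gen_eig_def vector_mul_eq_0)
qed

lemma gen_eig_shift_pow_inj:
  assumes "v \<in> gen_eig N \<nu>" "\<nu> \<noteq> \<mu>" "(shift_op N \<mu> ^^ k) v = 0"
  shows "v = 0"
  using assms
proof (induction k arbitrary: v)
  case (Suc k)
  then have "shift_op N \<mu> v = 0"
    using Suc.IH[of "shift_op N \<mu> v"] by (auto simp: gen_eig_shift funpow_swap1)
  then show ?case using Suc.prems gen_eig_shift_inj by blast
qed simp

lemma gen_eig_shift_pow: "v \<in> gen_eig N \<mu> \<Longrightarrow> (shift_op N \<nu> ^^ k) v \<in> gen_eig N \<mu>"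
  by (induction k) (auto simp: gen_eig_shift)

text \<open>A power of \<open>N - \<nu>\<close> deletes the component for \<open>\<nu>\<close> and
  keeps the others in their spaces. The induction hypothesis makes the images zero, and injectivity
  of that power on the other spaces gives back the components.\<close>

lemma gen_eig_independent:
  assumes "finite F" "\<And>\<mu>. \<mu> \<in> F \<Longrightarrow> g \<mu> \<in> gen_eig N \<mu>" "(\<Sum>\<mu>\<in>F. g \<mu>) = 0" "\<mu> \<in> F"
  shows "g \<mu> = 0"
  using assms
proof (induction F arbitrary: g \<mu> rule: finite_induct)
  case (insert \<nu> F)
  obtain k where k: "(shift_op N \<nu> ^^ k) (g \<nu>) = 0"
    using insert.prems(1)[of \<nu>] by (auto simp: gen_eig_def)
  have sum: "(shift_op N \<nu> ^^ k) (\<Sum>\<mu>\<in>F. g \<mu>) = (\<Sum>\<mu>\<in>F. (shift_op N \<nu> ^^ k) (g \<mu>))"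
    using insert.hyps(1) by (induction F rule: finite_induct) (auto simp: shift_op_pow_add)
  have "(shift_op N \<nu> ^^ k) (g \<nu> + (\<Sum>\<mu>\<in>F. g \<mu>)) = 0"
    using insert.prems(2) insert.hyps by simp
  then have "(\<Sum>\<mu>\<in>F. (shift_op N \<nu> ^^ k) (g \<mu>)) = 0" by (simp add: shift_op_pow_add k sum)
  then have "(shift_op N \<nu> ^^ k) (g \<mu>) = 0" if "\<mu> \<in> F" for \<mu>
    using insert.IH[of "\<lambda>\<mu>. (shift_op N \<nu> ^^ k) (g \<mu>)" \<mu>] insert.prems(1) that
    by (auto simp: gen_eig_shift_pow)
  then have z: "g \<mu> = 0" if "\<mu> \<in> F" for \<mu>
    using gen_eig_shift_pow_inj[of "g \<mu>" N \<mu> \<nu> k] insert.prems(1) insert.hyps that by auto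
  then have "g \<nu> = 0" using insert.prems(2) insert.hyps by simp
  then show ?case using z insert.prems(3) by blast
qed simp

text \<open>The index sets are arbitrary finite sets of complex numbers. A number that is not an
  eigenvalue contributes only the zero vector, so finiteness of the spectrum never has to be
  discussed.\<close>

definition gen_sum :: "(complex \<Rightarrow> bool) \<Rightarrow> complex^'n^'n \<Rightarrow> (complex^'n) set" where
  "gen_sum P N = {\<Sum>\<mu>\<in>F. g \<mu> | F g. finite F \<and> (\<forall>\<mu>\<in>F. P \<mu> \<and> g \<mu> \<in> gen_eig N \<mu>)}"

lemma gen_sumI:
  "finite F \<Longrightarrow> (\<And>\<mu>. \<mu> \<in> F \<Longrightarrow> P \<mu>) \<Longrightarrow> (\<And>\<mu>. \<mu> \<in> F \<Longrightarrow> g \<mu> \<in> gen_eig N \<mu>) \<Longrightarrow>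
    v = (\<Sum>\<mu>\<in>F. g \<mu>) \<Longrightarrow> v \<in> gen_sum P N"
  unfolding gen_sum_def by blast

text \<open>The components are normalized to vanish off \<open>F\<close>, so that two
  representations can be compared over the union of their index sets.\<close>

lemma gen_sumE:
  assumes "v \<in> gen_sum P N"
  obtains F g where "finite F" "\<And>\<mu>. \<mu> \<in> F \<Longrightarrow> P \<mu>" "\<And>\<mu>. g \<mu> \<in> gen_eig N \<mu>"
    "\<And>\<mu>. \<mu> \<notin> F \<Longrightarrow> g \<mu> = 0" "v = (\<Sum>\<mu>\<in>F. g \<mu>)"
proof -
  obtain F g where "finite F" "\<forall>\<mu>\<in>F. P \<mu> \<and> g \<mu> \<in> gen_eig N \<mu>" "v = (\<Sum>\<mu>\<in>F. g \<mu>)"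
    using assms unfolding gen_sum_def by blast
  then show ?thesis
    by (intro that[of F "\<lambda>\<mu>. if \<mu> \<in> F then g \<mu> else 0"]) (auto intro: sum.cong)
qed

lemma gen_eig_in_gen_sum: "v \<in> gen_eig N \<mu> \<Longrightarrow> P \<mu> \<Longrightarrow> v \<in> gen_sum P N"
  by (rule gen_sumI[of "{\<mu>}" P "\<lambda>_. v"]) auto

lemma gen_sum_add:
  assumes "v \<in> gen_sum P N" "w \<in> gen_sum P N"
  shows "v + w \<in> gen_sum P N"
proof -
  obtain F g where 1: "finite F" "\<And>\<mu>. \<mu> \<in> F \<Longrightarrow> P \<mu>" "\<And>\<mu>. g \<mu> \<in> gen_eig N \<mu>"
    "\<And>\<mu>. \<mu> \<notin> F \<Longrightarrow> g \<mu> = 0" "v = (\<Sum>\<mu>\<in>F. g \<mu>)" using gen_sumE[OF assms(1)] by metis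
  obtain F' g' where 2: "finite F'" "\<And>\<mu>. \<mu> \<in> F' \<Longrightarrow> P \<mu>" "\<And>\<mu>. g' \<mu> \<in> gen_eig N \<mu>"
    "\<And>\<mu>. \<mu> \<notin> F' \<Longrightarrow> g' \<mu> = 0" "w = (\<Sum>\<mu>\<in>F'. g' \<mu>)" using gen_sumE[OF assms(2)] by metis
  have "v = (\<Sum>\<mu>\<in>F \<union> F'. g \<mu>)" unfolding 1(5) using 1 2 by (intro sum.mono_neutral_left) auto
  moreover have "w = (\<Sum>\<mu>\<in>F \<union> F'. g' \<mu>)" unfolding 2(5) using 1 2 by (intro sum.mono_neutral_left) auto
  ultimately show ?thesis
    using 1 2 by (intro gen_sumI[of "F \<union> F'" P "\<lambda>\<mu>. g \<mu> + g' \<mu>"]) (auto simp: sum.distrib gen_eig_add)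
qed

lemma gen_sum_smult:
  assumes "v \<in> gen_sum P N"
  shows "c *s v \<in> gen_sum P N"
proof -
  obtain F g where 1: "finite F" "\<And>\<mu>. \<mu> \<in> F \<Longrightarrow> P \<mu>" "\<And>\<mu>. g \<mu> \<in> gen_eig N \<mu>"
    "\<And>\<mu>. \<mu> \<notin> F \<Longrightarrow> g \<mu> = 0" "v = (\<Sum>\<mu>\<in>F. g \<mu>)" using gen_sumE[OF assms(1)] by metis
  have "c *s v = (\<Sum>\<mu>\<in>F. c *s g \<mu>)" unfolding 1(5) by (rule vec.scale_sum_right)
  then show ?thesis using 1 by (intro gen_sumI[of F P "\<lambda>\<mu>. c *s g \<mu>"]) (auto simp: gen_eig_smult)
qed

text \<open>By independence the two representations have the same components, which therefore live
  on the common index set. This later turns the intersection of the two centre-extended bundles into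
  the centre bundle.\<close>

lemma gen_sum_Int:
  assumes "v \<in> gen_sum P N" "v \<in> gen_sum Q N"
  shows "v \<in> gen_sum (\<lambda>\<mu>. P \<mu> \<and> Q \<mu>) N"
proof -
  obtain F g where 1: "finite F" "\<And>\<mu>. \<mu> \<in> F \<Longrightarrow> P \<mu>" "\<And>\<mu>. g \<mu> \<in> gen_eig N \<mu>"
    "\<And>\<mu>. \<mu> \<notin> F \<Longrightarrow> g \<mu> = 0" "v = (\<Sum>\<mu>\<in>F. g \<mu>)" using gen_sumE[OF assms(1)] by metis
  obtain F' g' where 2: "finite F'" "\<And>\<mu>. \<mu> \<in> F' \<Longrightarrow> Q \<mu>" "\<And>\<mu>. g' \<mu> \<in> gen_eig N \<mu>"
    "\<And>\<mu>. \<mu> \<notin> F' \<Longrightarrow> g' \<mu> = 0" "v = (\<Sum>\<mu>\<in>F'. g' \<mu>)" using gen_sumE[OF assms(2)] by metis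
  have "v = (\<Sum>\<mu>\<in>F \<union> F'. g \<mu>)" unfolding 1(5) using 1 2 by (intro sum.mono_neutral_left) auto
  moreover have "v = (\<Sum>\<mu>\<in>F \<union> F'. g' \<mu>)" unfolding 2(5) using 1 2 by (intro sum.mono_neutral_left) auto
  ultimately have "(\<Sum>\<mu>\<in>F \<union> F'. g \<mu> - g' \<mu>) = 0"
    by (simp add: sum_subtractf)
  then have "g \<mu> - g' \<mu> = 0" if "\<mu> \<in> F \<union> F'" for \<mu>
    using gen_eig_independent[of "F \<union> F'" "\<lambda>\<mu>. g \<mu> - g' \<mu>" N \<mu>] 1 2 that
    by (auto simp: gen_eig_diff)
  then have eq: "g \<mu> = g' \<mu>" for \<mu>
    using 1(4) 2(4) by (cases "\<mu> \<in> F \<union> F'") auto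
  have "v = (\<Sum>\<mu>\<in>F \<inter> F'. g \<mu>)" unfolding 1(5) using 1 2 eq by (intro sum.mono_neutral_right) auto
  then show ?thesis using 1 2 by (intro gen_sumI[of "F \<inter> F'" _ g]) auto
qed

text \<open>Together with a polynomial \<open>q\<close> of least degree such that \<open>q N v\<close> lies in the sum, this closure property
  replaces the primary decomposition.\<close>

lemma gen_sum_shift_closed:
  assumes "shift_op N \<mu> v \<in> gen_sum (\<lambda>_. True) N"
  shows "v \<in> gen_sum (\<lambda>_. True) N"
proof -
  obtain F g where 1: "finite F" "\<And>\<mu>. g \<mu> \<in> gen_eig N \<mu>"
    "\<And>\<mu>. \<mu> \<notin> F \<Longrightarrow> g \<mu> = 0" "shift_op N \<mu> v = (\<Sum>\<mu>\<in>F. g \<mu>)" using gen_sumE[OF assms] by metis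
  have "\<forall>\<nu>\<in>F - {\<mu>}. \<exists>w. w \<in> gen_eig N \<nu> \<and> shift_op N \<mu> w = g \<nu>"
    using gen_eig_shift_surj 1(2) by fastforce
  then obtain w where w: "\<And>\<nu>. \<nu> \<in> F - {\<mu>} \<Longrightarrow> w \<nu> \<in> gen_eig N \<nu> \<and> shift_op N \<mu> (w \<nu>) = g \<nu>"
    by metis
  \<comment> \<open>\<open>s\<close> is a preimage of all components other than the one for
    \<open>\<mu>\<close>; the remainder \<open>v - s\<close> is mapped into the eigenspace of
    \<open>\<mu>\<close> and thus belongs to it.\<close>
  define s where "s = (\<Sum>\<nu>\<in>F - {\<mu>}. w \<nu>)"
  have sW: "s \<in> gen_sum (\<lambda>_. True) N"
    using 1(1) w by (intro gen_sumI[of "F - {\<mu>}" _ w]) (auto simp: s_def)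
  have "shift_op N \<mu> (\<Sum>\<nu>\<in>G. w \<nu>) = (\<Sum>\<nu>\<in>G. shift_op N \<mu> (w \<nu>))" if "finite G" for G
    using that by (induction G rule: finite_induct) (auto simp: shift_op_add)
  then have "shift_op N \<mu> s = (\<Sum>\<nu>\<in>F - {\<mu>}. g \<nu>)"
    using 1(1) w by (simp add: s_def)
  moreover have "(\<Sum>\<nu>\<in>F. g \<nu>) = g \<mu> + (\<Sum>\<nu>\<in>F - {\<mu>}. g \<nu>)"
    using 1 by (cases "\<mu> \<in> F") (auto simp: sum.remove)
  ultimately have "shift_op N \<mu> (v - s) = g \<mu>"
    by (simp add: shift_op_diff 1(4))
  then have "shift_op N \<mu> (v - s) \<in> gen_eig N \<mu>" using 1(2) by simp
  then obtain k where "(shift_op N \<mu> ^^ Suc k) (v - s) = 0"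
    unfolding gen_eig_def funpow_Suc_right by auto
  then have "v - s \<in> gen_eig N \<mu>" unfolding gen_eig_def by blast
  then have "(v - s) + s \<in> gen_sum (\<lambda>_. True) N"
    by (intro gen_sum_add sW gen_eig_in_gen_sum) auto
  then show ?thesis by simp
qed

section \<open>Polynomials of a matrix and the spanning property of generalized eigenspaces\<close>

lemma of_real_smult_vec: "complex_of_real c *s v = c *\<^sub>R v"
  unfolding vec_eq_iff by (simp add: scaleR_conv_of_real[where 'a = complex])

text \<open>Horner's scheme for the vector \<open>q(N) v\<close>.\<close>

definition poly_act :: "complex^'n^'n \<Rightarrow> complex poly \<Rightarrow> complex^'n \<Rightarrow> complex^'n" where
  "poly_act N q v = fold_coeffs (\<lambda>a w. a *s v + N *v w) q 0"

lemma poly_act_0 [simp]: "poly_act N 0 v = 0"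
  by (simp add: poly_act_def)

lemma poly_act_pCons [simp]: "poly_act N (pCons a q) v = a *s v + N *v poly_act N q v"
  unfolding poly_act_def by (cases "a = 0 \<and> q = 0") auto

lemma poly_act_add: "poly_act N (p + q) v = poly_act N p v + poly_act N q v"
  by (induction p q rule: poly_induct2) (auto simp: matrix_vector_right_distrib vector_sadd_rdistrib)

lemma poly_act_smult: "poly_act N (smult c p) v = c *s poly_act N p v"
  by (induction p) (auto simp: vector_scalar_commute vector_add_ldistrib vector_smult_assoc)

lemma poly_act_linear_factor: "poly_act N ([:-\<mu>, 1:] * q) v = shift_op N \<mu> (poly_act N q v)"
proof -
  have "[:-\<mu>, 1:] * q = smult (-\<mu>) q + pCons 0 q" by (simp add: mult_pCons_left)
  then show ?thesis
    by (simp only: poly_act_add poly_act_smult shift_op_def poly_act_pCons) simp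
qed

lemma poly_act_monom: "poly_act N (monom c i) v = c *s ((*v) N ^^ i) v"
  by (induction i) (auto simp: monom_0 monom_Suc vector_scalar_commute)

text \<open>Dependence is a property of sets and does not see repetitions, so a repeated value is
  treated separately; the difference of its two occurrences is then the relation.\<close>

lemma sequence_linearly_dependent:
  fixes f :: "nat \<Rightarrow> 'a::euclidean_space"
  obtains c i where "i \<le> DIM('a)" "c i \<noteq> 0" "(\<Sum>i\<le>DIM('a). c i *\<^sub>R f i) = 0"
proof (cases "inj_on f {..DIM('a)}")
  case True
  then have "card (f ` {..DIM('a)}) = Suc DIM('a)" by (simp add: card_image)
  then have "dependent (f ` {..DIM('a)})" using independent_bound[of "f ` {..DIM('a)}"] by auto
  then obtain u v where u: "v \<in> f ` {..DIM('a)}" "u v \<noteq> 0" "(\<Sum>v\<in>f ` {..DIM('a)}. u v *\<^sub>R v) = 0"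
    using real_vector.dependent_finite[of "f ` {..DIM('a)}"] by auto
  then show ?thesis
    using True by (auto simp: sum.reindex intro: that[of _ "u \<circ> f"])
next
  case False
  then obtain i j where ij: "i \<le> DIM('a)" "j \<le> DIM('a)" "i \<noteq> j" "f i = f j"
    by (auto simp: inj_on_def)
  let ?c = "\<lambda>k. (if k = i then 1 else 0) - (if k = j then 1 else 0 :: real)"
  have "(\<Sum>k\<le>DIM('a). ?c k *\<^sub>R f k) = (\<Sum>k\<le>DIM('a). (if k = i then f k else 0) - (if k = j then f k else 0))"
    by (rule sum.cong) auto
  also have "\<dots> = 0" using ij by (simp add: sum_subtractf)
  finally show ?thesis using ij by (intro that[of i ?c]) auto
qed

text \<open>Dependence of the iterates \<open>N^i v\<close> provides a nonzero polynomial
  \<open>q\<close> with \<open>q(N) v\<close> in the sum. One of least degree cannot be constant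
  when \<open>v\<close> is outside, and a linear factor could be removed from it by the preceding
  closure property.\<close>

lemma gen_sum_UNIV:
  fixes N :: "complex^'n^'n"
  shows "gen_sum (\<lambda>_. True) N = UNIV"
proof (rule ccontr)
  let ?W = "gen_sum (\<lambda>_. True) N"
  assume "?W \<noteq> UNIV"
  then obtain v where v: "v \<notin> ?W" by blast
  \<comment> \<open>This is the real dimension, and the relation found has real coefficients; both
    are harmless.\<close>
  let ?D = "DIM(complex^'n)"
  obtain c i where ci: "i \<le> ?D" "c i \<noteq> 0" "(\<Sum>i\<le>?D. c i *\<^sub>R ((*v) N ^^ i) v) = 0"
    using sequence_linearly_dependent[of "\<lambda>i. ((*v) N ^^ i) v"] by blast
  define q0 where "q0 = (\<Sum>i\<le>?D. monom (complex_of_real (c i)) i)"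
  have "coeff q0 i = complex_of_real (c i)"
    using ci(1) by (simp add: q0_def coeff_sum)
  then have "q0 \<noteq> 0" using ci(2) by auto
  have "poly_act N (\<Sum>i\<in>F. monom (complex_of_real (c i)) i) v = (\<Sum>i\<in>F. c i *\<^sub>R ((*v) N ^^ i) v)"
    if "finite F" for F
    using that by (induction F rule: finite_induct)
      (auto simp: poly_act_add poly_act_monom of_real_smult_vec)
  then have "poly_act N q0 v = 0" using ci(3) by (simp add: q0_def)
  also have "0 \<in> ?W" by (rule gen_eig_in_gen_sum[of _ _ 0]) auto
  finally have "q0 \<noteq> 0 \<and> poly_act N q0 v \<in> ?W" using \<open>q0 \<noteq> 0\<close> by simp
  then obtain q where q: "q \<noteq> 0" "poly_act N q v \<in> ?W"
    and min: "\<And>r. r \<noteq> 0 \<Longrightarrow> poly_act N r v \<in> ?W \<Longrightarrow> degree q \<le> degree r"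
    using ex_has_least_nat[of "\<lambda>q. q \<noteq> 0 \<and> poly_act N q v \<in> ?W" q0 degree] by blast
  show False
  proof (cases "degree q = 0")
    case True
    then obtain a where a: "q = [:a:]" by (rule degree_eq_zeroE)
    then have "inverse a *s poly_act N q v = v" using q(1) by (simp add: vector_smult_assoc)
    then show False using gen_sum_smult[OF q(2)] v by metis
  next
    case False
    then obtain \<mu> where "poly q \<mu> = 0" using alg_closed_imp_poly_has_root[of q] by auto
    then obtain r where r: "q = [:-\<mu>, 1:] * r" by (auto simp: poly_eq_0_iff_dvd)
    then have "r \<noteq> 0" using q(1) by auto
    then have "degree q = Suc (degree r)" unfolding r by (subst degree_mult_eq) auto
    moreover have "poly_act N r v \<in> ?W"
      using q(2) unfolding r poly_act_linear_factor by (rule gen_sum_shift_closed)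
    ultimately show False using min[OF \<open>r \<noteq> 0\<close>] by auto
  qed
qed

section \<open>Passage between real and complex spectral subspaces\<close>

definition cplx :: "real^'n \<Rightarrow> complex^'n" where "cplx x = (\<chi> i. complex_of_real (x $ i))"
definition Re_vec :: "complex^'n \<Rightarrow> real^'n" where "Re_vec v = (\<chi> i. Re (v $ i))"
definition Im_vec :: "complex^'n \<Rightarrow> real^'n" where "Im_vec v = (\<chi> i. Im (v $ i))"
definition cnj_vec :: "complex^'n \<Rightarrow> complex^'n" where "cnj_vec v = (\<chi> i. cnj (v $ i))"

text \<open>The complex-linear extension of the functional given by \<open>p\<close>. There is no
  conjugation, so that eigenvalues come out as factors.\<close>

definition pairing :: "real^'n \<Rightarrow> complex^'n \<Rightarrow> complex" where
  "pairing p v = Complex (p \<bullet> Re_vec v) (p \<bullet> Im_vec v)"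

lemma Re_vec_add: "Re_vec (v + w) = Re_vec v + Re_vec w"
  and Im_vec_add: "Im_vec (v + w) = Im_vec v + Im_vec w"
  and Re_vec_zero [simp]: "Re_vec 0 = 0"
  and Im_vec_zero [simp]: "Im_vec 0 = 0"
  by (simp_all add: Re_vec_def Im_vec_def vec_eq_iff)

lemma Re_vec_smult: "Re_vec (c *s v) = Re c *\<^sub>R Re_vec v - Im c *\<^sub>R Im_vec v"
  and Im_vec_smult: "Im_vec (c *s v) = Re c *\<^sub>R Im_vec v + Im c *\<^sub>R Re_vec v"
  by (simp_all add: Re_vec_def Im_vec_def vec_eq_iff)

lemma Re_vec_cplx [simp]: "Re_vec (cplx x) = x"
  and Im_vec_cplx [simp]: "Im_vec (cplx x) = 0"
  by (simp_all add: Re_vec_def Im_vec_def cplx_def vec_eq_iff)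

lemma Re_vec_mult: "Re_vec (complexify M *v v) = M *v Re_vec v"
  and Im_vec_mult: "Im_vec (complexify M *v v) = M *v Im_vec v"
  by (simp_all add: Re_vec_def Im_vec_def complexify_def matrix_vector_mult_def vec_eq_iff)

lemma Re_vec_pow_mult: "Re_vec (((*v) (complexify M) ^^ n) v) = ((*v) M ^^ n) (Re_vec v)"
  and Im_vec_pow_mult: "Im_vec (((*v) (complexify M) ^^ n) v) = ((*v) M ^^ n) (Im_vec v)"
  by (induction n) (simp_all add: Re_vec_mult Im_vec_mult)

lemma cplx_Re_vec: "cplx (Re_vec v) = (1/2) *s (v + cnj_vec v)"
  by (simp add: cplx_def Re_vec_def cnj_vec_def vec_eq_iff complex_eq_iff)

lemma cplx_Im_vec: "cplx (Im_vec v) = (-\<i>/2) *s (v + (-1) *s cnj_vec v)"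
  by (simp add: cplx_def Im_vec_def cnj_vec_def vec_eq_iff complex_eq_iff)

lemma cplx_add: "cplx (x + y) = cplx x + cplx y"
  by (simp add: cplx_def vec_eq_iff)

lemma cplx_scaleR: "cplx (c *\<^sub>R x) = complex_of_real c *s cplx x"
  by (simp add: cplx_def vec_eq_iff)

lemma pairing_add: "pairing p (v + w) = pairing p v + pairing p w"
  by (simp add: pairing_def Re_vec_add Im_vec_add inner_add_right complex_eq_iff)

lemma pairing_smult: "pairing p (c *s v) = c * pairing p v"
  by (simp add: pairing_def Re_vec_smult Im_vec_smult inner_add_right inner_diff_right complex_eq_iff)

lemma pairing_zero [simp]: "pairing p 0 = 0"
  by (simp add: pairing_def complex_eq_iff)

lemma pairing_cplx: "pairing p (cplx x) = complex_of_real (p \<bullet> x)"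
  by (simp add: pairing_def complex_eq_iff)

lemma pairing_sum: "pairing p (sum g F) = (\<Sum>\<mu>\<in>F. pairing p (g \<mu>))"
  by (induction F rule: infinite_finite_induct) (auto simp: pairing_add)

lemma shift_op_cnj: "shift_op (complexify M) (cnj \<mu>) (cnj_vec v) = cnj_vec (shift_op (complexify M) \<mu> v)"
  by (simp add: shift_op_def complexify_def cnj_vec_def matrix_vector_mult_def vec_eq_iff)

lemma gen_eig_cnj: "v \<in> gen_eig (complexify M) \<mu> \<Longrightarrow> cnj_vec v \<in> gen_eig (complexify M) (cnj \<mu>)"
proof -
  have "(shift_op (complexify M) (cnj \<mu>) ^^ k) (cnj_vec v) = cnj_vec ((shift_op (complexify M) \<mu> ^^ k) v)" for k
    by (induction k) (auto simp: shift_op_cnj)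
  moreover have "cnj_vec (0 :: complex^'a) = 0" by (simp add: cnj_vec_def vec_eq_iff)
  moreover assume "v \<in> gen_eig (complexify M) \<mu>"
  ultimately show ?thesis unfolding gen_eig_def mem_Collect_eq by metis
qed

lemma gen_eig_nonzero_eigenvalue:
  assumes "v \<in> gen_eig (complexify M) \<mu>" "v \<noteq> 0"
  shows "\<mu> \<in> eigenvalues M"
proof -
  obtain k where "(shift_op (complexify M) \<mu> ^^ k) v = 0" using assms(1) by (auto simp: gen_eig_def)
  then have "\<exists>w. w \<noteq> 0 \<and> shift_op (complexify M) \<mu> w = 0"
    using assms(2)
  proof (induction k arbitrary: v)
    case (Suc k)
    then show ?case by (cases "shift_op (complexify M) \<mu> v = 0") (auto simp: funpow_swap1)
  qed simp
  then show ?thesis by (auto simp: eigenvalues_def shift_op_def)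
qed

lemma real_gen_eigenspace_eq:
  "real_gen_eigenspace M \<mu> = span (Re_vec ` gen_eig (complexify M) \<mu> \<union> Im_vec ` gen_eig (complexify M) \<mu>)"
  by (simp add: real_gen_eigenspace_def gen_eigenspace_eq Re_vec_def[abs_def] Im_vec_def[abs_def])

text \<open>\<open>spectral_subspace\<close> ranges over eigenvalues only, whereas
  \<open>\<mu>\<close> is arbitrary here; a nonzero generalized eigenvector certifies that
  \<open>\<mu>\<close> is an eigenvalue.\<close>

lemma Re_vec_in_spectral_subspace:
  assumes "v \<in> gen_eig (complexify M) \<mu>" "P (cmod \<mu>)"
  shows "Re_vec v \<in> spectral_subspace P M" and "Im_vec v \<in> spectral_subspace P M"
proof -
  have *: "real_gen_eigenspace M \<mu> \<subseteq> spectral_subspace P M" if "v \<noteq> 0"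
    unfolding spectral_subspace_def using gen_eig_nonzero_eigenvalue[OF assms(1) that] assms(2)
    by (intro order_trans[OF _ span_superset]) blast
  have "Re_vec v \<in> real_gen_eigenspace M \<mu>" "Im_vec v \<in> real_gen_eigenspace M \<mu>"
    unfolding real_gen_eigenspace_eq using assms(1) by (auto intro!: span_base)
  then show "Re_vec v \<in> spectral_subspace P M" "Im_vec v \<in> spectral_subspace P M"
    using * by (cases "v = 0"; force simp: spectral_subspace_def span_zero)+
qed

text \<open>Real and imaginary parts are combinations of a vector and its conjugate, which belongs
  to the conjugate eigenvalue. As the condition concerns the modulus only, both eigenvalues satisfy
  it together.\<close>

lemma spectral_subspace_iff:
  "x \<in> spectral_subspace P M \<longleftrightarrow> cplx x \<in> gen_sum (\<lambda>\<mu>. P (cmod \<mu>)) (complexify M)"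
proof
  assume "cplx x \<in> gen_sum (\<lambda>\<mu>. P (cmod \<mu>)) (complexify M)"
  then obtain F g where F: "finite F" "\<And>\<mu>. \<mu> \<in> F \<Longrightarrow> P (cmod \<mu>)" "\<And>\<mu>. g \<mu> \<in> gen_eig (complexify M) \<mu>"
    "cplx x = (\<Sum>\<mu>\<in>F. g \<mu>)" using gen_sumE by metis
  have "\<forall>\<mu>\<in>F. Re_vec (g \<mu>) \<in> spectral_subspace P M"
    using F(2,3) Re_vec_in_spectral_subspace(1) by blast
  then have mem: "(\<Sum>\<mu>\<in>F. Re_vec (g \<mu>)) \<in> spectral_subspace P M"
    unfolding spectral_subspace_def by (intro span_sum) auto
  have "x = Re_vec (\<Sum>\<mu>\<in>F. g \<mu>)" using F(4) by (metis Re_vec_cplx)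
  also have "\<dots> = (\<Sum>\<mu>\<in>F. Re_vec (g \<mu>))" using F(1)
    by (induction F rule: finite_induct) (auto simp: Re_vec_add)
  finally show "x \<in> spectral_subspace P M" using mem by simp
next
  let ?G = "gen_sum (\<lambda>\<mu>. P (cmod \<mu>)) (complexify M)"
  let ?S = "{x. cplx x \<in> ?G}"
  have sub: "subspace ?S"
  proof (rule subspaceI)
    have "cplx 0 = 0" by (simp add: cplx_def vec_eq_iff)
    then show "0 \<in> ?S" by (auto intro: gen_sumI[of "{}"])
  qed (auto simp: cplx_add cplx_scaleR gen_sum_add gen_sum_smult)
  have "real_gen_eigenspace M \<mu> \<subseteq> ?S" if "P (cmod \<mu>)" for \<mu>
    unfolding real_gen_eigenspace_eq
  proof (rule span_minimal[OF _ sub])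
    have *: "cplx (Re_vec v) \<in> ?G \<and> cplx (Im_vec v) \<in> ?G" if v: "v \<in> gen_eig (complexify M) \<mu>" for v
    proof -
      have "v \<in> ?G" "cnj_vec v \<in> ?G"
        using \<open>P (cmod \<mu>)\<close>
        by (auto intro!: gen_eig_in_gen_sum[OF v] gen_eig_in_gen_sum[OF gen_eig_cnj[OF v]])
      then show ?thesis
        unfolding cplx_Re_vec cplx_Im_vec by (blast intro: gen_sum_add gen_sum_smult)
    qed
    then show "Re_vec ` gen_eig (complexify M) \<mu> \<union> Im_vec ` gen_eig (complexify M) \<mu> \<subseteq> ?S" by auto
  qed
  then have "spectral_subspace P M \<subseteq> ?S"
    unfolding spectral_subspace_def by (intro span_minimal sub) auto
  then show "x \<in> spectral_subspace P M \<Longrightarrow> cplx x \<in> ?G" by auto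
qed

lemma spectral_subspace_Int:
  assumes "x \<in> spectral_subspace P M" "x \<in> spectral_subspace Q M"
  shows "x \<in> spectral_subspace (\<lambda>r. P r \<and> Q r) M"
  using assms gen_sum_Int unfolding spectral_subspace_iff by blast

lemma spectral_subspace_disj:
  "spectral_subspace (\<lambda>r. P r \<or> Q r) M =
    {x + y | x y. x \<in> spectral_subspace P M \<and> y \<in> spectral_subspace Q M}"
proof -
  have "(\<Union>\<mu>\<in>{\<mu> \<in> eigenvalues M. P (cmod \<mu>) \<or> Q (cmod \<mu>)}. real_gen_eigenspace M \<mu>) =
    (\<Union>\<mu>\<in>{\<mu> \<in> eigenvalues M. P (cmod \<mu>)}. real_gen_eigenspace M \<mu>) \<union>
    (\<Union>\<mu>\<in>{\<mu> \<in> eigenvalues M. Q (cmod \<mu>)}. real_gen_eigenspace M \<mu>)" by auto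
  then show ?thesis unfolding spectral_subspace_def by (simp only: span_Un)
qed

lemma subspace_spectral_subspace: "subspace (spectral_subspace P M)"
  by (simp add: spectral_subspace_def)

section \<open>Spectral subspaces and iterated sums\<close>

lemma linear_funpow:
  fixes f :: "'a::real_vector \<Rightarrow> 'a"
  assumes "linear f"
  shows "linear (f ^^ k)"
proof (induction k)
  case 0
  show ?case unfolding funpow.simps by (rule linear_id)
next
  case (Suc k)
  show ?case unfolding funpow.simps by (rule linear_compose[OF Suc assms])
qed

lemma matrix_vector_mult_sum: "N *v (\<Sum>i\<in>F. g i) = (\<Sum>i\<in>F. N *v g i)"
  by (induction F rule: infinite_finite_induct) (auto simp: matrix_vector_right_distrib)

text \<open>Writing \<open>N\<close> as \<open>\<mu>\<close> plus \<open>shift_op\<close> turns the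
  pairings along the iterates into a scalar recursion whose inhomogeneity has a smaller nilpotency
  index. Both spectral estimates below are inductions along it.\<close>

lemma pairing_funpow_Suc:
  "pairing p (((*v) N ^^ Suc n) v) =
    \<mu> * pairing p (((*v) N ^^ n) v) + pairing p (((*v) N ^^ n) (shift_op N \<mu> v))"
proof -
  have lin: "((*v) N ^^ n) (a + c *s b) = ((*v) N ^^ n) a + c *s ((*v) N ^^ n) b" for a b c
    by (induction n) (auto simp: matrix_vector_right_distrib vector_scalar_commute)
  have "((*v) N ^^ Suc n) v = ((*v) N ^^ n) (N *v v)" by (simp add: funpow_swap1)
  also have "\<dots> = ((*v) N ^^ n) (shift_op N \<mu> v) + \<mu> *s ((*v) N ^^ n) v"
    unfolding lin[symmetric] by (simp add: shift_op_def)
  finally show ?thesis by (simp add: pairing_add pairing_smult del: funpow.simps)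
qed

text \<open>By induction on the nilpotency index the inhomogeneity vanishes, and the pairings are
  \<open>\<mu>^n\<close> times the first one. Their moduli do not fall below that of the first, yet
  they tend to 0 along the multiples of \<open>m\<close>.\<close>

lemma gen_eig_pairing_zero:
  assumes H: "\<And>x. (\<lambda>j. p \<bullet> (((*v) M ^^ (m * j)) x)) \<longlonglongrightarrow> 0"
    and v: "v \<in> gen_eig (complexify M) \<mu>" and \<mu>: "cmod \<mu> \<ge> 1"
  shows "pairing p v = 0"
proof -
  let ?N = "complexify M"
  have lim: "(\<lambda>j. pairing p (((*v) ?N ^^ (m * j)) v)) \<longlonglongrightarrow> 0" for v
  proof -
    have "(\<lambda>j. Complex (p \<bullet> (((*v) M ^^ (m * j)) (Re_vec v))) (p \<bullet> (((*v) M ^^ (m * j)) (Im_vec v))))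
      \<longlonglongrightarrow> Complex 0 0" by (intro tendsto_Complex H)
    then show ?thesis by (simp add: pairing_def Re_vec_pow_mult Im_vec_pow_mult zero_complex.code)
  qed
  obtain k where "(shift_op ?N \<mu> ^^ k) v = 0" using v by (auto simp: gen_eig_def)
  then show ?thesis
  proof (induction k arbitrary: v)
    case (Suc k)
    have w0: "pairing p (((*v) ?N ^^ n) (shift_op ?N \<mu> v)) = 0" for n
    proof (rule Suc.IH)
      have "(shift_op ?N \<mu> ^^ k) (((*v) ?N ^^ n) w) = ((*v) ?N ^^ n) ((shift_op ?N \<mu> ^^ k) w)" for w
        by (induction n) (auto simp: shift_op_pow_mult)
      moreover have "((*v) ?N ^^ n) 0 = 0" by (induction n) auto
      ultimately show "(shift_op ?N \<mu> ^^ k) (((*v) ?N ^^ n) (shift_op ?N \<mu> v)) = 0"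
        using Suc.prems by (simp add: funpow_swap1)
    qed
    have step: "pairing p (((*v) ?N ^^ Suc n) v) = \<mu> * pairing p (((*v) ?N ^^ n) v)" for n
      unfolding pairing_funpow_Suc[where \<mu> = \<mu>] w0 by simp
    have pow: "pairing p (((*v) ?N ^^ n) v) = \<mu> ^ n * pairing p v" for n
      by (induction n) (simp, simp only: step power_Suc mult.assoc)
    have "1 \<le> cmod \<mu> ^ n" for n using \<mu> by (rule one_le_power)
    then have "cmod (pairing p v) \<le> cmod (pairing p (((*v) ?N ^^ (m * j)) v))" for j
      unfolding pow norm_mult norm_power using mult_right_mono[of 1 "cmod \<mu> ^ (m * j)" "cmod (pairing p v)"] by simp
    then have "cmod (pairing p v) \<le> 0"
      using tendsto_norm_zero[OF lim[of v]] by (intro LIMSEQ_le_const) auto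
    then show ?case by simp
  qed simp
qed

lemma spectral_subspace_inner_zero:
  assumes H: "\<And>x. (\<lambda>j. p \<bullet> (((*v) M ^^ (m * j)) x)) \<longlonglongrightarrow> 0"
    and x: "x \<in> spectral_subspace (\<lambda>r. r \<ge> 1) M"
  shows "p \<bullet> x = 0"
proof -
  obtain F g where F: "\<And>\<mu>. \<mu> \<in> F \<Longrightarrow> 1 \<le> cmod \<mu>" "\<And>\<mu>. g \<mu> \<in> gen_eig (complexify M) \<mu>"
    "cplx x = (\<Sum>\<mu>\<in>F. g \<mu>)" using x unfolding spectral_subspace_iff by (metis gen_sumE)
  have "pairing p (cplx x) = 0"
    unfolding F(3) pairing_sum using gen_eig_pairing_zero[OF H F(2)] F(1) by simp
  then show ?thesis by (simp add: pairing_cplx)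
qed

text \<open>If \<open>S\<close> is stable under \<open>s \<mapsto> b + M\<^sup>m s\<close> for all small \<open>b\<close>, a functional \<open>p\<close> bounded above on \<open>S\<close>
  satisfies \<open>\<Sum>\<^sub>j \<bar>(M\<^sup>*)\<^sup>m\<^sup>j p\<bar> < \<infinity>\<close> and hence annihilates the eigenspaces with \<open>\<bar>\<mu>\<bar> \<ge> 1\<close>, so that no point of
  these can be separated from \<open>S\<close>.\<close>

lemma spectral_subspace_subset:
  fixes M :: "real^'n^'n"
  assumes S: "convex S" "0 \<in> S" and e: "e > 0"
    and step: "\<And>b s. norm b < e \<Longrightarrow> s \<in> S \<Longrightarrow> b + ((*v) M ^^ m) s \<in> S"
  shows "spectral_subspace (\<lambda>r. r \<ge> 1) M \<subseteq> S"
proof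
  fix x assume x: "x \<in> spectral_subspace (\<lambda>r. r \<ge> 1) M"
  show "x \<in> S"
  proof (rule ccontr)
    assume "x \<notin> S"
    then obtain a c where a: "a \<noteq> 0" "a \<bullet> x \<le> c" "\<And>y. y \<in> S \<Longrightarrow> c \<le> a \<bullet> y"
      using separating_hyperplane_sets[of "{x}" S] S by auto
    define p where "p = - a"
    have p: "p \<noteq> 0" and pS: "p \<bullet> y \<le> p \<bullet> x" if "y \<in> S" for y using a(1,2) a(3)[OF that] by (auto simp: p_def)
    then have p0: "p \<noteq> 0" using S(2) by blast
    define q where "q = (\<lambda>j. ((\<lambda>v. v v* M) ^^ (m * j)) p)"
    have adj: "((\<lambda>v. v v* M) ^^ n) p \<bullet> y = p \<bullet> ((*v) M ^^ n) y" for n y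
      by (induction n arbitrary: y) (auto simp: dot_lmul_matrix funpow_swap1)
    have q: "q j \<bullet> y = p \<bullet> ((*v) M ^^ (m * j)) y" for j y by (simp add: q_def adj)
    \<comment> \<open>Admissible small vectors pointing in the direction in which \<open>p\<close>,
      pulled back by \<open>m j\<close> steps, grows most; for \<open>q j = 0\<close> division by
      zero yields the vector 0.\<close>
    define b where "b = (\<lambda>j. (e / 2 / norm (q j)) *\<^sub>R q j)"
    have b: "norm (b j) < e" "q j \<bullet> b j = e / 2 * norm (q j)" for j
    proof -
      show "norm (b j) < e" using e by (cases "q j = 0") (auto simp: b_def)
      show "q j \<bullet> b j = e / 2 * norm (q j)" using e
        by (cases "q j = 0") (auto simp: b_def power2_norm_eq_inner[symmetric] power2_eq_square)
    qed
    \<comment> \<open>The left side is the value of \<open>p\<close> at the nested point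
      \<open>b 0 + M^m (b 1 + ... + M^m (b (n - 1) + M^m s))\<close>, which lies in \<open>S\<close>
      by repeated use of \<open>step\<close>.\<close>
    have claim: "(\<Sum>j<n. e / 2 * norm (q j)) + q n \<bullet> s \<le> p \<bullet> x" if "s \<in> S" for n s
      using that
    proof (induction n arbitrary: s)
      case 0
      then show ?case using pS by (simp add: q_def)
    next
      case (Suc n)
      have "q n \<bullet> (((*v) M ^^ m) s) = q (Suc n) \<bullet> s"
      proof -
        have "m * Suc n = m * n + m" by simp
        then show ?thesis unfolding q by (simp only: funpow_add o_apply)
      qed
      then show ?case using Suc.IH[OF step[OF b(1)[of n] Suc.prems]] b(2)[of n] by (simp add: inner_add_right)
    qed
    have "summable (\<lambda>j. e / 2 * norm (q j))"
    proof (rule summableI_nonneg_bounded)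
      show "(\<Sum>j<n. e / 2 * norm (q j)) \<le> p \<bullet> x" for n
        using claim[OF S(2), of n] by (simp only: inner_zero_right add_0_right)
    qed (use e in auto)
    then have "summable (\<lambda>j. norm (q j))" by (rule summable_mult_D) (use e in simp)
    then have q0: "q \<longlonglongrightarrow> 0" by (rule tendsto_norm_zero_cancel[OF summable_LIMSEQ_zero])
    have "(\<lambda>j. p \<bullet> (((*v) M ^^ (m * j)) y)) \<longlonglongrightarrow> 0" for y
      using tendsto_inner[OF q0 tendsto_const[of y]] by (simp add: q)
    then have "p \<bullet> x = 0" using x by (rule spectral_subspace_inner_zero)
    \<comment> \<open>Already the first summand is positive, which is incompatible with
      \<open>p \<bullet> x = 0\<close>.\<close>
    moreover have "e / 2 * norm (q 0) \<le> p \<bullet> x"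
      using claim[OF S(2), of 1] by (simp only: inner_zero_right add_0_right One_nat_def lessThan_Suc_atMost atMost_0 sum.insert finite.emptyI empty_iff sum.empty simp_thms)
    moreover have "q 0 = p" by (simp add: q_def)
    moreover have "e / 2 * norm p > 0" using p0 e by simp
    ultimately show False by simp
  qed
qed

text \<open>A partial sum \<open>S\<close> of the moduli satisfies
  \<open>S \<le> cmod (a 0) + cmod \<mu> * S + B\<close>, where \<open>B\<close> is the total of the
  inhomogeneity; solving for \<open>S\<close> gives a bound independent of the number of
  terms.\<close>

lemma summable_linear_recursion:
  fixes a b :: "nat \<Rightarrow> complex"
  assumes rec: "\<And>n. a (Suc n) = \<mu> * a n + b n" and \<mu>: "cmod \<mu> < 1" and b: "summable (\<lambda>n. cmod (b n))"
  shows "summable (\<lambda>n. cmod (a n))"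
proof (rule summableI_nonneg_bounded)
  fix n
  let ?B = "\<Sum>n. cmod (b n)" and ?S = "\<Sum>i<n. cmod (a i)"
  have "?S \<le> (\<Sum>i<Suc n. cmod (a i))" by simp
  also have "\<dots> = cmod (a 0) + (\<Sum>i<n. cmod (a (Suc i)))" by (rule sum.lessThan_Suc_shift)
  also have "(\<Sum>i<n. cmod (a (Suc i))) \<le> (\<Sum>i<n. cmod \<mu> * cmod (a i) + cmod (b i))"
    unfolding rec norm_mult[symmetric] by (intro sum_mono norm_triangle_ineq)
  also have "\<dots> = cmod \<mu> * ?S + (\<Sum>i<n. cmod (b i))" by (simp add: sum.distrib sum_distrib_left)
  also have "(\<Sum>i<n. cmod (b i)) \<le> ?B" by (rule sum_le_suminf[OF b]) auto
  finally have "(1 - cmod \<mu>) * ?S \<le> cmod (a 0) + ?B" by (simp add: algebra_simps)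
  then show "?S \<le> (cmod (a 0) + ?B) / (1 - cmod \<mu>)" using \<mu> by (simp add: field_simps)
qed simp

text \<open>For \<open>cmod \<mu> \<ge> 1\<close> the space is invariant under \<open>N\<close> and
  annihilated by \<open>p\<close>, so all terms are zero. Inside the unit disc the recursion
  propagates summability along the nilpotency index.\<close>

lemma gen_eig_pairing_summable:
  assumes p: "\<And>x. x \<in> spectral_subspace (\<lambda>r. r \<ge> 1) M \<Longrightarrow> p \<bullet> x = 0"
    and v: "v \<in> gen_eig (complexify M) \<mu>"
  shows "summable (\<lambda>n. cmod (pairing p (((*v) (complexify M) ^^ n) v)))"
proof (cases "cmod \<mu> \<ge> 1")
  case True
  have "pairing p (((*v) (complexify M) ^^ n) v) = 0" for n
    using Re_vec_in_spectral_subspace[OF gen_eig_pow_mult[OF v, of n], of "\<lambda>r. r \<ge> 1"] True p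
    by (auto simp: pairing_def complex_eq_iff)
  then show ?thesis by simp
next
  case False
  let ?N = "complexify M"
  obtain k where "(shift_op ?N \<mu> ^^ k) v = 0" using v by (auto simp: gen_eig_def)
  then show ?thesis
  proof (induction k arbitrary: v)
    case 0
    have "((*v) ?N ^^ n) 0 = 0" for n by (induction n) auto
    then show ?case using 0 by simp
  next
    case (Suc k)
    have "summable (\<lambda>n. cmod (pairing p (((*v) ?N ^^ n) (shift_op ?N \<mu> v))))"
      using Suc by (simp add: funpow_swap1)
    moreover have "pairing p (((*v) ?N ^^ Suc n) v) = \<mu> * pairing p (((*v) ?N ^^ n) v)
        + pairing p (((*v) ?N ^^ n) (shift_op ?N \<mu> v))" for n by (rule pairing_funpow_Suc)
    ultimately show ?case
      using False summable_linear_recursion[of "\<lambda>n. pairing p (((*v) ?N ^^ n) v)" \<mu>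
        "\<lambda>n. pairing p (((*v) ?N ^^ n) (shift_op ?N \<mu> v))"] by (simp only: not_le simp_thms)
  qed
qed

lemma inner_pow_summable:
  assumes p: "\<And>x. x \<in> spectral_subspace (\<lambda>r. r \<ge> 1) M \<Longrightarrow> p \<bullet> x = 0"
  shows "summable (\<lambda>n. \<bar>p \<bullet> (((*v) M ^^ n) x)\<bar>)"
proof -
  let ?N = "complexify M"
  have "cplx x \<in> gen_sum (\<lambda>_. True) ?N" by (simp add: gen_sum_UNIV)
  then obtain F g where F: "finite F" "\<And>\<mu>. g \<mu> \<in> gen_eig ?N \<mu>" "cplx x = (\<Sum>\<mu>\<in>F. g \<mu>)"
    using gen_sumE by metis
  have lin: "((*v) ?N ^^ n) (\<Sum>\<mu>\<in>F. g \<mu>) = (\<Sum>\<mu>\<in>F. ((*v) ?N ^^ n) (g \<mu>))" for n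
    by (induction n) (auto simp: matrix_vector_mult_sum)
  have cpow: "((*v) ?N ^^ n) (cplx x) = cplx (((*v) M ^^ n) x)" for n
    by (induction n) (auto simp: cplx_def complexify_def matrix_vector_mult_def vec_eq_iff)
  have "\<bar>p \<bullet> (((*v) M ^^ n) x)\<bar> = cmod (\<Sum>\<mu>\<in>F. pairing p (((*v) ?N ^^ n) (g \<mu>)))" for n
    unfolding pairing_sum[symmetric] lin[symmetric] F(3)[symmetric] cpow pairing_cplx by simp
  moreover have "summable (\<lambda>n. \<Sum>\<mu>\<in>F. cmod (pairing p (((*v) ?N ^^ n) (g \<mu>))))"
    by (intro summable_sum) (rule gen_eig_pairing_summable[OF p F(2)])
  ultimately show ?thesis
    by (intro summable_comparison_test[of "\<lambda>n. \<bar>p \<bullet> (((*v) M ^^ n) x)\<bar>"]) (auto intro!: exI[of _ 0] norm_sum)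
qed

text \<open>Unrolling gives \<open>y = q 0 + M (q 1) + M^2 (q 2) + ...\<close> with vectors of norm
  at most \<open>C\<close>, and \<open>p\<close> applied to it is dominated by a convergent series.
  The power \<open>j\<close> in the conclusion is what the induction needs, because removing one
  summand raises it by one.\<close>

lemma inner_bounded_on_iterated_sums:
  fixes M :: "real^'n^'n"
  assumes p: "\<And>x. x \<in> spectral_subspace (\<lambda>r. r \<ge> 1) M \<Longrightarrow> p \<bullet> x = 0"
    and R0: "R 0 \<subseteq> {0}"
    and R: "\<And>n y. y \<in> R (Suc n) \<Longrightarrow> \<exists>q y'. norm q \<le> C \<and> y' \<in> R n \<and> y = q + M *v y'"
  obtains c where "\<And>n j y. y \<in> R n \<Longrightarrow> \<bar>p \<bullet> (((*v) M ^^ j) y)\<bar> \<le> c"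
proof -
  \<comment> \<open>Testing on the basis makes pointwise summability uniform on bounded sets: up to
    the factor \<open>\<bar>C\<bar>\<close>, \<open>a k\<close> bounds \<open>p\<close> on the
    images under \<open>M^k\<close> of all vectors of norm at most \<open>C\<close>.\<close>
  define a where "a = (\<lambda>k. \<Sum>i\<in>Basis. \<bar>p \<bullet> (((*v) M ^^ k) i)\<bar>)"
  have sa: "summable a" unfolding a_def by (intro summable_sum inner_pow_summable[OF p])
  have a0: "a k \<ge> 0" for k by (simp add: a_def sum_nonneg)
  have lin: "linear ((*v) M ^^ k)" for k
    by (intro linear_funpow matrix_vector_mul_linear)
  have q: "\<bar>p \<bullet> (((*v) M ^^ k) q)\<bar> \<le> \<bar>C\<bar> * a k" if "norm q \<le> C" for q k
  proof -
    have "p \<bullet> (((*v) M ^^ k) q) = p \<bullet> (((*v) M ^^ k) (\<Sum>i\<in>Basis. (q \<bullet> i) *\<^sub>R i))"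
      by (simp only: euclidean_representation)
    also have "\<dots> = (\<Sum>i\<in>Basis. (q \<bullet> i) * (p \<bullet> (((*v) M ^^ k) i)))"
      by (simp add: linear_sum[OF lin] linear_cmul[OF lin] inner_sum_right)
    also have "\<bar>\<dots>\<bar> \<le> (\<Sum>i\<in>Basis. \<bar>(q \<bullet> i) * (p \<bullet> (((*v) M ^^ k) i))\<bar>)" by (rule sum_abs)
    also have "\<dots> \<le> (\<Sum>i\<in>Basis. \<bar>C\<bar> * \<bar>p \<bullet> (((*v) M ^^ k) i)\<bar>)"
      unfolding abs_mult using that Basis_le_norm[of _ q] by (intro sum_mono mult_right_mono) force+
    finally show ?thesis by (simp add: a_def sum_distrib_left)
  qed
  have "\<bar>p \<bullet> (((*v) M ^^ j) y)\<bar> \<le> (\<Sum>k<n. \<bar>C\<bar> * a (j + k))" if "y \<in> R n" for n j y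
    using that
  proof (induction n arbitrary: j y)
    case 0
    then show ?case using R0 linear_0[OF lin] by auto
  next
    case (Suc n)
    obtain q' y' where y: "norm q' \<le> C" "y' \<in> R n" "y = q' + M *v y'" using R[OF Suc.prems] by blast
    have "p \<bullet> (((*v) M ^^ j) y) = p \<bullet> (((*v) M ^^ j) q') + p \<bullet> (((*v) M ^^ Suc j) y')"
      unfolding y(3) linear_add[OF lin] by (simp add: inner_add_right funpow_swap1)
    also have "\<bar>\<dots>\<bar> \<le> \<bar>C\<bar> * a j + (\<Sum>k<n. \<bar>C\<bar> * a (Suc j + k))"
      by (intro order_trans[OF abs_triangle_ineq] add_mono q[OF y(1)] Suc.IH[OF y(2)])
    also have "\<dots> = (\<Sum>k<Suc n. \<bar>C\<bar> * a (j + k))"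
      by (simp add: sum.lessThan_Suc_shift del: sum.lessThan_Suc)
    finally show ?case .
  qed
  moreover have "(\<Sum>k<n. \<bar>C\<bar> * a (j + k)) \<le> \<bar>C\<bar> * suminf a" for n j
  proof -
    have "(\<Sum>k<n. a (j + k)) = sum a {j..<j+n}"
      by (simp add: sum.atLeastLessThan_shift_0[of a j] atLeast0LessThan add.commute)
    also have "\<dots> \<le> suminf a" using a0 by (intro sum_le_suminf sa) auto
    finally show ?thesis by (simp add: sum_distrib_left[symmetric] mult_left_mono)
  qed
  ultimately show ?thesis by (intro that[of "\<bar>C\<bar> * suminf a"]) (meson order_trans)
qed

section \<open>Spectral subspaces under similarity and inversion\<close>

lemma complexify_mult: "complexify (M ** N) = complexify M ** complexify N"
  by (simp add: complexify_def matrix_matrix_mult_def vec_eq_iff)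

lemma complexify_mat_1 [simp]: "complexify (mat 1) = mat 1"
  by (simp add: complexify_def mat_def vec_eq_iff)

lemma complexify_mult_vec_inverse:
  assumes "M ** N = mat 1"
  shows "complexify M *v (complexify N *v v) = v"
  using arg_cong[OF assms, of complexify] by (simp add: complexify_mult matrix_vector_mul_assoc)

text \<open>A common frame for similarity, where the eigenvalue is kept, and for inversion, where it
  becomes its reciprocal. The assumption \<open>v \<noteq> 0\<close> gives inversion the means to
  exclude the eigenvalue 0.\<close>

lemma spectral_subspace_image_subset:
  assumes gen: "\<And>\<mu> v. P (cmod \<mu>) \<Longrightarrow> v \<in> gen_eig (complexify M) \<mu> \<Longrightarrow> v \<noteq> 0 \<Longrightarrow>
     \<exists>\<nu>. Q (cmod \<nu>) \<and> complexify X *v v \<in> gen_eig (complexify M') \<nu>"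
  shows "(*v) X ` spectral_subspace P M \<subseteq> spectral_subspace Q M'"
proof -
  let ?S = "{x. X *v x \<in> spectral_subspace Q M'}"
  have sub: "subspace ?S"
    using linear_subspace_vimage[OF matrix_vector_mul_linear subspace_spectral_subspace, of X Q M']
    by (simp add: vimage_def)
  have "real_gen_eigenspace M \<mu> \<subseteq> ?S" if "P (cmod \<mu>)" for \<mu>
    unfolding real_gen_eigenspace_eq
  proof (rule span_minimal[OF _ sub])
    have *: "X *v Re_vec v \<in> spectral_subspace Q M' \<and> X *v Im_vec v \<in> spectral_subspace Q M'"
      if v: "v \<in> gen_eig (complexify M) \<mu>" for v
    proof (cases "v = 0")
      case True
      then show ?thesis using subspace_0[OF subspace_spectral_subspace] by simp
    next
      case False
      then show ?thesis
        using gen[OF \<open>P (cmod \<mu>)\<close> v] Re_vec_in_spectral_subspace[of "complexify X *v v" M' _ Q]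
        by (auto simp: Re_vec_mult Im_vec_mult)
    qed
    then show "Re_vec ` gen_eig (complexify M) \<mu> \<union> Im_vec ` gen_eig (complexify M) \<mu> \<subseteq> ?S" by auto
  qed
  then have "spectral_subspace P M \<subseteq> ?S"
    unfolding spectral_subspace_def[of P M] by (intro span_minimal sub) auto
  then show ?thesis by auto
qed

lemma spectral_subspace_similar_subset:
  fixes X Y M :: "real^'n^'n"
  assumes XY: "X ** Y = mat 1" "Y ** X = mat 1"
  shows "(*v) X ` spectral_subspace P M \<subseteq> spectral_subspace P (X ** M ** Y)"
proof (rule spectral_subspace_image_subset)
  fix \<mu> v assume P: "P (cmod \<mu>)" and v: "v \<in> gen_eig (complexify M) \<mu>"
  let ?X = "complexify X"
  have "shift_op (complexify (X ** M ** Y)) \<mu> (?X *v w) = ?X *v shift_op (complexify M) \<mu> w" for w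
    using complexify_mult_vec_inverse[OF XY(2)]
    by (simp add: shift_op_def complexify_mult matrix_vector_mul_assoc[symmetric]
        matrix_vector_mult_diff_distrib vector_scalar_commute)
  then have "(shift_op (complexify (X ** M ** Y)) \<mu> ^^ k) (?X *v v) = ?X *v (shift_op (complexify M) \<mu> ^^ k) v" for k
    by (induction k) auto
  moreover obtain k where "(shift_op (complexify M) \<mu> ^^ k) v = 0" using v by (auto simp: gen_eig_def)
  ultimately have "(shift_op (complexify (X ** M ** Y)) \<mu> ^^ k) (?X *v v) = 0" by simp
  then have "?X *v v \<in> gen_eig (complexify (X ** M ** Y)) \<mu>" unfolding gen_eig_def by blast
  then show "\<exists>\<nu>. P (cmod \<nu>) \<and> ?X *v v \<in> gen_eig (complexify (X ** M ** Y)) \<nu>" using P by blast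
qed

lemma spectral_subspace_similar:
  fixes X Y M :: "real^'n^'n"
  assumes XY: "X ** Y = mat 1" "Y ** X = mat 1"
  shows "spectral_subspace P (X ** M ** Y) = (*v) X ` spectral_subspace P M"
proof
  show "(*v) X ` spectral_subspace P M \<subseteq> spectral_subspace P (X ** M ** Y)"
    using XY by (rule spectral_subspace_similar_subset)
  have "Y ** (X ** M ** Y) ** X = (Y ** X) ** M ** (Y ** X)" by (simp only: matrix_mul_assoc)
  then have "Y ** (X ** M ** Y) ** X = M" by (simp add: XY)
  then have "(*v) Y ` spectral_subspace P (X ** M ** Y) \<subseteq> spectral_subspace P M"
    using spectral_subspace_similar_subset[OF XY(2,1), of P "X ** M ** Y"] by simp
  then have "(*v) X ` (*v) Y ` spectral_subspace P (X ** M ** Y) \<subseteq> (*v) X ` spectral_subspace P M"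
    by (rule image_mono)
  then show "spectral_subspace P (X ** M ** Y) \<subseteq> (*v) X ` spectral_subspace P M"
    by (simp add: image_image matrix_vector_mul_assoc XY)
qed

text \<open>The identity \<open>N - 1/\<mu> = - (1/\<mu>) N (M - \<mu>)\<close> and the commutation
  of its factors transfer nilpotency from \<open>M - \<mu>\<close> to
  \<open>N - 1/\<mu>\<close>.\<close>

lemma spectral_subspace_inverse_subset:
  assumes MN: "M ** N = mat 1" "N ** M = mat 1"
    and PQ: "\<And>r. r > 0 \<Longrightarrow> P r \<Longrightarrow> Q (1 / r)"
  shows "spectral_subspace P M \<subseteq> spectral_subspace Q N"
proof -
  have "(*v) (mat 1) ` spectral_subspace P M \<subseteq> spectral_subspace Q N"
  proof (rule spectral_subspace_image_subset)
    fix \<mu> v assume P: "P (cmod \<mu>)" and v: "v \<in> gen_eig (complexify M) \<mu>" "v \<noteq> 0"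
    let ?M = "complexify M" and ?N = "complexify N"
    note inv = complexify_mult_vec_inverse[OF MN(1)] complexify_mult_vec_inverse[OF MN(2)]
    \<comment> \<open>For eigenvalue 0 the shift is \<open>M\<close> itself, which is injective, so
      its powers cannot annihilate a nonzero vector.\<close>
    have \<mu>: "\<mu> \<noteq> 0"
    proof
      assume "\<mu> = 0"
      then have "\<And>w. w \<noteq> 0 \<Longrightarrow> shift_op ?M \<mu> w \<noteq> 0"
        using inv(2) by (auto simp: shift_op_def) (metis matrix_vector_mult_0_right)
      then have "(shift_op ?M \<mu> ^^ k) v \<noteq> 0" for k using v(2) by (induction k) auto
      then show False using v(1) by (auto simp: gen_eig_def)
    qed
    have s: "shift_op ?N (1 / \<mu>) w = (- 1 / \<mu>) *s (?N *v shift_op ?M \<mu> w)" for w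
    proof -
      have e: "?N *v shift_op ?M \<mu> w = w - \<mu> *s (?N *v w)"
        by (simp add: shift_op_def matrix_vector_mult_diff_distrib inv(2) vector_scalar_commute)
      show ?thesis unfolding e shift_op_def[of ?N] using \<mu> by (simp add: vec_eq_iff field_simps)
    qed
    have n0: "((*v) ?N ^^ k) 0 = 0" for k by (induction k) auto
    have nc: "shift_op ?M \<mu> (?N *v w) = ?N *v shift_op ?M \<mu> w" for w
      using inv by (simp add: shift_op_def matrix_vector_mult_diff_distrib vector_scalar_commute)
    have nck: "shift_op ?M \<mu> (((*v) ?N ^^ k) w) = ((*v) ?N ^^ k) (shift_op ?M \<mu> w)" for k w
      by (induction k) (auto simp: nc)
    have "(shift_op ?N (1 / \<mu>) ^^ k) v = (- 1 / \<mu>)^k *s ((*v) ?N ^^ k) ((shift_op ?M \<mu> ^^ k) v)" for k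
    proof (induction k)
      case (Suc k)
      have "(shift_op ?N (1 / \<mu>) ^^ Suc k) v =
        (- 1 / \<mu>)^k *s ((- 1 / \<mu>) *s (?N *v shift_op ?M \<mu> (((*v) ?N ^^ k) ((shift_op ?M \<mu> ^^ k) v))))"
        by (simp only: funpow.simps o_apply Suc shift_op_smult s)
      also have "\<dots> = ((- 1 / \<mu>)^k * (- 1 / \<mu>)) *s (?N *v ((*v) ?N ^^ k) (shift_op ?M \<mu> ((shift_op ?M \<mu> ^^ k) v)))"
        by (simp only: nck vector_smult_assoc)
      finally show ?case by (simp only: funpow.simps o_apply power_Suc2)
    qed simp
    moreover obtain k where "(shift_op ?M \<mu> ^^ k) v = 0" using v by (auto simp: gen_eig_def)
    ultimately have "(shift_op ?N (1 / \<mu>) ^^ k) v = 0" by (simp add: n0)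
    then have "v \<in> gen_eig ?N (1 / \<mu>)" unfolding gen_eig_def by blast
    moreover have "Q (cmod (1 / \<mu>))" using PQ[of "cmod \<mu>"] P \<mu> by (simp add: norm_divide)
    ultimately show "\<exists>\<nu>. Q (cmod \<nu>) \<and> complexify (mat 1) *v v \<in> gen_eig ?N \<nu>" by auto
  qed
  then show ?thesis by simp
qed

lemma spectral_subspace_inverse:
  assumes MN: "M ** N = mat 1" "N ** M = mat 1"
  shows "spectral_subspace (\<lambda>r. r \<ge> 1) N = spectral_subspace (\<lambda>r. r \<le> 1) M"
proof (rule subset_antisym)
  show "spectral_subspace (\<lambda>r. r \<ge> 1) N \<subseteq> spectral_subspace (\<lambda>r. r \<le> 1) M"
    by (rule spectral_subspace_inverse_subset[OF MN(2,1)]) (simp add: divide_simps)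
  show "spectral_subspace (\<lambda>r. r \<le> 1) M \<subseteq> spectral_subspace (\<lambda>r. r \<ge> 1) N"
    by (rule spectral_subspace_inverse_subset[OF MN]) (simp add: divide_simps)
qed

section \<open>Periodic linear control systems\<close>

lemma L_infty_UNIV_iff:
  "f \<in> L_infty_on UNIV \<longleftrightarrow> f \<in> borel_measurable lebesgue \<and> (\<exists>C. AE t in lebesgue. norm (f t) \<le> C)"
  unfolding L_infty_on_def lebesgue_on_UNIV_eq mem_Collect_eq ..

lemma measurable_shift_lebesgue: "(\<lambda>r::real. r + c) \<in> lebesgue \<rightarrow>\<^sub>M lebesgue"
  using lebesgue_affine_measurable[of "\<lambda>_. 1" c] by (simp add: add.commute)

lemma AE_lebesgue_shift:
  assumes "AE r in lebesgue. P r"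
  shows "AE r in lebesgue. P (r + c :: real)"
proof -
  obtain N where N: "{r. \<not> P r} \<subseteq> N" "N \<in> null_sets lebesgue"
    using assms by (auto simp: eventually_ae_filter)
  then have "negligible ((\<lambda>r. -c + r) ` N)"
    by (intro negligible_translation) (simp add: negligible_iff_null_sets)
  moreover have "{r. \<not> P (r + c)} \<subseteq> (\<lambda>r. -c + r) ` N"
  proof
    fix r assume "r \<in> {r. \<not> P (r + c)}"
    then have "r + c \<in> N" using N(1) by auto
    then show "r \<in> (\<lambda>r. -c + r) ` N" by (intro image_eqI[of _ _ "r + c"]) auto
  qed
  ultimately show ?thesis unfolding negligible_iff_null_sets eventually_ae_filter by auto
qed

lemma L_infty_shift:
  assumes "f \<in> L_infty_on UNIV"
  shows "(\<lambda>r. f (r + c)) \<in> L_infty_on UNIV"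
  using assms measurable_compose[OF measurable_shift_lebesgue, of f borel c] AE_lebesgue_shift
  unfolding L_infty_UNIV_iff by blast

lemma L_infty_add:
  assumes "f \<in> L_infty_on UNIV" "g \<in> L_infty_on UNIV"
  shows "(\<lambda>r. f r + g r) \<in> L_infty_on UNIV"
proof -
  obtain C D where C: "AE t in lebesgue. norm (f t) \<le> C" and D: "AE t in lebesgue. norm (g t) \<le> D"
    using assms unfolding L_infty_UNIV_iff by blast
  have "AE t in lebesgue. norm (f t + g t) \<le> C + D"
    using C D by eventually_elim (rule norm_triangle_mono)
  then show ?thesis using assms unfolding L_infty_UNIV_iff by (blast intro: borel_measurable_add)
qed

lemma L_infty_scaleR:
  assumes "f \<in> L_infty_on UNIV"
  shows "(\<lambda>r. c *\<^sub>R f r) \<in> L_infty_on UNIV"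
proof -
  obtain C where C: "AE t in lebesgue. norm (f t) \<le> C" using assms unfolding L_infty_UNIV_iff by blast
  have "AE t in lebesgue. norm (c *\<^sub>R f t) \<le> \<bar>c\<bar> * C"
    using C by eventually_elim (simp add: mult_left_mono)
  then show ?thesis using assms by (auto simp: L_infty_UNIV_iff)
qed

lemma L_infty_const: "(\<lambda>_. c) \<in> L_infty_on UNIV"
  unfolding L_infty_UNIV_iff by auto

lemma L_infty_sum:
  assumes "\<And>i. i \<in> I \<Longrightarrow> f i \<in> L_infty_on UNIV"
  shows "(\<lambda>r. \<Sum>i\<in>I. f i r) \<in> L_infty_on UNIV"
  using assms
proof (induction I rule: infinite_finite_induct)
  case (insert i I)
  then show ?case using L_infty_add[of "f i" "\<lambda>r. \<Sum>i\<in>I. f i r"] by simp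
qed (auto simp: L_infty_const)

lemma L_infty_glue:
  assumes "f \<in> L_infty_on UNIV" "g \<in> L_infty_on UNIV"
  shows "(\<lambda>r. if r \<le> c then f r else g r) \<in> L_infty_on UNIV"
proof -
  obtain C D where C: "AE t in lebesgue. norm (f t) \<le> C" and D: "AE t in lebesgue. norm (g t) \<le> D"
    using assms unfolding L_infty_UNIV_iff by blast
  have "AE t in lebesgue. norm (if t \<le> c then f t else g t) \<le> max C D"
    using C D by eventually_elim auto
  moreover have "(\<lambda>r. if r \<le> c then f r else g r) \<in> borel_measurable lebesgue"
  proof (rule measurable_If)
    have "{r \<in> space lebesgue. r \<le> c} = {..c}" by auto
    then show "{r \<in> space lebesgue. r \<le> c} \<in> sets lebesgue" by simp
  qed (use assms in \<open>auto simp: L_infty_UNIV_iff\<close>)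
  ultimately show ?thesis unfolding L_infty_UNIV_iff by blast
qed

lemma L_infty_extend_by_zero:
  assumes "u \<in> L_infty_on {a..b}"
  shows "(\<lambda>t. if t \<in> {a..b} then u t else 0) \<in> L_infty_on UNIV"
proof -
  obtain C where C: "AE t in lebesgue_on {a..b}. norm (u t) \<le> C"
    using assms by (auto simp: L_infty_on_def)
  then have "AE t in lebesgue. t \<in> {a..b} \<longrightarrow> norm (u t) \<le> C"
    by (subst (asm) AE_restrict_space_iff) auto
  then have "AE t in lebesgue. norm (if t \<in> {a..b} then u t else 0) \<le> max C 0"
    by eventually_elim auto
  moreover have "(\<lambda>t. if t \<in> {a..b} then u t else 0) \<in> borel_measurable lebesgue"
    using assms by (subst borel_measurable_if) (auto simp: L_infty_on_def)
  ultimately show ?thesis unfolding L_infty_UNIV_iff by blast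
qed

lemma bounded_bilinear_matrix_vector: "bounded_bilinear (\<lambda>(M::real^'n^'m) x. M *v x)"
  by (intro bilinear_conv_bounded_bilinear[THEN iffD1])
    (auto simp: bilinear_def linear_iff matrix_vector_mult_add_rdistrib matrix_vector_right_distrib
      scaleR_matrix_vector_assoc matrix_vector_mult_scaleR)

lemma bounded_bilinear_matrix_matrix: "bounded_bilinear (\<lambda>(M::real^'n^'m) (N::real^'k^'n). M ** N)"
  by (intro bilinear_conv_bounded_bilinear[THEN iffD1])
    (auto simp: bilinear_def linear_iff matrix_matrix_mult_def vec_eq_iff sum.distrib sum_distrib_left algebra_simps)

lemma bounded_bilinear_borel_measurable:
  fixes F :: "'a::euclidean_space \<Rightarrow> 'b::euclidean_space \<Rightarrow> 'c::euclidean_space"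
  assumes "bounded_bilinear F" "f \<in> borel_measurable M" "g \<in> borel_measurable M"
  shows "(\<lambda>r. F (f r) (g r)) \<in> borel_measurable M"
  using assms(2,3)
  by (rule borel_measurable_continuous_Pair)
    (intro bounded_bilinear.continuous_on[OF assms(1)] continuous_on_fst continuous_on_snd continuous_on_id)

lemma bounded_bilinear_AE_bound:
  assumes "bounded_bilinear F" "f \<in> L_infty_on UNIV"
  obtains K where "K > 0" "AE r in lebesgue. \<forall>x. norm (F (f r) x) \<le> K * norm x"
proof -
  obtain C where C: "AE t in lebesgue. norm (f t) \<le> C" using assms(2) unfolding L_infty_UNIV_iff by blast
  obtain K where K: "K > 0" "\<And>a b. norm (F a b) \<le> norm a * norm b * K"
    using bounded_bilinear.pos_bounded[OF assms(1)] by blast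
  have "AE r in lebesgue. \<forall>x. norm (F (f r) x) \<le> (\<bar>C\<bar> * K + 1) * norm x"
    using C
  proof eventually_elim
    case (elim r)
    show ?case
    proof
      fix x
      have "norm (F (f r) x) \<le> norm (f r) * norm x * K" by (rule K)
      also have "\<dots> = norm (f r) * (norm x * K)" by simp
      also have "\<dots> \<le> \<bar>C\<bar> * (norm x * K)" using elim K(1) by (intro mult_right_mono) auto
      also have "\<dots> \<le> (\<bar>C\<bar> * K + 1) * norm x" by (simp add: algebra_simps)
      finally show "norm (F (f r) x) \<le> (\<bar>C\<bar> * K + 1) * norm x" .
    qed
  qed
  moreover have "\<bar>C\<bar> * K + 1 > 0" using K(1) by (simp add: add_nonneg_pos)
  ultimately show ?thesis using that by blast
qed

text \<open>Covers both the control system and the matrix equation of its fundamental solution.\<close>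

lemma linear_ode_solves:
  fixes F :: "'a::euclidean_space \<Rightarrow> 'b::euclidean_space \<Rightarrow> 'b"
  assumes F: "bounded_bilinear F" and f: "f \<in> L_infty_on UNIV" and g: "g \<in> L_infty_on UNIV"
  defines "h \<equiv> \<lambda>r x. F (f r) x + g r"
  shows "solves h (\<lambda>t. ode_solution h t t0 x0)" and "ode_solution h t0 t0 x0 = x0"
    and "solves h y \<Longrightarrow> ode_solution h t t0 (y t0) = y t"
proof -
  interpret F: bounded_bilinear F by (rule F)
  obtain K where K: "K > 0" "AE r in lebesgue. \<forall>x. norm (F (f r) x) \<le> K * norm x"
    using bounded_bilinear_AE_bound[OF F f] .
  obtain G where G: "AE t in lebesgue. norm (g t) \<le> G" using g unfolding L_infty_UNIV_iff by blast
  have lip: "AE r in lebesgue. \<forall>u v. norm (h r u - h r v) \<le> K * norm (u - v)"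
    using K(2) by eventually_elim (simp add: h_def F.diff_right[symmetric])
  then have lip': "\<exists>L. AE r in lebesgue. \<forall>u v. norm u \<le> k \<longrightarrow> norm v \<le> k \<longrightarrow> norm (h r u - h r v) \<le> L * norm (u - v)" for k
    by (intro exI[of _ K]) (auto elim: eventually_mono)
  obtain x where x: "solves h x" "x t0 = x0"
  proof (rule solves_exists[OF K(1) _ lip])
    fix x :: "real \<Rightarrow> 'b" assume "continuous_on UNIV x"
    then have "x \<in> borel_measurable lebesgue" by (rule continuous_imp_borel_measurable_lebesgue)
    then show "(\<lambda>r. h r (x r)) \<in> borel_measurable lebesgue"
      unfolding h_def using f g bounded_bilinear_borel_measurable[OF F]
      by (intro borel_measurable_add) (auto simp: L_infty_UNIV_iff)
  next
    show "AE r in lebesgue. norm (h r 0) \<le> G" using G by (simp add: h_def F.zero_right)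
  qed
  have e: "ode_solution h t t0 (y t0) = y t" if "solves h y" for y t
    by (rule ode_solution_eqI[OF that lip'])
  show "solves h y \<Longrightarrow> ode_solution h t t0 (y t0) = y t" by (rule e)
  have "ode_solution h t t0 x0 = x t" for t using e[OF x(1)] x(2) by auto
  then show "solves h (\<lambda>t. ode_solution h t t0 x0)" "ode_solution h t0 t0 x0 = x0"
    using x by auto
qed

lemma solves_linear_image:
  assumes x: "solves f x" and h: "bounded_linear h" and g: "\<And>r. g r (h (x r)) = h (f r (x r))"
  shows "solves g (\<lambda>r. h (x r))"
proof -
  have ai: "(\<lambda>r. f r (x r)) absolutely_integrable_on {a..b}"
    and d: "s \<le> t \<Longrightarrow> x t - x s = integral {s..t} (\<lambda>r. f r (x r))" for a b s t
    using x unfolding solves_def by blast+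
  show ?thesis
    unfolding solves_def g
  proof (intro conjI allI impI)
    fix a b show "(\<lambda>r. h (f r (x r))) absolutely_integrable_on {a..b}"
      using absolutely_integrable_linear[OF ai h] by (simp add: o_def)
  next
    fix s t :: real assume "s \<le> t"
    then have "h (x t) - h (x s) = h (integral {s..t} (\<lambda>r. f r (x r)))"
      using d by (simp add: linear_diff[OF bounded_linear.linear[OF h], symmetric])
    also have "\<dots> = integral {s..t} (\<lambda>r. h (f r (x r)))"
      using integral_linear[OF set_lebesgue_integral_eq_integral(1)[OF ai] h] by (simp add: o_def)
    finally show "h (x t) - h (x s) = integral {s..t} (\<lambda>r. h (f r (x r)))" .
  qed
qed

lemma solves_add:
  assumes x: "solves f x" and y: "solves g y" and h: "\<And>r. h r (x r + y r) = f r (x r) + g r (y r)"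
  shows "solves h (\<lambda>r. x r + y r)"
proof -
  have ai: "(\<lambda>r. f r (x r)) absolutely_integrable_on {a..b}" "(\<lambda>r. g r (y r)) absolutely_integrable_on {a..b}"
    and d: "s \<le> t \<Longrightarrow> x t - x s = integral {s..t} (\<lambda>r. f r (x r))"
      "s \<le> t \<Longrightarrow> y t - y s = integral {s..t} (\<lambda>r. g r (y r))" for a b s t
    using x y unfolding solves_def by blast+
  show ?thesis
    unfolding solves_def h
  proof (intro conjI allI impI)
    fix a b show "(\<lambda>r. f r (x r) + g r (y r)) absolutely_integrable_on {a..b}"
      by (rule set_integral_add(1)[OF ai])
  next
    fix s t :: real assume "s \<le> t"
    have "x t + y t - (x s + y s) = (x t - x s) + (y t - y s)" by simp
    also have "\<dots> = integral {s..t} (\<lambda>r. f r (x r) + g r (y r))"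
      unfolding d(1)[OF \<open>s \<le> t\<close>] d(2)[OF \<open>s \<le> t\<close>]
      using ai by (intro Henstock_Kurzweil_Integration.integral_add[symmetric] set_lebesgue_integral_eq_integral(1))
    finally show "x t + y t - (x s + y s) = integral {s..t} (\<lambda>r. f r (x r) + g r (y r))" .
  qed
qed

lemma solves_shift:
  fixes x :: "real \<Rightarrow> 'a::euclidean_space"
  assumes x: "solves f x" and g: "AE r in lebesgue. g r = f (r + c)"
  shows "solves g (\<lambda>r. x (r + c))"
proof -
  let ?F = "\<lambda>r. f r (x r)"
  have ai: "?F absolutely_integrable_on {a..b}"
    and d: "s \<le> t \<Longrightarrow> x t - x s = integral {s..t} ?F" for a b s t
    using x unfolding solves_def by blast+
  obtain N where N: "negligible N" "\<And>r. r \<notin> N \<Longrightarrow> g r = f (r + c)"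
    using g unfolding eventually_ae_filter negligible_iff_null_sets by auto
  have shift: "(\<lambda>r. h (r + c)) integrable_on {a..b}" if "h integrable_on {a+c..b+c}" for h :: "real \<Rightarrow> 'b::banach" and a b
    using that has_integral_shift_Icc_real[of h c _ a b] unfolding integrable_on_def
    by (auto simp: o_def add.commute)
  show ?thesis
    unfolding solves_def
  proof (intro conjI allI impI)
    fix a b
    have "(\<lambda>r. f (r + c) (x (r + c))) absolutely_integrable_on {a..b}"
      using ai[of "a+c" "b+c"] shift[of ?F a b] shift[of "\<lambda>r. norm (?F r)" a b]
      unfolding absolutely_integrable_on_def by auto
    then show "(\<lambda>r. g r (x (r + c))) absolutely_integrable_on {a..b}"
      by (rule absolutely_integrable_spike[OF _ N(1)]) (simp add: N(2))
  next
    fix s t :: real assume "s \<le> t"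
    then have "x (t + c) - x (s + c) = integral {s+c..t+c} ?F" using d by simp
    also have "\<dots> = integral {s..t} (\<lambda>r. f (r + c) (x (r + c)))"
      using integral_shift_Icc_real[of s t ?F c] by (simp add: o_def add.commute)
    also have "\<dots> = integral {s..t} (\<lambda>r. g r (x (r + c)))"
      by (rule integral_spike[OF N(1)]) (simp add: N(2))
    finally show "x (t + c) - x (s + c) = integral {s..t} (\<lambda>r. g r (x (r + c)))" .
  qed
qed

locale periodic_control_system =
  fixes T :: real
    and A :: "real \<Rightarrow> real^'d^'d"
    and B :: "real \<Rightarrow> real^'m^'d"
    and U :: "(real^'m) set"
  assumes T_pos: "T > 0"
    and A_L_infty: "A \<in> L_infty_on UNIV" and A_periodic: "ae_periodic T A"
    and B_L_infty: "B \<in> L_infty_on UNIV" and B_periodic: "ae_periodic T B"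
    and U_bounded: "bounded U" and U_convex: "convex U" and U_nhd: "0 \<in> interior U"
    and controllable: "controllable A B"
begin

abbreviation controls :: "(real \<Rightarrow> real^'m) set" where "controls \<equiv> admissible_controls U"
abbreviation \<phi> where "\<phi> \<equiv> phi A B"
abbreviation X where "X \<equiv> fundamental_solution A"

lemma L_infty_Bu:
  assumes "u \<in> L_infty_on UNIV"
  shows "(\<lambda>r. B r *v u r) \<in> L_infty_on UNIV"
proof -
  obtain K where K: "K > 0" "AE r in lebesgue. \<forall>x. norm (B r *v x) \<le> K * norm x"
    using bounded_bilinear_AE_bound[OF bounded_bilinear_matrix_vector B_L_infty] .
  obtain C where C: "AE t in lebesgue. norm (u t) \<le> C" using assms unfolding L_infty_UNIV_iff by blast
  have "AE r in lebesgue. norm (B r *v u r) \<le> K * C"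
    using K(2) C
  proof eventually_elim
    case (elim r)
    then show ?case using K(1) mult_left_mono[of "norm (u r)" C K] by (meson less_imp_le order_trans)
  qed
  moreover have "(\<lambda>r. B r *v u r) \<in> borel_measurable lebesgue"
    using bounded_bilinear_borel_measurable[OF bounded_bilinear_matrix_vector] assms B_L_infty
    by (auto simp: L_infty_UNIV_iff)
  ultimately show ?thesis unfolding L_infty_UNIV_iff by blast
qed

lemma lin_rhs_eq: "lin_rhs A B u = (\<lambda>r x. A r *v x + B r *v u r)"
  by (simp add: lin_rhs_def fun_eq_iff)

lemma phi_solves:
  assumes "u \<in> L_infty_on UNIV"
  shows "solves (lin_rhs A B u) (\<lambda>t. \<phi> t s x u)"
  using linear_ode_solves(1)[OF bounded_bilinear_matrix_vector A_L_infty L_infty_Bu[OF assms]]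
  by (simp add: phi_def lin_rhs_eq)

lemma phi_init:
  assumes "u \<in> L_infty_on UNIV"
  shows "\<phi> s s x u = x"
  using linear_ode_solves(2)[OF bounded_bilinear_matrix_vector A_L_infty L_infty_Bu[OF assms]]
  by (simp add: phi_def lin_rhs_eq)

lemma phi_unique:
  assumes "u \<in> L_infty_on UNIV" "solves (lin_rhs A B u) y"
  shows "\<phi> t s (y s) u = y t"
  using linear_ode_solves(3)[OF bounded_bilinear_matrix_vector A_L_infty L_infty_Bu[OF assms(1)]] assms(2)
  by (simp add: phi_def lin_rhs_eq)

lemma phi_flow:
  assumes "u \<in> L_infty_on UNIV"
  shows "\<phi> t r (\<phi> r s x u) u = \<phi> t s x u"
  using phi_unique[OF assms phi_solves[OF assms]] .

lemma phi_add:
  assumes "u \<in> L_infty_on UNIV" "v \<in> L_infty_on UNIV"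
  shows "\<phi> t s (x + y) (\<lambda>r. u r + v r) = \<phi> t s x u + \<phi> t s y v"
proof -
  have "solves (lin_rhs A B (\<lambda>r. u r + v r)) (\<lambda>t. \<phi> t s x u + \<phi> t s y v)"
    by (rule solves_add[OF phi_solves[OF assms(1)] phi_solves[OF assms(2)]])
      (simp add: lin_rhs_def matrix_vector_right_distrib)
  from phi_unique[OF L_infty_add[OF assms] this, of t s] show ?thesis by (simp add: phi_init assms)
qed

lemma phi_scaleR:
  assumes "u \<in> L_infty_on UNIV"
  shows "\<phi> t s (c *\<^sub>R x) (\<lambda>r. c *\<^sub>R u r) = c *\<^sub>R \<phi> t s x u"
proof -
  have "solves (lin_rhs A B (\<lambda>r. c *\<^sub>R u r)) (\<lambda>t. c *\<^sub>R \<phi> t s x u)"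
    by (rule solves_linear_image[OF phi_solves[OF assms] bounded_linear_scaleR_right])
      (simp add: lin_rhs_def matrix_vector_mult_scaleR scaleR_add_right)
  from phi_unique[OF L_infty_scaleR[OF assms] this, of t s] show ?thesis by (simp add: phi_init assms)
qed

lemma phi_cong:
  assumes u: "u \<in> L_infty_on UNIV" and v: "v \<in> L_infty_on UNIV"
    and uv: "AE r in lebesgue. r \<in> {min s t..max s t} \<longrightarrow> u r = v r"
  shows "\<phi> t s x u = \<phi> t s x v"
proof (rule solves_unique_interval[OF phi_solves[OF u] phi_solves[OF v],
    where a = "min s t" and b = "max s t" and s = s and t = t])
  show "AE r in lebesgue. r \<in> {min s t..max s t} \<longrightarrow> lin_rhs A B u r = lin_rhs A B v r"
    using uv by eventually_elim (auto simp: lin_rhs_def)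
  obtain K where K: "K > 0" "AE r in lebesgue. \<forall>x. norm (A r *v x) \<le> K * norm x"
    using bounded_bilinear_AE_bound[OF bounded_bilinear_matrix_vector A_L_infty] .
  show "\<exists>L. AE r in lebesgue. \<forall>a b. norm a \<le> k \<longrightarrow> norm b \<le> k \<longrightarrow>
      norm (lin_rhs A B u r a - lin_rhs A B u r b) \<le> L * norm (a - b)" for k
    using K(2) by (intro exI[of _ K], eventually_elim) (simp add: lin_rhs_def matrix_vector_mult_diff_distrib[symmetric])
qed (auto simp: phi_init u v)

lemma fundamental_solves: "solves (\<lambda>r Y. A r ** Y) (\<lambda>t. X t s)"
  and fundamental_init [simp]: "X s s = mat 1"
  using linear_ode_solves(1,2)[OF bounded_bilinear_matrix_matrix A_L_infty L_infty_const[of 0]]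
  by (simp_all add: fundamental_solution_def)

lemma phi_zero_control: "\<phi> t s x (\<lambda>_. 0) = X t s *v x"
proof -
  have "solves (lin_rhs A B (\<lambda>_. 0)) (\<lambda>t. X t s *v x)"
    by (rule solves_linear_image[OF fundamental_solves
        bounded_bilinear.bounded_linear_left[OF bounded_bilinear_matrix_vector]])
      (simp add: lin_rhs_def matrix_vector_mul_assoc)
  from phi_unique[OF L_infty_const this, of t s] show ?thesis by simp
qed

lemma fundamental_flow: "X t r ** X r s = X t s"
  using phi_flow[OF L_infty_const[of 0], of t r s]
  by (simp add: phi_zero_control matrix_eq matrix_vector_mul_assoc)

lemma fundamental_inverse: "X t s ** X s t = mat 1"
  by (simp add: fundamental_flow)

lemma phi_decomp:
  assumes "u \<in> L_infty_on UNIV"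
  shows "\<phi> t s x u = X t s *v x + \<phi> t s 0 u"
  using phi_add[OF L_infty_const[of 0] assms, of t s x 0] by (simp add: phi_zero_control)

text \<open>Since the coefficients are periodic only almost everywhere, equality of the shifted
  fields also holds almost everywhere; \<open>solves_shift\<close> accounts for this. The control is
  written with \<open>r + - T\<close> to match the form \<open>r + c\<close> of the shift
  lemmas.\<close>

lemma phi_shift:
  assumes u: "u \<in> L_infty_on UNIV"
  shows "\<phi> (t + T) (s + T) x (\<lambda>r. u (r + - T)) = \<phi> t s x u"
proof -
  let ?v = "\<lambda>r. u (r + - T)"
  have v: "?v \<in> L_infty_on UNIV" by (rule L_infty_shift[OF u])
  have "solves (lin_rhs A B u) (\<lambda>r. \<phi> (r + T) (s + T) x ?v)"
  proof (rule solves_shift[OF phi_solves[OF v]])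
    show "AE r in lebesgue. lin_rhs A B u r = lin_rhs A B ?v (r + T)"
      using A_periodic B_periodic unfolding ae_periodic_def
      by eventually_elim (simp add: lin_rhs_def fun_eq_iff)
  qed
  from phi_unique[OF u this, of t s] phi_init[OF v, of "s + T" x] show ?thesis by simp
qed

lemma fundamental_shift: "X (t + T) (s + T) = X t s"
  using phi_shift[OF L_infty_const[of 0], of t s] by (simp add: phi_zero_control matrix_eq)

lemma controls_L_infty: "u \<in> controls \<Longrightarrow> u \<in> L_infty_on UNIV"
  by (simp add: admissible_controls_def)

lemma controls_shift:
  assumes "u \<in> controls"
  shows "(\<lambda>r. u (r + c)) \<in> controls"
  using assms L_infty_shift[of u c] AE_lebesgue_shift[of "\<lambda>r. u r \<in> U" c]
  by (auto simp: admissible_controls_def)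

lemma controls_glue:
  assumes "u \<in> controls" "v \<in> controls"
  shows "(\<lambda>r. if r \<le> c then u r else v r) \<in> controls"
proof -
  have "AE r in lebesgue. u r \<in> U" "AE r in lebesgue. v r \<in> U"
    using assms by (auto simp: admissible_controls_def)
  then have "AE r in lebesgue. (if r \<le> c then u r else v r) \<in> U" by eventually_elim auto
  then show ?thesis using assms L_infty_glue[of u v c] by (simp add: admissible_controls_def)
qed

lemma controls_convex:
  assumes "u \<in> controls" "v \<in> controls" "0 \<le> a" "0 \<le> b" "a + b = 1"
  shows "(\<lambda>r. a *\<^sub>R u r + b *\<^sub>R v r) \<in> controls"
proof -
  have "AE r in lebesgue. u r \<in> U" "AE r in lebesgue. v r \<in> U"
    using assms by (auto simp: admissible_controls_def)
  then have "AE r in lebesgue. a *\<^sub>R u r + b *\<^sub>R v r \<in> U"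
    by eventually_elim (intro convexD[OF U_convex] assms(3-5))
  then show ?thesis using assms L_infty_add[OF L_infty_scaleR L_infty_scaleR, of u v a b]
    by (simp add: admissible_controls_def)
qed

lemma zero_controls: "(\<lambda>_. 0) \<in> controls"
  using U_nhd interior_subset[of U] L_infty_const[of 0] by (auto simp: admissible_controls_def)

subsection \<open>Steering in absolute time\<close>

text \<open>The order of the times is part of the relation because \<open>\<phi>\<close> also runs
  backwards.\<close>

definition rch :: "real \<Rightarrow> real^'d \<Rightarrow> real \<Rightarrow> real^'d \<Rightarrow> bool" where
  "rch s x t y \<longleftrightarrow> s \<le> t \<and> (\<exists>u\<in>controls. \<phi> t s x u = y)"

lemma rch_le: "rch s x t y \<Longrightarrow> s \<le> t"
  by (simp add: rch_def)

lemma rch_phi: "u \<in> controls \<Longrightarrow> s \<le> t \<Longrightarrow> rch s x t (\<phi> t s x u)"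
  by (auto simp: rch_def)

lemma rch_zero_control: "s \<le> t \<Longrightarrow> rch s x t (X t s *v x)"
  using rch_phi[OF zero_controls, of s t x] by (simp add: phi_zero_control)

lemma rch_zero: "s \<le> t \<Longrightarrow> rch s 0 t 0"
  using rch_zero_control[of s t 0] by simp

lemma rch_trans:
  assumes "rch r x s y" "rch s y t z"
  shows "rch r x t z"
proof -
  obtain u v where u: "u \<in> controls" "\<phi> s r x u = y" and v: "v \<in> controls" "\<phi> t s y v = z"
    and le: "r \<le> s" "s \<le> t" using assms by (auto simp: rch_def)
  let ?w = "\<lambda>q. if q \<le> s then u q else v q"
  have w: "?w \<in> controls" using u(1) v(1) by (rule controls_glue)
  note L = controls_L_infty[OF w] controls_L_infty[OF u(1)] controls_L_infty[OF v(1)]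
  have "\<phi> s r x ?w = y"
    using phi_cong[OF L(1,2), of r s x] le u(2) by simp
  \<comment> \<open>At the switching time itself the glued control still takes the value of
    \<open>u\<close>, so it agrees with \<open>v\<close> only off a null set.\<close>
  moreover have "AE q in lebesgue. q \<notin> {s}" by (rule AE_not_in) simp
  then have "AE q in lebesgue. q \<in> {min s t..max s t} \<longrightarrow> ?w q = v q"
    by eventually_elim (use le in auto)
  then have "\<phi> t s y ?w = z" using phi_cong[OF L(1,3)] v(2) by simp
  ultimately have "\<phi> t r x ?w = z" using phi_flow[OF L(1), of t s r x] by simp
  then show ?thesis using w le by (auto simp: rch_def)
qed

lemma rch_split:
  assumes "rch r x t z" "r \<le> s" "s \<le> t"
  obtains y where "rch r x s y" "rch s y t z"
proof -
  obtain u where u: "u \<in> controls" "\<phi> t r x u = z" using assms by (auto simp: rch_def)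
  show ?thesis
    using that[of "\<phi> s r x u"] rch_phi[OF u(1) assms(2)] rch_phi[OF u(1) assms(3), of "\<phi> s r x u"]
      phi_flow[OF controls_L_infty[OF u(1)]] u(2) by simp
qed

lemma rch_shift_forward:
  assumes "rch s x t y"
  shows "rch (s + T) x (t + T) y"
proof -
  obtain u where u: "u \<in> controls" "\<phi> t s x u = y" using assms by (auto simp: rch_def)
  have "\<phi> (t + T) (s + T) x (\<lambda>r. u (r + - T)) = y"
    unfolding phi_shift[OF controls_L_infty[OF u(1)]] by (rule u(2))
  then show ?thesis using controls_shift[OF u(1)] assms by (auto simp: rch_def simp del: add_uminus_conv_diff)
qed

lemma rch_shift_back:
  assumes "rch (s + T) x (t + T) y"
  shows "rch s x t y"
proof -
  obtain u where u: "u \<in> controls" "\<phi> (t + T) (s + T) x u = y" using assms by (auto simp: rch_def)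
  let ?v = "\<lambda>r. u (r + T)"
  have v: "?v \<in> controls" by (rule controls_shift[OF u(1)])
  have "\<phi> t s x ?v = y"
    using phi_shift[OF controls_L_infty[OF v], of t s x] u(2) by simp
  then show ?thesis using v assms by (auto simp: rch_def)
qed

lemma rch_shift_nat: "rch (s + real n * T) x (t + real n * T) y \<longleftrightarrow> rch s x t y"
proof (induction n)
  case (Suc n)
  have "rch (s + real (Suc n) * T) x (t + real (Suc n) * T) y \<longleftrightarrow>
    rch ((s + real n * T) + T) x ((t + real n * T) + T) y" by (simp add: algebra_simps)
  then show ?case using Suc rch_shift_forward rch_shift_back by blast
qed simp

lemma rch_shift_int: "rch (s + of_int k * T) x (t + of_int k * T) y \<longleftrightarrow> rch s x t y"
proof (cases "k \<ge> 0")
  case True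
  then show ?thesis using rch_shift_nat[of s "nat k" x t y] by simp
next
  case False
  then show ?thesis using rch_shift_nat[of "s + of_int k * T" "nat (- k)" x "t + of_int k * T" y] by simp
qed

text \<open>States depend linearly on initial state and control jointly, and \<open>U\<close> is
  convex. The times must coincide; resting at the origin will later be used to equalize
  them.\<close>

lemma rch_convex:
  assumes "rch s x t y" "rch s x' t y'" "0 \<le> a" "0 \<le> b" "a + b = 1"
  shows "rch s (a *\<^sub>R x + b *\<^sub>R x') t (a *\<^sub>R y + b *\<^sub>R y')"
proof -
  obtain u v where u: "u \<in> controls" "\<phi> t s x u = y" and v: "v \<in> controls" "\<phi> t s x' v = y'"
    using assms by (auto simp: rch_def)
  note L = controls_L_infty[OF u(1)] controls_L_infty[OF v(1)]
  have "\<phi> t s (a *\<^sub>R x + b *\<^sub>R x') (\<lambda>r. a *\<^sub>R u r + b *\<^sub>R v r) = a *\<^sub>R y + b *\<^sub>R y'"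
    by (simp add: phi_add L_infty_scaleR L phi_scaleR u(2) v(2))
  then show ?thesis using controls_convex[OF u(1) v(1) assms(3-5)] assms(1) by (auto simp: rch_def)
qed

text \<open>By superposition only the deviation from the free motion has to be produced from the
  origin.\<close>

lemma rch_decomp: "rch s x t y \<longleftrightarrow> rch s 0 t (y - X t s *v x)"
proof -
  have "\<phi> t s x u = y \<longleftrightarrow> \<phi> t s 0 u = y - X t s *v x" if "u \<in> controls" for u
    using phi_decomp[OF controls_L_infty[OF that], of t s x] by (auto simp: algebra_simps)
  then show ?thesis by (auto simp: rch_def)
qed

lemma rch_add: "rch s 0 t q \<Longrightarrow> rch s x t (X t s *v x + q)"
  using rch_decomp[of s x t "X t s *v x + q"] by simp

text \<open>The constants depend neither on the control nor on the initial time, because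
  \<open>U\<close> is bounded and the coefficients are essentially bounded. The first estimate
  controls whole periods, the second the displacement over short times.\<close>

lemma phi_growth:
  obtains K b where "K > 0" "b \<ge> 0"
    "\<And>u s t x. u \<in> controls \<Longrightarrow> norm (\<phi> t s x u) \<le> 2 * (norm x + b * \<bar>t - s\<bar>) * exp (2 * K * \<bar>t - s\<bar>)"
    "\<And>u s t x. u \<in> controls \<Longrightarrow> norm (\<phi> t s x u - x) \<le>
       (K * (2 * (norm x + b * \<bar>t - s\<bar>) * exp (2 * K * \<bar>t - s\<bar>)) + b) * \<bar>t - s\<bar>"
proof -
  obtain K where K: "K > 0" "AE r in lebesgue. \<forall>x. norm (A r *v x) \<le> K * norm x"
    using bounded_bilinear_AE_bound[OF bounded_bilinear_matrix_vector A_L_infty] .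
  obtain K' where K': "K' > 0" "AE r in lebesgue. \<forall>x. norm (B r *v x) \<le> K' * norm x"
    using bounded_bilinear_AE_bound[OF bounded_bilinear_matrix_vector B_L_infty] .
  obtain R where R: "R > 0" "\<And>v. v \<in> U \<Longrightarrow> norm v \<le> R" using U_bounded by (auto simp: bounded_pos)
  define b where "b = K' * R"
  have b: "b \<ge> 0" using K'(1) R(1) by (simp add: b_def)
  have inc: "norm (\<phi> t q x u - \<phi> s q x u) \<le> integral {s..t} (\<lambda>r. K * norm (\<phi> r q x u) + b)"
    if u: "u \<in> controls" and st: "s \<le> t" for u s t q x
  proof -
    let ?x = "\<lambda>r. \<phi> r q x u"
    have sol: "solves (lin_rhs A B u) ?x" by (rule phi_solves[OF controls_L_infty[OF u]])
    have cont: "continuous_on S ?x" for S by (rule solves_continuous[OF sol])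
    have xm: "?x \<in> borel_measurable lebesgue" by (rule continuous_imp_borel_measurable_lebesgue[OF cont])
    have m: "(\<lambda>r. lin_rhs A B u r (?x r)) \<in> borel_measurable lebesgue"
      unfolding lin_rhs_def using A_L_infty L_infty_Bu[OF controls_L_infty[OF u]] xm
        bounded_bilinear_borel_measurable[OF bounded_bilinear_matrix_vector]
      by (intro borel_measurable_add) (auto simp: L_infty_UNIV_iff)
    have "AE r in lebesgue. u r \<in> U" using u by (simp add: admissible_controls_def)
    then have ae: "AE r in lebesgue. r \<in> {s..t} \<longrightarrow> norm (lin_rhs A B u r (?x r)) \<le> K * norm (?x r) + b"
      using K(2) K'(2)
    proof eventually_elim
      case (elim r)
      have "norm (B r *v u r) \<le> K' * norm (u r)" using elim by blast
      also have "\<dots> \<le> b" unfolding b_def using K'(1) R(2)[OF elim(1)] by (intro mult_left_mono) auto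
      finally have "norm (lin_rhs A B u r (?x r)) \<le> K * norm (?x r) + b"
        unfolding lin_rhs_def using elim(2) by (intro norm_triangle_mono) auto
      then show ?case by simp
    qed
    have "norm (integral {s..t} (\<lambda>r. lin_rhs A B u r (?x r))) \<le> integral {s..t} (\<lambda>r. K * norm (?x r) + b)"
      by (rule integral_dominated_continuous(2)[OF m _ ae]) (intro continuous_intros cont)
    then show ?thesis using sol st by (simp add: solves_def)
  qed
  have growth: "norm (\<phi> t s x u) \<le> 2 * (norm x + b * \<bar>t - s\<bar>) * exp (2 * K * \<bar>t - s\<bar>)"
    if u: "u \<in> controls" for u s t x
    using gronwall[OF K(1) b _ inc[OF u], of "min s t" "max s t" s x s t]
      solves_continuous[OF phi_solves[OF controls_L_infty[OF u]]] phi_init[OF controls_L_infty[OF u]] by simp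
  show ?thesis
  proof (rule that[OF K(1) b growth])
    fix u s t and x :: "real^'d" assume u: "u \<in> controls"
    let ?G = "2 * (norm x + b * \<bar>t - s\<bar>) * exp (2 * K * \<bar>t - s\<bar>)"
    have G: "K * norm (\<phi> r s x u) + b \<le> K * ?G + b" if "r \<in> {min s t..max s t}" for r
    proof -
      have rs: "\<bar>r - s\<bar> \<le> \<bar>t - s\<bar>" using that by auto
      have "norm (\<phi> r s x u) \<le> 2 * (norm x + b * \<bar>r - s\<bar>) * exp (2 * K * \<bar>r - s\<bar>)" by (rule growth[OF u])
      also have "\<dots> \<le> ?G"
        using rs b K(1) by (intro mult_mono add_mono mult_left_mono) auto
      finally show ?thesis using K(1) by simp
    qed
    have "norm (\<phi> t s x u - x) = norm (\<phi> (max s t) s x u - \<phi> (min s t) s x u)"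
      using phi_init[OF controls_L_infty[OF u]] by (auto simp: min_def max_def norm_minus_commute)
    also have "\<dots> \<le> integral {min s t..max s t} (\<lambda>r. K * norm (\<phi> r s x u) + b)" by (rule inc[OF u]) simp
    also have "\<dots> \<le> integral {min s t..max s t} (\<lambda>r. K * ?G + b)"
      by (rule integral_le[OF _ _ G])
        (intro integrable_continuous_real continuous_intros solves_continuous[OF phi_solves[OF controls_L_infty[OF u]]])+
    also have "\<dots> = (K * ?G + b) * \<bar>t - s\<bar>" by (simp add: min_def max_def)
    finally show "norm (\<phi> t s x u - x) \<le> (K * ?G + b) * \<bar>t - s\<bar>" .
  qed
qed

lemma phi_local_lipschitz:
  obtains C where "C > 0"
    "\<And>u s t x. u \<in> controls \<Longrightarrow> norm x \<le> R \<Longrightarrow> \<bar>t - s\<bar> \<le> 1 \<Longrightarrow> norm (\<phi> t s x u - x) \<le> C * \<bar>t - s\<bar>"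
proof -
  obtain K b where K: "K > 0" "b \<ge> 0" and inc: "\<And>u s t x. u \<in> controls \<Longrightarrow> norm (\<phi> t s x u - x) \<le>
       (K * (2 * (norm x + b * \<bar>t - s\<bar>) * exp (2 * K * \<bar>t - s\<bar>)) + b) * \<bar>t - s\<bar>"
    using phi_growth by metis
  define C where "C = K * (2 * (\<bar>R\<bar> + b) * exp (2 * K)) + b + 1"
  show ?thesis
  proof (rule that)
    show "C > 0" using K by (simp add: C_def add_nonneg_pos)
    fix u s t and x :: "real^'d" assume u: "u \<in> controls" and x: "norm x \<le> R" and st: "\<bar>t - s\<bar> \<le> (1::real)"
    have "2 * (norm x + b * \<bar>t - s\<bar>) * exp (2 * K * \<bar>t - s\<bar>) \<le> 2 * (\<bar>R\<bar> + b * 1) * exp (2 * K * 1)"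
      using K x st by (intro mult_mono add_mono mult_left_mono) auto
    then have "K * (2 * (norm x + b * \<bar>t - s\<bar>) * exp (2 * K * \<bar>t - s\<bar>)) + b \<le> C"
      unfolding C_def mult_1_right using mult_left_mono[OF _ less_imp_le[OF K(1)]] by (smt (verit))
    then show "norm (\<phi> t s x u - x) \<le> C * \<bar>t - s\<bar>"
      by (intro order_trans[OF inc[OF u, of t s x]] mult_right_mono) auto
  qed
qed

text \<open>Both initial points are transported to the common time \<open>s\<close>: this costs
  \<open>C * \<bar>s - s'\<bar>\<close>, and from there on the same control acts, so the difference
  evolves by the fixed matrix \<open>X t s\<close>.\<close>

lemma phi_continuous:
  assumes u: "u \<in> controls" and e: "e > 0"
  obtains \<delta> where "\<delta> > 0"
    "\<And>s' x'. \<bar>s' - s\<bar> < \<delta> \<Longrightarrow> norm (x' - x) < \<delta> \<Longrightarrow> norm (\<phi> t s' x' u - \<phi> t s x u) < e"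
proof -
  note L = controls_L_infty[OF u]
  obtain C where C: "C > 0" "\<And>s t y. norm y \<le> norm x + 1 \<Longrightarrow> \<bar>t - s\<bar> \<le> 1 \<Longrightarrow> norm (\<phi> t s y u - y) \<le> C * \<bar>t - s\<bar>"
    using phi_local_lipschitz[of "norm x + 1"] u by metis
  obtain D where D: "D > 0" "\<And>y. norm (X t s *v y) \<le> D * norm y"
    using bounded_linear.pos_bounded[OF matrix_vector_mul_bounded_linear, of "X t s"] by (auto simp: mult.commute)
  define \<delta> where "\<delta> = min 1 (e / (D * (C + 1)))"
  show ?thesis
  proof (rule that)
    show "\<delta> > 0" using e C D by (simp add: \<delta>_def)
    fix s' x' assume s': "\<bar>s' - s\<bar> < \<delta>" and x': "norm (x' - x) < \<delta>"
    have "norm x' \<le> norm x + norm (x' - x)" using norm_triangle_ineq[of x "x' - x"] by simp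
    then have nx: "norm x' \<le> norm x + 1" using x' by (simp add: \<delta>_def)
    have "\<phi> t s' x' u = X t s *v \<phi> s s' x' u + \<phi> t s 0 u"
      using phi_flow[OF L, of t s s' x'] phi_decomp[OF L, of t s "\<phi> s s' x' u"] by simp
    then have "\<phi> t s' x' u - \<phi> t s x u = X t s *v (\<phi> s s' x' u - x' + (x' - x))"
      using phi_decomp[OF L, of t s x] by (simp add: matrix_vector_mult_diff_distrib)
    then have "norm (\<phi> t s' x' u - \<phi> t s x u) \<le> D * norm (\<phi> s s' x' u - x' + (x' - x))"
      using D(2) by (simp only:)
    also have "\<dots> \<le> D * (C * \<bar>s - s'\<bar> + norm (x' - x))"
      using D(1) C(2)[OF nx, of s s'] s' by (intro mult_left_mono norm_triangle_mono) (auto simp: \<delta>_def)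
    also have "\<dots> < D * (C * \<delta> + \<delta>)"
      using D(1) C(1) s' x' by (intro mult_strict_left_mono add_strict_mono) (auto simp: abs_minus_commute)
    also have "\<dots> = (D * (C + 1)) * \<delta>" by (simp add: algebra_simps)
    also have "\<dots> \<le> (D * (C + 1)) * (e / (D * (C + 1)))"
      using D(1) C(1) by (intro mult_left_mono) (auto simp: \<delta>_def)
    also have "\<dots> = e" using D(1) C(1) by simp
    finally show "norm (\<phi> t s' x' u - \<phi> t s x u) < e" .
  qed
qed

lemma phi_sum:
  assumes "\<And>i. i \<in> I \<Longrightarrow> u i \<in> L_infty_on UNIV"
  shows "\<phi> t s 0 (\<lambda>r. \<Sum>i\<in>I. u i r) = (\<Sum>i\<in>I. \<phi> t s 0 (u i))"
  using assms
proof (induction I rule: infinite_finite_induct)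
  case (insert i I)
  have "\<phi> t s (0 + 0) (\<lambda>r. u i r + (\<Sum>i\<in>I. u i r)) = \<phi> t s 0 (u i) + \<phi> t s 0 (\<lambda>r. \<Sum>i\<in>I. u i r)"
    using insert.prems by (intro phi_add L_infty_sum) auto
  then show ?case using insert by simp
qed (simp_all add: phi_zero_control)

text \<open>Controllability gives a final time depending on \<open>x\<close>. Extending the control
  by zero keeps the state at 0 afterwards, so finitely many vectors can share one later
  time.\<close>

lemma unconstrained_null_control:
  obtains t u where "t > s" "u \<in> L_infty_on UNIV" "\<And>r. r \<ge> t \<Longrightarrow> \<phi> r s x u = 0"
proof -
  obtain t v where t: "t > s" and v: "v \<in> L_infty_on {s..t}"
    and e: "\<phi> t s x (\<lambda>r. if r \<in> {s..t} then v r else 0) = 0"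
    using controllable unfolding controllable_def by metis
  let ?u = "\<lambda>r. if r \<in> {s..t} then v r else 0"
  have u: "?u \<in> L_infty_on UNIV" using v by (rule L_infty_extend_by_zero)
  have "\<phi> r s x ?u = 0" if "r \<ge> t" for r
  proof -
    have "AE q in lebesgue. q \<notin> {t}" by (rule AE_not_in) simp
    then have "AE q in lebesgue. q \<in> {min t r..max t r} \<longrightarrow> ?u q = 0"
      by eventually_elim (use that in auto)
    then have "\<phi> r t 0 ?u = \<phi> r t 0 (\<lambda>_. 0)" by (rule phi_cong[OF u L_infty_const])
    then show ?thesis using phi_flow[OF u, of r t s x] e by (simp add: phi_zero_control)
  qed
  then show ?thesis using that t u by blast
qed

text \<open>If unconstrained controls steer each basis vector to \<open>0\<close>, their linear combinations with small
  coefficients are admissible and steer \<open>0\<close> to all small vectors.\<close>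

lemma rch_ball:
  obtains N e where "N \<ge> 1" "e > 0" "\<And>k b. N \<le> k \<Longrightarrow> norm b < e \<Longrightarrow> rch \<tau> 0 (\<tau> + real k * T) b"
proof -
  have "\<exists>t u. t > \<tau> \<and> u \<in> L_infty_on UNIV \<and> (\<forall>r\<ge>t. \<phi> r \<tau> i u = 0)" for i
    using unconstrained_null_control[of \<tau> i] by metis
  then obtain t u where t: "\<And>i. t i > \<tau>" and u: "\<And>i. u i \<in> L_infty_on UNIV"
    and null: "\<And>i r. r \<ge> t i \<Longrightarrow> \<phi> r \<tau> i (u i) = 0" by metis
  have "\<exists>C. AE r in lebesgue. norm (u i r) \<le> C" for i using u[of i] by (simp add: L_infty_UNIV_iff)
  then obtain C where C: "\<And>i. AE r in lebesgue. norm (u i r) \<le> C i" by metis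
  \<comment> \<open>The sum bounds all the basic controls at once; the summand 1 keeps
    \<open>D\<close> positive for the division below.\<close>
  define D where "D = 1 + (\<Sum>i\<in>Basis. \<bar>C i\<bar>)"
  have D: "D > 0" by (simp add: D_def add_pos_nonneg sum_nonneg)
  obtain N :: nat where N: "(\<Sum>i\<in>Basis. \<bar>t i - \<tau>\<bar>) / T < real N" using reals_Archimedean2 by blast
  define S where "S = \<tau> + real (Suc N) * T"
  have St: "t i \<le> S" if "i \<in> Basis" for i
  proof -
    have "\<bar>t i - \<tau>\<bar> \<le> (\<Sum>i\<in>Basis. \<bar>t i - \<tau>\<bar>)" using that by (intro member_le_sum) auto
    also have "\<dots> \<le> real N * T" using N T_pos by (simp add: field_simps)
    finally show ?thesis using T_pos by (simp add: S_def algebra_simps)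
  qed
  \<comment> \<open>A control that cancels the free motion of \<open>i\<close> produces its negative
    when started at 0; hence the coefficients \<open>- (c \<bullet> i)\<close> below, with
    \<open>c\<close> the vector whose free motion ends in \<open>b\<close>.\<close>
  have e: "\<phi> S \<tau> 0 (u i) = - (X S \<tau> *v i)" if "i \<in> Basis" for i
    using null[OF St[OF that]] phi_decomp[OF u[of i], of S \<tau> i] by (simp add: add_eq_0_iff)
  obtain \<rho> where \<rho>: "\<rho> > 0" "ball 0 \<rho> \<subseteq> U" using U_nhd by (auto simp: mem_interior)
  obtain K where K: "K > 0" "\<And>y. norm (X \<tau> S *v y) \<le> K * norm y"
    using bounded_linear.pos_bounded[OF matrix_vector_mul_bounded_linear, of "X \<tau> S"] by (auto simp: mult.commute)
  define \<epsilon> where "\<epsilon> = \<rho> / (K * D)"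
  have \<epsilon>: "\<epsilon> > 0" using \<rho> K D by (simp add: \<epsilon>_def)
  have main: "rch \<tau> 0 S b" if b: "norm b < \<epsilon>" for b
  proof -
    define c where "c = X \<tau> S *v b"
    define v where "v = (\<lambda>r. \<Sum>i\<in>Basis. (- (c \<bullet> i)) *\<^sub>R u i r)"
    have vL: "v \<in> L_infty_on UNIV" unfolding v_def by (intro L_infty_sum L_infty_scaleR u)
    have e0: "\<phi> S \<tau> 0 (\<lambda>r. a *\<^sub>R u i r) = a *\<^sub>R \<phi> S \<tau> 0 (u i)" for a i
      using phi_scaleR[OF u[of i], of S \<tau> a 0] by simp
    have "\<phi> S \<tau> 0 v = (\<Sum>i\<in>Basis. \<phi> S \<tau> 0 (\<lambda>r. (- (c \<bullet> i)) *\<^sub>R u i r))"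
      unfolding v_def by (intro phi_sum L_infty_scaleR u)
    also have "\<dots> = (\<Sum>i\<in>Basis. (- (c \<bullet> i)) *\<^sub>R \<phi> S \<tau> 0 (u i))"
      by (simp only: e0)
    also have "\<dots> = (\<Sum>i\<in>Basis. X S \<tau> *v ((c \<bullet> i) *\<^sub>R i))"
      by (rule sum.cong) (simp_all add: e matrix_vector_mult_scaleR)
    also have "\<dots> = X S \<tau> *v c" by (simp add: matrix_vector_mult_sum[symmetric] euclidean_representation)
    also have "\<dots> = b" by (simp add: c_def matrix_vector_mul_assoc fundamental_inverse)
    finally have vb: "\<phi> S \<tau> 0 v = b" .
    have nc: "norm c * D < \<rho>"
    proof -
      have "norm c * D \<le> K * norm b * D" unfolding c_def using K(2) D by (intro mult_right_mono) auto
      also have "\<dots> < K * \<epsilon> * D" using b K(1) D by simp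
      also have "\<dots> = \<rho>" using K(1) D by (simp add: \<epsilon>_def)
      finally show ?thesis .
    qed
    have "AE r in lebesgue. \<forall>i\<in>Basis. norm (u i r) \<le> C i"
      by (rule AE_finite_allI) (auto intro: C)
    then have "AE r in lebesgue. v r \<in> U"
    proof eventually_elim
      case (elim r)
      have "norm (v r) \<le> (\<Sum>i\<in>Basis. norm ((- (c \<bullet> i)) *\<^sub>R u i r))" unfolding v_def by (rule norm_sum)
      also have "\<dots> \<le> (\<Sum>i\<in>Basis. norm c * \<bar>C i\<bar>)"
        using elim Basis_le_norm[of _ c] by (intro sum_mono) (auto intro!: mult_mono order_trans[OF _ abs_ge_self])
      also have "\<dots> \<le> norm c * D" by (simp add: D_def sum_distrib_left[symmetric] distrib_left)
      finally show ?case using nc \<rho>(2) by auto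
    qed
    then have "v \<in> controls" using vL by (simp add: admissible_controls_def)
    moreover have "\<tau> \<le> S" using T_pos by (simp add: S_def)
    ultimately show ?thesis using vb by (auto simp: rch_def)
  qed
  show ?thesis
  proof (rule that[of "Suc N" \<epsilon>])
    fix k and b :: "real^'d" assume k: "Suc N \<le> k" and b: "norm b < \<epsilon>"
    \<comment> \<open>For a longer time the system first rests at 0 for the surplus periods.\<close>
    have "rch (\<tau> + real (k - Suc N) * T) 0 (S + real (k - Suc N) * T) b"
      unfolding rch_shift_nat by (rule main[OF b])
    also have "S + real (k - Suc N) * T = \<tau> + real k * T"
      using k by (simp add: S_def of_nat_diff algebra_simps)
    finally have "rch (\<tau> + real (k - Suc N) * T) 0 (\<tau> + real k * T) b" .
    moreover have "rch \<tau> 0 (\<tau> + real (k - Suc N) * T) 0" using T_pos by (intro rch_zero) simp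
    ultimately show "rch \<tau> 0 (\<tau> + real k * T) b" by (rule rch_trans[rotated])
  qed (use \<epsilon> in auto)
qed

text \<open>Steering \<open>y\<close> to 0 amounts to producing the negative of its free motion from
  0, which is small for small \<open>y\<close>.\<close>

lemma rch_ball_back:
  obtains N e where "N \<ge> 1" "e > 0" "\<And>y. norm y < e \<Longrightarrow> rch \<tau> y (\<tau> + real N * T) 0"
proof -
  obtain N e where N: "N \<ge> 1" "e > 0" "\<And>k b. N \<le> k \<Longrightarrow> norm b < e \<Longrightarrow> rch \<tau> 0 (\<tau> + real k * T) b"
    using rch_ball[of \<tau>] by metis
  let ?X = "X (\<tau> + real N * T) \<tau>"
  obtain K where K: "K > 0" "\<And>y. norm (?X *v y) \<le> K * norm y"
    using bounded_linear.pos_bounded[OF matrix_vector_mul_bounded_linear, of ?X] by (auto simp: mult.commute)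
  show ?thesis
  proof (rule that[OF N(1), of "e / K"])
    fix y :: "real^'d" assume "norm y < e / K"
    then have "norm (- (?X *v y)) < e"
      using K(2)[of y] K(1) by (simp add: field_simps)
    then have "rch \<tau> 0 (\<tau> + real N * T) (0 - ?X *v y)" using N(3)[OF order_refl] by simp
    then show "rch \<tau> y (\<tau> + real N * T) 0" by (subst rch_decomp)
  qed (use N K in simp)
qed

end

section \<open>The cylinder of phases and states\<close>

lemma circ_in_S1 [simp]: "circ T t \<in> S1"
  by (simp add: circ_def)

lemma norm_circ [simp]: "cmod (circ T t) = 1"
  by (simp add: circ_def)

lemma circ_eq_iff:
  assumes "T > 0"
  shows "circ T s = circ T t \<longleftrightarrow> (\<exists>k::int. s = t + of_int k * T)"
proof -
  have "circ T s = circ T t \<longleftrightarrow> (\<exists>k::int. 2 * pi * s / T = 2 * pi * t / T + 2 * pi * of_int k)"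
    unfolding circ_def complex_eq_iff cis.sel using sin_cos_eq_iff by blast
  also have "\<dots> \<longleftrightarrow> (\<exists>k::int. s = t + of_int k * T)"
  proof (rule ex_cong1)
    fix k :: int
    have "2 * pi * s / T = 2 * pi * t / T + 2 * pi * of_int k \<longleftrightarrow> (2 * pi) * s = (2 * pi) * (t + of_int k * T)"
      using assms by (simp add: field_simps)
    also have "\<dots> \<longleftrightarrow> s = t + of_int k * T" unfolding mult_cancel_left by simp
    finally show "2 * pi * s / T = 2 * pi * t / T + 2 * pi * of_int k \<longleftrightarrow> s = t + of_int k * T" .
  qed
  finally show ?thesis .
qed

lemma circ_add_int_mult: "T > 0 \<Longrightarrow> circ T (t + of_int k * T) = circ T t"
  by (auto simp: circ_eq_iff)

lemma phase_range:
  assumes "T > 0"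
  shows "0 \<le> phase T z" "phase T z < T"
  using assms Arg2pi_ge_0[of z] Arg2pi_lt_2pi[of z] by (auto simp: phase_def field_simps)

lemma circ_phase:
  assumes "T > 0" "z \<in> S1"
  shows "circ T (phase T z) = z"
proof -
  have "2 * pi * phase T z / T = Arg2pi z" using assms by (simp add: phase_def)
  then show ?thesis using Arg2pi_eq[of z] assms by (simp add: circ_def cis_conv_exp)
qed

lemma phase_circ:
  assumes "T > 0"
  obtains k :: int where "t = phase T (circ T t) + of_int k * T"
  using circ_phase[OF assms circ_in_S1[of T t]] circ_eq_iff[OF assms, of t "phase T (circ T t)"] that by auto

lemma phase_circ_id:
  assumes "T > 0" "t \<in> {0..<T}"
  shows "phase T (circ T t) = t"
proof -
  obtain k :: int where k: "t = phase T (circ T t) + of_int k * T" using phase_circ[OF assms(1)] .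
  have r: "0 \<le> phase T (circ T t)" "phase T (circ T t) < T" using phase_range[OF assms(1)] by auto
  have "k = 0"
  proof (rule ccontr)
    assume "k \<noteq> 0"
    then consider "k \<ge> 1" | "k \<le> -1" by linarith
    then show False
    proof cases
      case 1
      then have "1 * T \<le> real_of_int k * T" using assms(1) by (intro mult_right_mono) auto
      then show False using k r(1) assms(2) unfolding atLeastLessThan_iff by linarith
    next
      case 2
      then have "real_of_int k * T \<le> (-1) * T" using assms(1) by (intro mult_right_mono) auto
      then show False using k r(2) assms(2) unfolding atLeastLessThan_iff by linarith
    qed
  qed
  then show ?thesis using k by simp
qed

lemma continuous_circ: "continuous_on S (circ T)"
  unfolding circ_def[abs_def] divide_inverse by (intro continuous_intros)

text \<open>The lift is found by rotating the base point to 1, where \<open>Arg\<close> is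
  continuous; \<open>phase\<close> itself jumps at phase 0 and could not be used there.\<close>

lemma circ_local_lift:
  assumes T: "T > 0" and d: "d > 0"
  obtains e where "e > 0"
    "\<And>z. z \<in> S1 \<Longrightarrow> dist z (circ T t) < e \<Longrightarrow> \<exists>t'. \<bar>t' - t\<bar> < d \<and> circ T t' = z"
proof -
  have "isCont Arg 1" by (rule continuous_at_Arg) (simp add: complex_nonpos_Reals_iff)
  moreover have "2 * pi * d / T > 0" using T d by simp
  ultimately obtain e where e: "e > 0" "\<And>w. dist w 1 < e \<Longrightarrow> dist (Arg w) (Arg 1) < 2 * pi * d / T"
    unfolding continuous_at_eps_delta by metis
  show ?thesis
  proof (rule that[OF e(1)])
    fix z assume z: "z \<in> S1" "dist z (circ T t) < e"
    define w where "w = z * cnj (circ T t)"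
    have c: "cmod (circ T t) = 1" using circ_in_S1[of T t] by simp
    have cc: "circ T t * cnj (circ T t) = 1" using c by (simp add: complex_norm_square[symmetric])
    have "w - 1 = (z - circ T t) * cnj (circ T t)" using cc by (simp add: w_def algebra_simps)
    then have "dist w 1 = dist z (circ T t)" using c by (simp add: dist_norm norm_mult)
    then have A: "\<bar>Arg w\<bar> < 2 * pi * d / T" using e(2)[of w] z(2) by (simp add: dist_real_def)
    have w1: "cmod w = 1" using z c by (simp add: w_def norm_mult)
    then have "w \<noteq> 0" by auto
    then have cw: "cis (Arg w) = w" using w1 by (simp add: cis_Arg sgn_eq)
    let ?t = "t + T * Arg w / (2 * pi)"
    have "2 * pi * ?t / T = 2 * pi * t / T + Arg w" using T by (simp add: field_simps)
    then have "circ T ?t = circ T t * w" unfolding circ_def using cw by (simp add: cis_mult[symmetric])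
    also have "\<dots> = z" using cc by (simp add: w_def mult.commute mult.left_commute)
    finally have "circ T ?t = z" .
    moreover have "\<bar>?t - t\<bar> < d" using A T by (simp add: abs_mult field_simps)
    ultimately show "\<exists>t'. \<bar>t' - t\<bar> < d \<and> circ T t' = z" by blast
  qed
qed

lemma topspace_cylinder [simp]: "topspace cylinder = S1 \<times> UNIV"
  by (simp add: cylinder_def)

text \<open>Nearby phases lift to nearby times, so openness may be tested in absolute time, in which
  the steering estimates are stated.\<close>

lemma openin_cylinderI:
  fixes S :: "(complex \<times> (real^'d)) set"
  assumes T: "T > 0" and sub: "S \<subseteq> S1 \<times> UNIV"
    and loc: "\<And>t y. (circ T t, y) \<in> S \<Longrightarrow> \<exists>d>0. \<forall>t' y'. \<bar>t' - t\<bar> < d \<longrightarrow> norm (y' - y) < d \<longrightarrow> (circ T t', y') \<in> S"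
  shows "openin cylinder S"
  unfolding cylinder_def openin_euclidean_subtopology_iff
proof (intro conjI sub ballI)
  fix p assume p: "p \<in> S"
  define t y where "t = phase T (fst p)" and "y = snd p"
  have pe: "p = (circ T t, y)" using p sub circ_phase[OF T] by (auto simp: t_def y_def)
  then obtain d where d: "d > 0" "\<And>t' y'. \<bar>t' - t\<bar> < d \<Longrightarrow> norm (y' - y) < d \<Longrightarrow> (circ T t', y') \<in> S"
    using loc[of t y] p by metis
  obtain e where e: "e > 0" "\<And>z. z \<in> S1 \<Longrightarrow> dist z (circ T t) < e \<Longrightarrow> \<exists>t'. \<bar>t' - t\<bar> < d \<and> circ T t' = z"
    using circ_local_lift[OF T d(1)] by metis
  show "\<exists>e>0. \<forall>q\<in>S1 \<times> UNIV. dist q p < e \<longrightarrow> q \<in> S"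
  proof (intro exI conjI ballI impI)
    show "min e d > 0" using e d by simp
    fix q assume q: "q \<in> S1 \<times> UNIV" "dist q p < min e d"
    have "dist (fst q) (circ T t) < e" "dist (snd q) y < d"
      using q(2) dist_fst_le[of q p] dist_snd_le[of q p] by (auto simp: pe)
    then obtain t' where "\<bar>t' - t\<bar> < d" "circ T t' = fst q" using e(2)[of "fst q"] q(1) by auto
    then show "q \<in> S" using d(2)[of t' "snd q"] \<open>dist (snd q) y < d\<close> by (auto simp: dist_norm)
  qed
qed

lemma cylinder_closure_iff:
  fixes S :: "(complex \<times> (real^'d)) set"
  assumes T: "T > 0" and sub: "S \<subseteq> S1 \<times> UNIV"
  shows "(circ T t, y) \<in> cylinder closure_of S \<longleftrightarrow>
    (\<forall>d>0. \<exists>t' y'. (circ T t', y') \<in> S \<and> \<bar>t' - t\<bar> < d \<and> norm (y' - y) < d)"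
proof -
  have cl: "(circ T t, y) \<in> cylinder closure_of S \<longleftrightarrow> (circ T t, y) \<in> closure S"
    using sub by (simp add: cylinder_def closure_of_subtopology Int_absorb1)
  show ?thesis
    unfolding cl closure_approachable
  proof (intro iffI allI impI)
    fix d :: real assume d: "d > 0" and near: "\<forall>e>0. \<exists>q\<in>S. dist q (circ T t, y) < e"
    obtain e where e: "e > 0" "\<And>z. z \<in> S1 \<Longrightarrow> dist z (circ T t) < e \<Longrightarrow> \<exists>t'. \<bar>t' - t\<bar> < d \<and> circ T t' = z"
      using circ_local_lift[OF T d] by metis
    obtain q where q: "q \<in> S" "dist q (circ T t, y) < min e d" using near e(1) d by (metis min_less_iff_conj)
    have fq: "fst q \<in> S1" using q(1) sub by auto
    have "dist (fst q) (circ T t) < e" "dist (snd q) y < d"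
      using q(2) dist_fst_le[of q "(circ T t, y)"] dist_snd_le[of q "(circ T t, y)"] by auto
    moreover then obtain t' where "\<bar>t' - t\<bar> < d" "circ T t' = fst q" using e(2)[OF fq] by auto
    ultimately show "\<exists>t' y'. (circ T t', y') \<in> S \<and> \<bar>t' - t\<bar> < d \<and> norm (y' - y) < d"
      using q(1) by (intro exI[of _ t'] exI[of _ "snd q"]) (auto simp: dist_norm)
  next
    fix e :: real assume e: "e > 0"
      and near: "\<forall>d>0. \<exists>t' y'. (circ T t', y') \<in> S \<and> \<bar>t' - t\<bar> < d \<and> norm (y' - y) < d"
    have "isCont (circ T) t" using continuous_circ[of UNIV T] by (simp add: continuous_on_eq_continuous_at)
    then obtain d where d: "d > 0" "\<And>t'. dist t' t < d \<Longrightarrow> dist (circ T t') (circ T t) < e / 2"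
      using e unfolding continuous_at_eps_delta by (metis half_gt_zero)
    obtain t' y' where t': "(circ T t', y') \<in> S" "\<bar>t' - t\<bar> < min d (e/2)" "norm (y' - y) < min d (e/2)"
      using near d(1) e by (metis half_gt_zero min_less_iff_conj)
    have "dist (circ T t', y') (circ T t, y) \<le> dist (circ T t') (circ T t) + dist y' y"
      unfolding dist_prod_def by (simp add: sqrt_sum_squares_le_sum)
    also have "\<dots> < e" using d(2)[of t'] t' by (simp add: dist_real_def dist_norm)
    finally show "\<exists>q\<in>S. dist q (circ T t, y) < e" using t'(1) by blast
  qed
qed

context periodic_control_system
begin

text \<open>Start and end can be translated together by a multiple of \<open>T\<close>, so the
  chosen representative of the initial phase is immaterial as long as only the phase of the end is
  recorded.\<close>

lemma rch_circ_cong: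
  assumes "circ T s = circ T s'"
  shows "(\<exists>t. P (circ T t) \<and> rch s x t y) \<longleftrightarrow> (\<exists>t. P (circ T t) \<and> rch s' x t y)"
proof -
  have *: "\<exists>t. P (circ T t) \<and> rch s' x t y" if hc: "circ T s = circ T s'" and hP: "P (circ T t)" and hr: "rch s x t y" for s s' t
  proof -
    obtain k :: int where k: "s' = s + of_int k * T"
      using hc[symmetric] circ_eq_iff[OF T_pos, of s' s] by blast
    have "rch s' x (t + of_int k * T) y" unfolding k rch_shift_int by (rule hr)
    moreover have "circ T (t + of_int k * T) = circ T t" by (rule circ_add_int_mult[OF T_pos])
    ultimately show ?thesis using hP by (intro exI[of _ "t + of_int k * T"] conjI) simp_all
  qed
  show ?thesis
  proof
    assume "\<exists>t. P (circ T t) \<and> rch s x t y"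
    then show "\<exists>t. P (circ T t) \<and> rch s' x t y" using *[OF assms] by blast
  next
    assume "\<exists>t. P (circ T t) \<and> rch s' x t y"
    then show "\<exists>t. P (circ T t) \<and> rch s x t y" using *[OF assms[symmetric]] by blast
  qed
qed

lemma phi_a_apply:
  "phi_a T A B t (z, x) u = (circ T (phase T z + t), \<phi> (phase T z + t) (phase T z) x u)"
  by (simp add: phi_a_def autonomized_def Let_def)

lemma reachable_set_iff:
  "p \<in> reachable_set (phi_a T A B) controls (circ T \<tau>, x) \<longleftrightarrow> (\<exists>t y. p = (circ T t, y) \<and> rch \<tau> x t y)"
proof -
  let ?s = "phase T (circ T \<tau>)"
  have "p \<in> reachable_set (phi_a T A B) controls (circ T \<tau>, x) \<longleftrightarrow>
      (\<exists>t u. t \<ge> 0 \<and> u \<in> controls \<and> p = (circ T (?s + t), \<phi> (?s + t) ?s x u))"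
    unfolding reachable_set_def phi_a_apply by blast
  also have "\<dots> \<longleftrightarrow> (\<exists>t. fst p = circ T t \<and> rch ?s x t (snd p))" (is "?L \<longleftrightarrow> ?R")
  proof
    assume ?L
    then obtain t u where "t \<ge> 0" "u \<in> controls" "p = (circ T (?s + t), \<phi> (?s + t) ?s x u)" by blast
    then show ?R using rch_phi[of u ?s "?s + t" x] by auto
  next
    assume ?R
    then obtain t u where t: "fst p = circ T t" "?s \<le> t" "u \<in> controls" "\<phi> t ?s x u = snd p"
      by (auto simp: rch_def)
    then show ?L by (intro exI[of _ "t - ?s"] exI[of _ u]) (auto simp: prod_eq_iff)
  qed
  also have "\<dots> \<longleftrightarrow> (\<exists>t. fst p = circ T t \<and> rch \<tau> x t (snd p))"
    by (rule rch_circ_cong) (rule circ_phase[OF T_pos circ_in_S1])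
  finally show ?thesis by (auto simp: prod_eq_iff)
qed

lemma Reach_iff: "p \<in> Reach_a T A B U \<tau> x \<longleftrightarrow> (\<exists>t y. p = (circ T t, y) \<and> rch \<tau> x t y)"
  unfolding Reach_a_def by (rule reachable_set_iff)

lemma Contr_iff:
  "(circ T s, y) \<in> Contr_a T A B U \<tau> x \<longleftrightarrow> (\<exists>t. circ T t = circ T \<tau> \<and> rch s y t x)"
proof -
  have "(circ T s, y) \<in> Contr_a T A B U \<tau> x \<longleftrightarrow>
      (circ T \<tau>, x) \<in> reachable_set (phi_a T A B) controls (circ T s, y)"
    by (auto simp: Contr_a_def controllable_set_def reachable_set_def eq_commute)
  then show ?thesis unfolding reachable_set_iff by auto
qed

abbreviation "\<R> \<equiv> Reach_a T A B U 0 0"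
abbreviation "\<C> \<equiv> Contr_a T A B U 0 0"

lemma Reach_iff0: "(circ T t, y) \<in> \<R> \<longleftrightarrow> (\<exists>t'. circ T t' = circ T t \<and> rch 0 0 t' y)"
  unfolding Reach_iff by (metis prod.inject)

lemma Contr_iff0: "(circ T s, y) \<in> \<C> \<longleftrightarrow> (\<exists>k::int. rch s y (of_int k * T) 0)"
  unfolding Contr_iff circ_eq_iff[OF T_pos] by auto

lemma Reach_subset: "Reach_a T A B U \<tau> x \<subseteq> S1 \<times> UNIV"
  unfolding subset_iff Reach_iff by auto

lemma Contr_subset: "Contr_a T A B U \<tau> x \<subseteq> S1 \<times> UNIV"
  by (auto simp: Contr_a_def controllable_set_def)

text \<open>Flowing back to phase \<open>0\<close> along a fixed control turns a neighbourhood of a reachable point into one of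
  the origin, which is reachable after a multiple of \<open>T\<close>.\<close>

lemma openin_Reach: "openin cylinder \<R>"
proof (rule openin_cylinderI[OF T_pos Reach_subset])
  fix t y assume "(circ T t, y) \<in> \<R>"
  then obtain t0 where "circ T t0 = circ T t" "rch 0 0 t0 y" unfolding Reach_iff0 by blast
  then have c1: "circ T (t0 + T) = circ T t" and r1: "rch 0 0 (t0 + T) y"
    using circ_add_int_mult[OF T_pos, of t0 1] rch_trans[OF rch_zero[of 0 T]] rch_shift_forward[of 0 0 t0 y] T_pos
    by auto
  define t1 where "t1 = t0 + T"
  \<comment> \<open>The additional period makes the time strictly positive, so that slightly smaller
    times still come after 0; this is the role of \<open>min d t1\<close> below.\<close>
  have t1: "t1 > 0" using rch_le[OF \<open>rch 0 0 t0 y\<close>] T_pos by (simp add: t1_def)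
  obtain u where u: "u \<in> controls" "\<phi> t1 0 0 u = y" using r1 by (auto simp: rch_def t1_def)
  note L = controls_L_infty[OF u(1)]
  have orig: "\<phi> 0 t1 y u = 0" using phi_flow[OF L, of 0 t1 0 0] u(2) by (simp add: phi_init[OF L])
  obtain N e where N: "e > 0" "\<And>b. norm b < e \<Longrightarrow> rch 0 0 (0 + real N * T) b"
    using rch_ball[of 0] by (metis order_refl)
  obtain d where d: "d > 0" "\<And>s' x'. \<bar>s' - t1\<bar> < d \<Longrightarrow> norm (x' - y) < d \<Longrightarrow> norm (\<phi> 0 s' x' u - \<phi> 0 t1 y u) < e"
    using phi_continuous[OF u(1) N(1)] by metis
  obtain k :: int where k: "t1 = t + of_int k * T" using c1 circ_eq_iff[OF T_pos] by (metis t1_def)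
  show "\<exists>d>0. \<forall>t' y'. \<bar>t' - t\<bar> < d \<longrightarrow> norm (y' - y) < d \<longrightarrow> (circ T t', y') \<in> \<R>"
  proof (intro exI[of _ "min d t1"] conjI allI impI)
    show "min d t1 > 0" using d t1 by simp
    fix t' y' assume t': "\<bar>t' - t\<bar> < min d t1" and y': "norm (y' - y) < min d t1"
    let ?s = "t' + of_int k * T"
    have s: "\<bar>?s - t1\<bar> < min d t1" using t' k by simp
    then have "norm (\<phi> 0 ?s y' u) < e" using d(2)[of ?s y'] y' orig by simp
    then have "rch 0 0 (real N * T) (\<phi> 0 ?s y' u)" using N(2) by simp
    moreover have "0 \<le> ?s" using s by linarith
    then have "rch 0 (\<phi> 0 ?s y' u) ?s y'"
      using rch_phi[OF u(1), of 0 ?s "\<phi> 0 ?s y' u"] phi_flow[OF L, of ?s 0 ?s y'] by (simp add: phi_init[OF L])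
    then have "rch (0 + real N * T) (\<phi> 0 ?s y' u) (?s + real N * T) y'" unfolding rch_shift_nat .
    ultimately have "rch 0 0 (?s + real N * T) y'" using rch_trans by simp
    moreover have "circ T (?s + real N * T) = circ T t'"
      using circ_add_int_mult[OF T_pos, of t' "k + int N"] by (simp add: algebra_simps)
    ultimately show "(circ T t', y') \<in> \<R>" unfolding Reach_iff0 by blast
  qed
qed

text \<open>The control steering \<open>y\<close> to 0 carries neighbours into a small ball about 0,
  which is then absorbed. The arrival is delayed by one period so that slightly later starting times
  remain before it.\<close>

lemma openin_Contr: "openin cylinder \<C>"
proof (rule openin_cylinderI[OF T_pos Contr_subset])
  fix t y assume "(circ T t, y) \<in> \<C>"
  then obtain k0 :: int where "rch t y (of_int k0 * T) 0" unfolding Contr_iff0 by blast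
  moreover define t1 where "t1 = of_int (k0 + 1) * T"
  ultimately have t1: "rch t y t1 0" "t < t1"
    using rch_trans[OF _ rch_zero[of "of_int k0 * T" t1]] rch_le[of t y "of_int k0 * T" 0] T_pos
    by (auto simp: t1_def algebra_simps)
  obtain u where u: "u \<in> controls" "\<phi> t1 t y u = 0" using t1 by (auto simp: rch_def)
  obtain N e where N: "e > 0" "\<And>y. norm y < e \<Longrightarrow> rch t1 y (t1 + real N * T) 0"
    using rch_ball_back[of t1] by metis
  obtain d where d: "d > 0" "\<And>s' x'. \<bar>s' - t\<bar> < d \<Longrightarrow> norm (x' - y) < d \<Longrightarrow> norm (\<phi> t1 s' x' u - \<phi> t1 t y u) < e"
    using phi_continuous[OF u(1) N(1)] by metis
  show "\<exists>d>0. \<forall>t' y'. \<bar>t' - t\<bar> < d \<longrightarrow> norm (y' - y) < d \<longrightarrow> (circ T t', y') \<in> \<C>"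
  proof (intro exI[of _ "min d (t1 - t)"] conjI allI impI)
    show "min d (t1 - t) > 0" using d t1 by simp
    fix t' y' assume t': "\<bar>t' - t\<bar> < min d (t1 - t)" and y': "norm (y' - y) < min d (t1 - t)"
    then have "norm (\<phi> t1 t' y' u) < e" using d(2)[of t' y'] u(2) by simp
    then have "rch t1 (\<phi> t1 t' y' u) (t1 + real N * T) 0" by (rule N(2))
    moreover have "rch t' y' t1 (\<phi> t1 t' y' u)" using t' by (intro rch_phi[OF u(1)]) auto
    ultimately have "rch t' y' (t1 + real N * T) 0" using rch_trans by blast
    moreover have "t1 + real N * T = of_int (k0 + 1 + int N) * T" by (simp add: t1_def algebra_simps)
    ultimately show "(circ T t', y') \<in> \<C>" unfolding Contr_iff0 by metis
  qed
qed

section \<open>Spectral subspaces and the steering sets over the period map\<close>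

lemma fundamental_shift_nat: "X (t + real n * T) (s + real n * T) = X t s"
proof (induction n)
  case (Suc n)
  have "X (t + real (Suc n) * T) (s + real (Suc n) * T) = X ((t + real n * T) + T) ((s + real n * T) + T)"
    by (simp add: algebra_simps)
  then show ?case using Suc fundamental_shift by metis
qed simp

lemma fundamental_pow: "X (real n * T) 0 *v y = ((*v) (X T 0) ^^ n) y"
proof (induction n)
  case (Suc n)
  have "X (real (Suc n) * T) 0 = X (T + real n * T) (0 + real n * T) ** X (real n * T) 0"
    by (simp add: fundamental_flow algebra_simps)
  then show ?case unfolding fundamental_shift_nat using Suc by (simp add: matrix_vector_mul_assoc[symmetric])
qed simp

lemma fundamental_inverse_pow: "X 0 (real n * T) *v y = ((*v) (X 0 T) ^^ n) y"
proof (induction n)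
  case (Suc n)
  have "X 0 (real (Suc n) * T) = X 0 T ** X (0 + real 1 * T) (real n * T + real 1 * T)"
    by (simp add: fundamental_flow algebra_simps)
  then show ?case unfolding fundamental_shift_nat using Suc by (simp add: matrix_vector_mul_assoc[symmetric])
qed simp

lemma rch_from_zero_mono:
  assumes "rch 0 0 (real n * T) y" "n \<le> k"
  shows "rch 0 0 (real k * T) y"
proof -
  have "rch (0 + real (k - n) * T) 0 (real n * T + real (k - n) * T) y"
    unfolding rch_shift_nat by (rule assms(1))
  moreover have "real n * T + real (k - n) * T = real k * T"
    using assms(2) by (simp add: of_nat_diff algebra_simps)
  ultimately have "rch (real (k - n) * T) 0 (real k * T) y" by simp
  then show ?thesis using rch_trans[OF rch_zero[of 0 "real (k - n) * T"]] T_pos by simp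
qed

lemma rch_to_zero_mono:
  assumes "rch 0 y (real n * T) 0" "n \<le> k"
  shows "rch 0 y (real k * T) 0"
proof -
  have "real n * T \<le> real k * T" using assms(2) T_pos by (intro mult_right_mono) auto
  then show ?thesis by (rule rch_trans[OF assms(1) rch_zero])
qed

lemma matrix_bound:
  obtains K where "K > 0" "\<And>y. norm ((Q::real^'n^'k) *v y) \<le> K * norm y"
proof -
  obtain K where K: "K > 0" "\<And>y. norm (Q *v y) \<le> norm y * K"
    using bounded_linear.pos_bounded[OF matrix_vector_mul_bounded_linear, of Q] by blast
  show ?thesis using that[OF K(1)] K(2) by (simp add: mult.commute)
qed

text \<open>The separation argument applies to the union over all numbers of periods: it is convex
  because the sets increase by resting at 0, and a further block of \<open>N\<close> periods maps
  \<open>s\<close> to its free motion plus any small \<open>b\<close>.\<close>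

lemma spectral_subspace_reachable:
  assumes "x \<in> spectral_subspace (\<lambda>r. r \<ge> 1) (X T 0)"
  shows "\<exists>n. rch 0 0 (real n * T) x"
proof -
  let ?S = "{y. \<exists>n. rch 0 0 (real n * T) y}"
  obtain N e where N: "e > 0" "\<And>b. norm b < e \<Longrightarrow> rch 0 0 (0 + real N * T) b"
    using rch_ball[of 0] by (metis order_refl)
  have "spectral_subspace (\<lambda>r. r \<ge> 1) (X T 0) \<subseteq> ?S"
  proof (rule spectral_subspace_subset[OF _ _ N(1)])
    show "convex ?S"
    proof (rule convexI, clarsimp)
      fix y z a b n k
      assume "rch 0 0 (real n * T) y" "rch 0 0 (real k * T) z" and ab: "0 \<le> a" "0 \<le> b" "a + b = (1::real)"
      then have "rch 0 0 (real (max n k) * T) y" "rch 0 0 (real (max n k) * T) z"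
        by (auto intro: rch_from_zero_mono)
      from rch_convex[OF this ab] show "\<exists>n. rch 0 0 (real n * T) (a *\<^sub>R y + b *\<^sub>R z)" by auto
    qed
    show "0 \<in> ?S" using rch_zero[of 0 0] by (auto intro!: exI[of _ 0])
    fix b s :: "real^'d" assume b: "norm b < e" and "s \<in> ?S"
    then obtain n where n: "rch 0 0 (real n * T) s" by blast
    have "rch 0 s (0 + real N * T) (X (0 + real N * T) 0 *v s + b)" by (rule rch_add[OF N(2)[OF b]])
    then have "rch 0 s (real N * T) (b + ((*v) (X T 0) ^^ N) s)" by (simp add: fundamental_pow add.commute)
    then have "rch (0 + real n * T) s (real N * T + real n * T) (b + ((*v) (X T 0) ^^ N) s)"
      unfolding rch_shift_nat .
    then have "rch 0 0 (real N * T + real n * T) (b + ((*v) (X T 0) ^^ N) s)"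
      using rch_trans[OF n] by simp
    then show "b + ((*v) (X T 0) ^^ N) s \<in> ?S"
      by (auto intro!: exI[of _ "N + n"] simp: algebra_simps)
  qed
  then show ?thesis using assms by blast
qed

text \<open>Here the separation argument uses the inverse period map, and a block of
  \<open>N\<close> periods is placed before the given trajectory instead of after it.\<close>

lemma spectral_subspace_controllable:
  assumes "x \<in> spectral_subspace (\<lambda>r. r \<le> 1) (X T 0)"
  shows "\<exists>n. rch 0 x (real n * T) 0"
proof -
  let ?S = "{y. \<exists>n. rch 0 y (real n * T) 0}"
  obtain N e where N: "e > 0" "\<And>b. norm b < e \<Longrightarrow> rch 0 0 (0 + real N * T) b"
    using rch_ball[of 0] by (metis order_refl)
  obtain K where K: "K > 0" "\<And>y. norm (X (real N * T) 0 *v y) \<le> K * norm y" using matrix_bound by metis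
  have "e / K > 0" using N(1) K(1) by simp
  have "spectral_subspace (\<lambda>r. r \<ge> 1) (X 0 T) \<subseteq> ?S"
  proof (rule spectral_subspace_subset[OF _ _ \<open>e / K > 0\<close>])
    show "convex ?S"
    proof (rule convexI, clarsimp)
      fix y z a b n k
      assume "rch 0 y (real n * T) 0" "rch 0 z (real k * T) 0" and ab: "0 \<le> a" "0 \<le> b" "a + b = (1::real)"
      then have "rch 0 y (real (max n k) * T) 0" "rch 0 z (real (max n k) * T) 0"
        by (auto intro: rch_to_zero_mono)
      from rch_convex[OF this ab] show "\<exists>n. rch 0 (a *\<^sub>R y + b *\<^sub>R z) (real n * T) 0" by auto
    qed
    show "0 \<in> ?S" using rch_zero[of 0 0] by (auto intro!: exI[of _ 0])
    fix b s :: "real^'d" assume b: "norm b < e / K" and "s \<in> ?S"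
    then obtain n where n: "rch 0 s (real n * T) 0" by blast
    let ?X = "X (real N * T) 0"
    have "norm (- (?X *v b)) \<le> K * norm b" using K(2) by simp
    also have "\<dots> < e" using b K(1) by (simp add: field_simps)
    finally have "rch 0 0 (0 + real N * T) (- (?X *v b))" by (rule N(2))
    \<comment> \<open>Free motion takes the new starting point to \<open>s\<close> plus the image of
      \<open>b\<close>; the control only has to remove that image, which has norm below
      \<open>e\<close> by the choice of radius \<open>e / K\<close>.\<close>
    moreover have "- (?X *v b) = s - ?X *v (b + X 0 (real N * T) *v s)"
      by (simp add: matrix_vector_right_distrib matrix_vector_mul_assoc fundamental_inverse)
    ultimately have "rch 0 (b + X 0 (real N * T) *v s) (real N * T) s" by (subst rch_decomp) simp
    moreover have "rch (0 + real N * T) s (real n * T + real N * T) 0"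
      unfolding rch_shift_nat by (rule n)
    ultimately have "rch 0 (b + X 0 (real N * T) *v s) (real n * T + real N * T) 0"
      using rch_trans by simp
    then show "b + ((*v) (X 0 T) ^^ N) s \<in> ?S"
      unfolding fundamental_inverse_pow by (auto intro!: exI[of _ "n + N"] simp: algebra_simps)
  qed
  then show ?thesis
    using assms spectral_subspace_inverse[OF fundamental_inverse[of T 0] fundamental_inverse[of 0 T]] by blast
qed

lemma rch_period_bounded:
  obtains C where "\<And>s t q. t \<le> s + T \<Longrightarrow> rch s 0 t q \<Longrightarrow> norm q \<le> C"
proof -
  obtain K b where K: "K > 0" "b \<ge> 0"
    "\<And>u s t x. u \<in> controls \<Longrightarrow> norm (\<phi> t s x u) \<le> 2 * (norm x + b * \<bar>t - s\<bar>) * exp (2 * K * \<bar>t - s\<bar>)"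
    using phi_growth by metis
  show ?thesis
  proof (rule that)
    fix s t q assume t: "t \<le> s + T" and "rch s 0 t q"
    then obtain u where u: "u \<in> controls" "\<phi> t s 0 u = q" "s \<le> t" by (auto simp: rch_def)
    have "norm q \<le> 2 * (norm (0::real^'d) + b * \<bar>t - s\<bar>) * exp (2 * K * \<bar>t - s\<bar>)"
      using K(3)[OF u(1), of t s 0] u(2) by simp
    also have "\<dots> \<le> 2 * (0 + b * T) * exp (2 * K * T)"
      using K(1,2) u(3) t T_pos by (intro mult_mono add_mono mult_left_mono) auto
    finally show "norm q \<le> 2 * (0 + b * T) * exp (2 * K * T)" .
  qed
qed

lemma fundamental_period_bounded:
  obtains D where "\<And>s t x. \<bar>t - s\<bar> \<le> T \<Longrightarrow> norm x \<le> C \<Longrightarrow> norm (X t s *v x) \<le> D"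
proof -
  obtain K b where K: "K > 0" "b \<ge> 0"
    "\<And>u s t x. u \<in> controls \<Longrightarrow> norm (\<phi> t s x u) \<le> 2 * (norm x + b * \<bar>t - s\<bar>) * exp (2 * K * \<bar>t - s\<bar>)"
    using phi_growth by metis
  show ?thesis
  proof (rule that)
    fix s t and x :: "real^'d" assume st: "\<bar>t - s\<bar> \<le> T" and x: "norm x \<le> C"
    have "norm (X t s *v x) \<le> 2 * (norm x + b * \<bar>t - s\<bar>) * exp (2 * K * \<bar>t - s\<bar>)"
      using K(3)[OF zero_controls, of t s x] by (simp add: phi_zero_control)
    also have "\<dots> \<le> 2 * (\<bar>C\<bar> + b * T) * exp (2 * K * T)"
      using K(1,2) st x T_pos by (intro mult_mono add_mono mult_left_mono) auto
    finally show "norm (X t s *v x) \<le> 2 * (\<bar>C\<bar> + b * T) * exp (2 * K * T)" .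
  qed
qed

text \<open>The trajectory is cut at the last multiple of \<open>T\<close> before its end. The state
  there belongs to the iterated sums, and the remaining piece of less than one period contributes a
  bounded amount.\<close>

lemma Reach_inner_bounded:
  assumes p: "\<And>x. x \<in> spectral_subspace (\<lambda>r. r \<ge> 1) (X T 0) \<Longrightarrow> p \<bullet> x = 0"
  obtains c where "\<And>\<tau> y. \<tau> \<in> {0..<T} \<Longrightarrow> (circ T \<tau>, y) \<in> \<R> \<Longrightarrow> \<bar>p \<bullet> (X 0 \<tau> *v y)\<bar> \<le> c"
proof -
  obtain C where C: "\<And>s t q. t \<le> s + T \<Longrightarrow> rch s 0 t q \<Longrightarrow> norm q \<le> C" using rch_period_bounded by metis
  obtain D where D: "\<And>s t x. \<bar>t - s\<bar> \<le> T \<Longrightarrow> norm x \<le> C \<Longrightarrow> norm (X t s *v x) \<le> D"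
    using fundamental_period_bounded by metis
  let ?R = "\<lambda>n. {y. rch 0 0 (real n * T) y}"
  have R0: "?R 0 \<subseteq> {0}" using phi_init[OF controls_L_infty] by (auto simp: rch_def)
  have Rs: "\<exists>q y'. norm q \<le> C \<and> y' \<in> ?R n \<and> y = q + X T 0 *v y'" if "y \<in> ?R (Suc n)" for n y
  proof -
    have r: "rch 0 0 (real (Suc n) * T) y" using that by simp
    have le: "0 \<le> real n * T" "real n * T \<le> real (Suc n) * T" using T_pos by (auto intro: mult_right_mono)
    obtain y' where y': "rch 0 0 (real n * T) y'" "rch (real n * T) y' (real (Suc n) * T) y"
      using rch_split[OF r le] .
    have "rch (0 + real n * T) y' (T + real n * T) y" using y'(2) by (simp add: algebra_simps)
    then have "rch 0 0 T (y - X T 0 *v y')" unfolding rch_shift_nat by (subst (asm) rch_decomp)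
    then have "norm (y - X T 0 *v y') \<le> C" by (rule C[rotated]) simp
    then show ?thesis
      using y'(1) by (intro exI[of _ "y - X T 0 *v y'"] exI[of _ y']) auto
  qed
  obtain c where c: "\<And>n j y. y \<in> ?R n \<Longrightarrow> \<bar>p \<bullet> (((*v) (X T 0) ^^ j) y)\<bar> \<le> c"
    using inner_bounded_on_iterated_sums[where R = ?R and C = C, OF p R0 Rs] by metis
  show ?thesis
  proof (rule that)
    fix \<tau> y assume \<tau>: "\<tau> \<in> {0..<T}" and "(circ T \<tau>, y) \<in> \<R>"
    then obtain t' where t': "circ T t' = circ T \<tau>" "rch 0 0 t' y" unfolding Reach_iff0 by blast
    then obtain k :: int where k: "t' = \<tau> + of_int k * T" using circ_eq_iff[OF T_pos] by blast
    \<comment> \<open>A negative \<open>k\<close> would put the end before time 0, since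
      \<open>\<tau> < T\<close>.\<close>
    have "k \<ge> 0"
    proof (rule ccontr)
      assume "\<not> 0 \<le> k"
      then have "real_of_int k * T \<le> (-1) * T" using T_pos by (intro mult_right_mono) auto
      then show False using rch_le[OF t'(2)] k \<tau> by auto
    qed
    then obtain n where n: "k = int n" by (metis nonneg_int_cases)
    have le: "0 \<le> real n * T" "real n * T \<le> t'" using T_pos k n \<tau> by auto
    obtain y0 where y0: "rch 0 0 (real n * T) y0" "rch (real n * T) y0 t' y" using rch_split[OF t'(2) le] .
    have "rch (0 + real n * T) y0 (\<tau> + real n * T) y" using y0(2) k n by simp
    then have q: "rch 0 0 \<tau> (y - X \<tau> 0 *v y0)" unfolding rch_shift_nat by (subst (asm) rch_decomp)
    let ?q = "y - X \<tau> 0 *v y0"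
    have "norm ?q \<le> C" using C[OF _ q] \<tau> by simp
    then have "norm (X 0 \<tau> *v ?q) \<le> D" using D[of 0 \<tau>] \<tau> by simp
    then have "\<bar>p \<bullet> (X 0 \<tau> *v ?q)\<bar> \<le> norm p * D"
      by (intro order_trans[OF Cauchy_Schwarz_ineq2] mult_left_mono) auto
    moreover have "X 0 \<tau> *v y = y0 + X 0 \<tau> *v ?q"
      by (simp add: matrix_vector_mult_diff_distrib matrix_vector_mul_assoc fundamental_inverse)
    moreover have "\<bar>p \<bullet> y0\<bar> \<le> c" using c[of y0 n 0] y0(1) by simp
    ultimately show "\<bar>p \<bullet> (X 0 \<tau> *v y)\<bar> \<le> c + norm p * D" by (simp add: inner_add_right)
  qed
qed

text \<open>The same estimate backwards in time: the trajectory is cut at the next multiple of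
  \<open>T\<close> after its start, and peeling off one period expresses the earlier state by the
  inverse period map.\<close>

lemma Contr_inner_bounded:
  assumes p: "\<And>x. x \<in> spectral_subspace (\<lambda>r. r \<le> 1) (X T 0) \<Longrightarrow> p \<bullet> x = 0"
  obtains c where "\<And>\<tau> y. \<tau> \<in> {0..<T} \<Longrightarrow> (circ T \<tau>, y) \<in> \<C> \<Longrightarrow> \<bar>p \<bullet> (X 0 \<tau> *v y)\<bar> \<le> c"
proof -
  have p': "p \<bullet> x = 0" if "x \<in> spectral_subspace (\<lambda>r. r \<ge> 1) (X 0 T)" for x
    using p that spectral_subspace_inverse[OF fundamental_inverse[of T 0] fundamental_inverse[of 0 T]] by blast
  obtain C where C: "\<And>s t q. t \<le> s + T \<Longrightarrow> rch s 0 t q \<Longrightarrow> norm q \<le> C" using rch_period_bounded by metis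
  obtain D where D: "\<And>s t x. \<bar>t - s\<bar> \<le> T \<Longrightarrow> norm x \<le> C \<Longrightarrow> norm (X t s *v x) \<le> D"
    using fundamental_period_bounded by metis
  have DT: "norm (X 0 T *v q) \<le> D" if "norm q \<le> C" for q using D[of 0 T q] T_pos that by simp
  let ?R = "\<lambda>n. {y. rch 0 y (real n * T) 0}"
  have R0: "?R 0 \<subseteq> {0}" using phi_init[OF controls_L_infty] by (auto simp: rch_def)
  have Rs: "\<exists>q y'. norm q \<le> D \<and> y' \<in> ?R n \<and> y = q + X 0 T *v y'" if "y \<in> ?R (Suc n)" for n y
  proof -
    have r: "rch 0 y (real (Suc n) * T) 0" using that by simp
    have le: "0 \<le> T" "T \<le> real (Suc n) * T" using T_pos by auto
    obtain y' where y': "rch 0 y T y'" "rch T y' (real (Suc n) * T) 0" using rch_split[OF r le] .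
    have "rch (0 + real 1 * T) y' (real n * T + real 1 * T) 0" using y'(2) by (simp add: algebra_simps)
    then have n: "rch 0 y' (real n * T) 0" unfolding rch_shift_nat .
    have "rch 0 0 T (y' - X T 0 *v y)" using y'(1) by (subst (asm) rch_decomp)
    then have "norm (y' - X T 0 *v y) \<le> C" by (rule C[rotated]) simp
    then have "norm (- (X 0 T *v (y' - X T 0 *v y))) \<le> D" using DT by simp
    moreover have "y = - (X 0 T *v (y' - X T 0 *v y)) + X 0 T *v y'"
      by (simp add: matrix_vector_mult_diff_distrib matrix_vector_mul_assoc fundamental_inverse)
    ultimately show ?thesis
      using n by blast
  qed
  obtain c where c: "\<And>n j y. y \<in> ?R n \<Longrightarrow> \<bar>p \<bullet> (((*v) (X 0 T) ^^ j) y)\<bar> \<le> c"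
    using inner_bounded_on_iterated_sums[where R = ?R and C = D, OF p' R0 Rs] by metis
  show ?thesis
  proof (rule that)
    fix \<tau> y assume \<tau>: "\<tau> \<in> {0..<T}" and "(circ T \<tau>, y) \<in> \<C>"
    then obtain k :: int where k: "rch \<tau> y (of_int k * T) 0" unfolding Contr_iff0 by blast
    have "0 \<le> real_of_int k * T" using rch_le[OF k] \<tau> by simp
    then have "k \<ge> 0" using T_pos by (simp add: zero_le_mult_iff)
    then obtain n where n: "k = int n" by (metis nonneg_int_cases)
    \<comment> \<open>The arrival is postponed by one period, resting at 0, so that the cut at
      \<open>T\<close> precedes it even for \<open>n = 0\<close>.\<close>
    have le: "\<tau> \<le> T" "T \<le> real (Suc n) * T" using \<tau> T_pos by auto
    have r: "rch \<tau> y (real (Suc n) * T) 0"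
      using rch_trans[OF k rch_zero[of "of_int k * T" "real (Suc n) * T"]] n T_pos by (simp add: algebra_simps)
    obtain y' where y': "rch \<tau> y T y'" "rch T y' (real (Suc n) * T) 0" using rch_split[OF r le] .
    have "rch (0 + real 1 * T) y' (real n * T + real 1 * T) 0" using y'(2) by (simp add: algebra_simps)
    then have yn: "rch 0 y' (real n * T) 0" unfolding rch_shift_nat .
    let ?q = "y' - X T \<tau> *v y"
    have q: "rch \<tau> 0 T ?q" using y'(1) by (subst (asm) rch_decomp)
    have "norm ?q \<le> C" using C[OF _ q] \<tau> by simp
    then have "norm (X 0 T *v ?q) \<le> D" by (rule DT)
    then have "\<bar>p \<bullet> (X 0 T *v ?q)\<bar> \<le> norm p * D"
      by (intro order_trans[OF Cauchy_Schwarz_ineq2] mult_left_mono) auto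
    moreover have "X 0 \<tau> *v y = X 0 T *v y' - X 0 T *v ?q"
      by (simp add: matrix_vector_mult_diff_distrib matrix_vector_mul_assoc fundamental_flow)
    \<comment> \<open>The cut is at time \<open>T\<close>, so one inverse period map remains in
      front; this is the case \<open>j = 1\<close> of the bound.\<close>
    moreover have "\<bar>p \<bullet> (X 0 T *v y')\<bar> \<le> c" using c[of y' n 1] yn by simp
    ultimately show "\<bar>p \<bullet> (X 0 \<tau> *v y)\<bar> \<le> c + norm p * D" by (simp add: inner_diff_right)
  qed
qed

text \<open>Periodicity makes the period map at phase \<open>\<tau>\<close> conjugate to the one at
  phase 0 through \<open>X \<tau> 0\<close>.\<close>

lemma spectral_fibre:
  "spectral_subspace P (X (T + \<tau>) \<tau>) = (*v) (X \<tau> 0) ` spectral_subspace P (X T 0)"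
proof -
  have "X (T + \<tau>) \<tau> = X (\<tau> + T) (0 + T) ** X T 0 ** X 0 \<tau>" by (simp add: fundamental_flow add.commute)
  then have "X (T + \<tau>) \<tau> = X \<tau> 0 ** X T 0 ** X 0 \<tau>" unfolding fundamental_shift .
  then show ?thesis using spectral_subspace_similar[OF fundamental_inverse fundamental_inverse] by metis
qed

lemma E_plus_zero_eq: "E_plus_zero T A \<tau> = (*v) (X \<tau> 0) ` spectral_subspace (\<lambda>r. r \<ge> 1) (X T 0)"
proof -
  have "E_plus_zero T A \<tau> = spectral_subspace (\<lambda>r. r > 1 \<or> r = 1) (X (T + \<tau>) \<tau>)"
    unfolding E_plus_zero_def E_plus_def E_zero_def spectral_subspace_disj ..
  also have "(\<lambda>r::real. r > 1 \<or> r = 1) = (\<lambda>r. r \<ge> 1)" by auto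
  finally show ?thesis unfolding spectral_fibre .
qed

lemma E_minus_zero_eq: "E_minus_zero T A \<tau> = (*v) (X \<tau> 0) ` spectral_subspace (\<lambda>r. r \<le> 1) (X T 0)"
proof -
  have "E_minus_zero T A \<tau> = spectral_subspace (\<lambda>r. r < 1 \<or> r = 1) (X (T + \<tau>) \<tau>)"
    unfolding E_minus_zero_def E_minus_def E_zero_def spectral_subspace_disj ..
  also have "(\<lambda>r::real. r < 1 \<or> r = 1) = (\<lambda>r. r \<le> 1)" by auto
  finally show ?thesis unfolding spectral_fibre .
qed

lemma E_zero_eq: "E_zero T A \<tau> = (*v) (X \<tau> 0) ` spectral_subspace (\<lambda>r. r = 1) (X T 0)"
  unfolding E_zero_def spectral_fibre ..

lemma spectral_zero_Int:
  "spectral_subspace (\<lambda>r. r \<ge> 1) M \<inter> spectral_subspace (\<lambda>r. r \<le> 1) M = spectral_subspace (\<lambda>r. r = 1) M"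
proof -
  have "(\<lambda>r::real. r \<ge> 1 \<and> r \<le> 1) = (\<lambda>r. r = 1)" by auto
  then have "spectral_subspace (\<lambda>r. r \<ge> 1) M \<inter> spectral_subspace (\<lambda>r. r \<le> 1) M \<subseteq> spectral_subspace (\<lambda>r. r = 1) M"
    using spectral_subspace_Int[of _ "\<lambda>r. r \<ge> 1" M "\<lambda>r. r \<le> 1"] by auto
  moreover have sub: "spectral_subspace (\<lambda>r. r = 1) M \<subseteq> spectral_subspace P M" if "P 1" for P
    unfolding spectral_subspace_def by (intro span_mono) (use that in auto)
  ultimately show ?thesis
    using sub[of "\<lambda>r. r \<ge> 1"] sub[of "\<lambda>r. r \<le> 1"] by (intro subset_antisym Int_greatest) simp_all
qed

lemma subbundle_plus_Reach: "subbundle T (E_plus_zero T A) \<subseteq> \<R>"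
proof
  fix q assume "q \<in> subbundle T (E_plus_zero T A)"
  then obtain \<tau> x where q: "q = (circ T \<tau>, X \<tau> 0 *v x)" "\<tau> \<in> {0..<T}" "x \<in> spectral_subspace (\<lambda>r. r \<ge> 1) (X T 0)"
    unfolding subbundle_def E_plus_zero_eq by blast
  obtain n where n: "rch 0 0 (real n * T) x" using spectral_subspace_reachable[OF q(3)] by blast
  have "rch (0 + real n * T) x (\<tau> + real n * T) (X \<tau> 0 *v x)"
    unfolding rch_shift_nat using q(2) by (intro rch_zero_control) simp
  then have "rch 0 0 (\<tau> + real n * T) (X \<tau> 0 *v x)" using rch_trans[OF n] by simp
  moreover have "circ T (\<tau> + real n * T) = circ T \<tau>" using circ_add_int_mult[OF T_pos, of \<tau> "int n"] by simp
  ultimately show "q \<in> \<R>" unfolding q(1) Reach_iff0 by blast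
qed

lemma subbundle_minus_Contr: "subbundle T (E_minus_zero T A) \<subseteq> \<C>"
proof
  fix q assume "q \<in> subbundle T (E_minus_zero T A)"
  then obtain \<tau> x where q: "q = (circ T \<tau>, X \<tau> 0 *v x)" "\<tau> \<in> {0..<T}" "x \<in> spectral_subspace (\<lambda>r. r \<le> 1) (X T 0)"
    unfolding subbundle_def E_minus_zero_eq by blast
  \<comment> \<open>Steering to 0 is known only from phase 0, so the point first moves freely on to
    time \<open>T\<close>; there it is again in the subspace by invariance.\<close>
  have MN: "spectral_subspace (\<lambda>r. r \<le> 1) (X T 0) = (*v) (X T 0) ` spectral_subspace (\<lambda>r. r \<le> 1) (X T 0)"
    using spectral_fibre[of "\<lambda>r. r \<le> 1" T] spectral_fibre[of "\<lambda>r. r \<le> 1" 0] fundamental_shift[of T 0] by simp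
  then have "X T 0 *v x \<in> spectral_subspace (\<lambda>r. r \<le> 1) (X T 0)" using q(3) by blast
  then obtain n where n: "rch 0 (X T 0 *v x) (real n * T) 0" using spectral_subspace_controllable by blast
  have "rch \<tau> (X \<tau> 0 *v x) T (X T \<tau> *v (X \<tau> 0 *v x))" using q(2) by (intro rch_zero_control) simp
  then have "rch \<tau> (X \<tau> 0 *v x) T (X T 0 *v x)" by (simp add: matrix_vector_mul_assoc fundamental_flow)
  moreover have "rch (0 + real 1 * T) (X T 0 *v x) (real n * T + real 1 * T) 0"
    unfolding rch_shift_nat by (rule n)
  ultimately have "rch \<tau> (X \<tau> 0 *v x) (of_int (int n + 1) * T) 0"
    using rch_trans by (simp add: algebra_simps)
  then show "q \<in> \<C>" unfolding q(1) Contr_iff0 by blast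
qed

end

section \<open>Control sets\<close>

lemma weakly_invariant_transport:
  assumes hm: "homeomorphic_map M M' h"
    and conj: "\<And>p u t. p \<in> topspace M \<Longrightarrow> u \<in> \<U> \<Longrightarrow> t \<ge> 0 \<Longrightarrow> \<Phi>' t (h p) u = h (\<Phi> t p u)"
    and inv: "\<And>p u t. p \<in> topspace M \<Longrightarrow> u \<in> \<U> \<Longrightarrow> t \<ge> 0 \<Longrightarrow> \<Phi> t p u \<in> topspace M"
    and D: "D \<subseteq> topspace M" "weakly_invariant_and_approx_controllable M \<Phi> \<U> D"
  shows "weakly_invariant_and_approx_controllable M' \<Phi>' \<U> (h ` D)"
proof -
  have reach: "reachable_set \<Phi>' \<U> (h p) = h ` reachable_set \<Phi> \<U> p" if "p \<in> topspace M" for p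
    unfolding reachable_set_def using conj[OF that] by force
  have rsub: "reachable_set \<Phi> \<U> p \<subseteq> topspace M" if "p \<in> topspace M" for p
    unfolding reachable_set_def using inv[OF that] by auto
  show ?thesis
    unfolding weakly_invariant_and_approx_controllable_def
  proof (intro conjI ballI)
    fix q assume "q \<in> h ` D"
    then obtain p where p: "p \<in> D" "q = h p" by blast
    then have pt: "p \<in> topspace M" using D(1) by blast
    obtain u where "u \<in> \<U>" "\<forall>t\<ge>0. \<Phi> t p u \<in> D"
      using D(2) p(1) unfolding weakly_invariant_and_approx_controllable_def by blast
    then show "\<exists>u\<in>\<U>. \<forall>t\<ge>0. \<Phi>' t q u \<in> h ` D" using conj[OF pt] p(2) by auto
    have "D \<subseteq> M closure_of reachable_set \<Phi> \<U> p"
      using D(2) p(1) unfolding weakly_invariant_and_approx_controllable_def by blast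
    then have "h ` D \<subseteq> h ` (M closure_of reachable_set \<Phi> \<U> p)" by (rule image_mono)
    also have "\<dots> = M' closure_of reachable_set \<Phi>' \<U> q"
      unfolding p(2) reach[OF pt] by (rule homeomorphic_map_closure_of[OF hm rsub[OF pt], symmetric])
    finally show "h ` D \<subseteq> M' closure_of reachable_set \<Phi>' \<U> q" .
  qed
qed

text \<open>Maximality passes across the conjugacy because the inverse map carries every competing
  larger set back. The second part shows that no further control sets appear, which is needed for
  uniqueness on the sphere.\<close>

lemma control_set_transport:
  assumes hm: "homeomorphic_maps M M' h g"
    and conj: "\<And>p u t. p \<in> topspace M \<Longrightarrow> u \<in> \<U> \<Longrightarrow> t \<ge> 0 \<Longrightarrow> \<Phi>' t (h p) u = h (\<Phi> t p u)"
    and inv: "\<And>p u t. p \<in> topspace M \<Longrightarrow> u \<in> \<U> \<Longrightarrow> t \<ge> 0 \<Longrightarrow> \<Phi> t p u \<in> topspace M"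
  shows "control_set_nonvoid_interior M \<Phi> \<U> D \<Longrightarrow> control_set_nonvoid_interior M' \<Phi>' \<U> (h ` D)"
    and "control_set_nonvoid_interior M' \<Phi>' \<U> E \<Longrightarrow> \<exists>D. control_set_nonvoid_interior M \<Phi> \<U> D \<and> E = h ` D"
proof -
  let ?W = "weakly_invariant_and_approx_controllable M \<Phi> \<U>"
  let ?W' = "weakly_invariant_and_approx_controllable M' \<Phi>' \<U>"
  have h: "homeomorphic_map M M' h" and g: "homeomorphic_map M' M g"
    using hm homeomorphic_maps_map by blast+
  have gh: "p \<in> topspace M \<Longrightarrow> g (h p) = p" and hg: "q \<in> topspace M' \<Longrightarrow> h (g q) = q"
    and hM: "p \<in> topspace M \<Longrightarrow> h p \<in> topspace M'" and gM: "q \<in> topspace M' \<Longrightarrow> g q \<in> topspace M" for p q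
    using hm unfolding homeomorphic_maps_def continuous_map_def by auto
  have conj': "\<Phi> t (g q) u = g (\<Phi>' t q u)" and inv': "\<Phi>' t q u \<in> topspace M'"
    if "q \<in> topspace M'" "u \<in> \<U>" "t \<ge> 0" for q u t
    using conj[OF gM[OF that(1)] that(2,3)] inv[OF gM[OF that(1)] that(2,3)] hg[OF that(1)] gh hM by auto
  have img: "D \<subseteq> topspace M \<Longrightarrow> g ` h ` D = D" and img': "E \<subseteq> topspace M' \<Longrightarrow> h ` g ` E = E" for D E
    using gh hg by (force simp: image_image)+
  have tr: "?W' (h ` D)"
    if "D \<subseteq> topspace M" "?W D" for D
    using weakly_invariant_transport[of M M' h \<U> \<Phi>' \<Phi> D] h conj inv that by blast
  have tr': "?W (g ` E)"
    if "E \<subseteq> topspace M'" "?W' E" for E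
    using weakly_invariant_transport[of M' M g \<U> \<Phi> \<Phi>' E] g conj' inv' that by blast
  have *: "control_set_nonvoid_interior M' \<Phi>' \<U> (h ` D)" if "control_set_nonvoid_interior M \<Phi> \<U> D" for D
  proof -
    have D: "D \<noteq> {}" "D \<subseteq> topspace M" "?W D" "M interior_of D \<noteq> {}"
      and max: "\<And>D'. D \<subseteq> D' \<Longrightarrow> D' \<subseteq> topspace M \<Longrightarrow> ?W D' \<Longrightarrow> D' = D"
      using that unfolding control_set_nonvoid_interior_def control_set_def by blast+
    have "E = h ` D" if E: "h ` D \<subseteq> E" "E \<subseteq> topspace M'" "?W' E" for E
    proof -
      have "g ` E = D"
      proof (rule max)
        show "D \<subseteq> g ` E" using img[OF D(2)] E(1) by blast
        show "g ` E \<subseteq> topspace M" using gM E(2) by blast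
        show "?W (g ` E)" by (rule tr'[OF E(2,3)])
      qed
      then show ?thesis using img'[OF E(2)] by simp
    qed
    moreover have "?W' (h ` D)" by (rule tr[OF D(2,3)])
    moreover have "M' interior_of (h ` D) \<noteq> {}" using homeomorphic_map_interior_of[OF h D(2)] D(4) by simp
    moreover have "h ` D \<subseteq> topspace M'" using hM D(2) by blast
    ultimately show ?thesis using D(1) unfolding control_set_nonvoid_interior_def control_set_def by blast
  qed
  show "control_set_nonvoid_interior M \<Phi> \<U> D \<Longrightarrow> control_set_nonvoid_interior M' \<Phi>' \<U> (h ` D)" by (rule *)
  show "\<exists>D. control_set_nonvoid_interior M \<Phi> \<U> D \<and> E = h ` D" if E': "control_set_nonvoid_interior M' \<Phi>' \<U> E"
  proof -
    have E: "E \<noteq> {}" "E \<subseteq> topspace M'" "?W' E" "M' interior_of E \<noteq> {}"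
      and max: "\<And>D'. E \<subseteq> D' \<Longrightarrow> D' \<subseteq> topspace M' \<Longrightarrow> ?W' D' \<Longrightarrow> D' = E"
      using E' unfolding control_set_nonvoid_interior_def control_set_def by blast+
    have "D = g ` E" if D: "g ` E \<subseteq> D" "D \<subseteq> topspace M" "?W D" for D
    proof -
      have "h ` D = E"
      proof (rule max)
        show "E \<subseteq> h ` D" using img'[OF E(2)] D(1) by blast
        show "h ` D \<subseteq> topspace M'" using hM D(2) by blast
        show "?W' (h ` D)" by (rule tr[OF D(2,3)])
      qed
      then show ?thesis using img[OF D(2)] by simp
    qed
    moreover have "?W (g ` E)" by (rule tr'[OF E(2,3)])
    moreover have "M interior_of (g ` E) \<noteq> {}" using homeomorphic_map_interior_of[OF g E(2)] E(4) by simp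
    moreover have "g ` E \<subseteq> topspace M" using gM E(2) by blast
    ultimately have "control_set_nonvoid_interior M \<Phi> \<U> (g ` E)"
      using E(1) unfolding control_set_nonvoid_interior_def control_set_def by blast
    then show ?thesis using img'[OF E(2)] by metis
  qed
qed

context periodic_control_system
begin

lemma Reach_trans:
  assumes "(circ T s, x) \<in> \<R>" "rch s x t y"
  shows "(circ T t, y) \<in> \<R>"
proof -
  obtain t0 where t0: "circ T t0 = circ T s" "rch 0 0 t0 x" using assms(1) unfolding Reach_iff0 by blast
  obtain k :: int where k: "t0 = s + of_int k * T" using t0(1) circ_eq_iff[OF T_pos] by blast
  have "rch t0 x (t + of_int k * T) y" unfolding k rch_shift_int by (rule assms(2))
  then have "rch 0 0 (t + of_int k * T) y" by (rule rch_trans[OF t0(2)])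
  then show ?thesis unfolding Reach_iff0 using circ_add_int_mult[OF T_pos, of t k] by blast
qed

lemma Contr_trans:
  assumes "(circ T t, y) \<in> \<C>" "rch s x t y"
  shows "(circ T s, x) \<in> \<C>"
  using assms rch_trans unfolding Contr_iff0 by blast

lemma zero_in_Reach: "(circ T t, 0) \<in> \<R>"
proof -
  obtain n :: nat where "- t / T < real n" using reals_Archimedean2 by blast
  then have "0 \<le> t + of_int (int n) * T" using T_pos by (simp add: field_simps)
  then have "rch 0 0 (t + of_int (int n) * T) 0" by (rule rch_zero)
  then show ?thesis unfolding Reach_iff0 using circ_add_int_mult[OF T_pos, of t "int n"] by blast
qed

lemma zero_in_Contr: "(circ T t, 0) \<in> \<C>"
proof -
  obtain n :: nat where "t / T < real n" using reals_Archimedean2 by blast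
  then have "t \<le> of_int (int n) * T" using T_pos by (simp add: field_simps)
  then have "rch t 0 (of_int (int n) * T) 0" by (rule rch_zero)
  then show ?thesis unfolding Contr_iff0 by blast
qed

lemma rch_same_time: "rch s x s y \<Longrightarrow> y = x"
  using phi_init[OF controls_L_infty] by (auto simp: rch_def)

text \<open>Approximating points may start at a slightly later time than \<open>s\<close>; for
  \<open>s < t\<close> they still precede \<open>t\<close> and can be driven by the same control,
  and \<open>s = t\<close> is trivial.\<close>

lemma closure_Reach_trans:
  assumes c: "(circ T s, x) \<in> cylinder closure_of \<R>" and r: "rch s x t y"
  shows "(circ T t, y) \<in> cylinder closure_of \<R>"
proof (cases "s = t")
  case True
  then show ?thesis using assms rch_same_time by blast
next
  case False
  then have st: "s < t" using rch_le[OF r] by simp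
  obtain u where u: "u \<in> controls" "\<phi> t s x u = y" using r by (auto simp: rch_def)
  show ?thesis
    unfolding cylinder_closure_iff[OF T_pos Reach_subset]
  proof (intro allI impI)
    fix d :: real assume d: "d > 0"
    obtain e where e: "e > 0"
      "\<And>s' x'. \<bar>s' - s\<bar> < e \<Longrightarrow> norm (x' - x) < e \<Longrightarrow> norm (\<phi> t s' x' u - \<phi> t s x u) < d"
      using phi_continuous[OF u(1) d] by metis
    have "min e (t - s) > 0" using e st by simp
    then obtain s' x' where s': "(circ T s', x') \<in> \<R>" "\<bar>s' - s\<bar> < min e (t - s)" "norm (x' - x) < min e (t - s)"
      using c unfolding cylinder_closure_iff[OF T_pos Reach_subset] by blast
    have "rch s' x' t (\<phi> t s' x' u)" using s' by (intro rch_phi[OF u(1)]) auto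
    then have "(circ T t, \<phi> t s' x' u) \<in> \<R>" by (rule Reach_trans[OF s'(1)])
    moreover have "norm (\<phi> t s' x' u - y) < d" using e(2)[of s' x'] s' u(2) by simp
    ultimately show "\<exists>t' y'. (circ T t', y') \<in> \<R> \<and> \<bar>t' - t\<bar> < d \<and> norm (y' - y) < d"
      using d by (intro exI[of _ t] exI[of _ "\<phi> t s' x' u"]) auto
  qed
qed

abbreviation "wica \<equiv> weakly_invariant_and_approx_controllable cylinder (phi_a T A B) controls"
abbreviation "\<D> \<equiv> (cylinder closure_of \<R>) \<inter> \<C>"

lemma point_circ:
  assumes "p \<in> S1 \<times> UNIV"
  obtains x where "p = (circ T (phase T (fst p)), x)"
  using assms circ_phase[OF T_pos] by (cases p) auto

lemma reachable_subset_topspace: "reachable_set (phi_a T A B) controls p \<subseteq> S1 \<times> UNIV"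
  by (cases p) (auto simp: reachable_set_def phi_a_apply)

text \<open>From a point of the set one can steer to the origin and rest there under the zero
  control. The whole path remains in the closure of the reachable set and stays controllable to the
  origin. Passing through the origin also reaches all of \<open>\<R>\<close>.\<close>

lemma control_set_weakly_invariant: "wica \<D>"
  unfolding weakly_invariant_and_approx_controllable_def
proof (intro conjI ballI)
  fix p assume p: "p \<in> \<D>"
  then have "p \<in> S1 \<times> UNIV" using Contr_subset by blast
  define \<tau> where "\<tau> = phase T (fst p)"
  obtain x where x: "p = (circ T \<tau>, x)" using point_circ[OF \<open>p \<in> S1 \<times> UNIV\<close>] unfolding \<tau>_def .
  have ph: "phase T (circ T \<tau>) = \<tau>"
    using \<open>p \<in> S1 \<times> UNIV\<close> circ_phase[OF T_pos, of "fst p"] by (auto simp: \<tau>_def)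
  obtain k :: int where k: "rch \<tau> x (of_int k * T) 0" using p unfolding x Int_iff Contr_iff0 by blast
  define S where "S = real_of_int k * T"
  obtain u where u: "u \<in> controls" "\<phi> S \<tau> x u = 0" "\<tau> \<le> S" using k by (auto simp: rch_def S_def)
  let ?w = "\<lambda>q. if q \<le> S then u q else 0"
  have w: "?w \<in> controls" using controls_glue[OF u(1) zero_controls] .
  note L = controls_L_infty[OF w]
  have w0: "\<phi> S \<tau> x ?w = 0"
    using phi_cong[OF L controls_L_infty[OF u(1)], of \<tau> S x] u(2,3) by simp
  show "\<exists>u\<in>controls. \<forall>t\<ge>0. phi_a T A B t p u \<in> \<D>"
  proof (intro bexI[OF _ w] allI impI)
    fix t :: real assume t: "t \<ge> 0"
    let ?r = "\<tau> + t" let ?y = "\<phi> ?r \<tau> x ?w"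
    have r: "rch \<tau> x ?r ?y" using t by (intro rch_phi[OF w]) simp
    have "(circ T ?r, ?y) \<in> cylinder closure_of \<R>" using closure_Reach_trans[OF _ r] p x by simp
    moreover have "(circ T ?r, ?y) \<in> \<C>"
    proof (cases "?r \<le> S")
      case True
      have "rch ?r ?y S 0" using rch_phi[OF w True, of ?y] phi_flow[OF L, of S ?r \<tau> x] w0 by simp
      then show ?thesis using Contr_trans[OF zero_in_Contr] by blast
    next
      case False
      have "AE q in lebesgue. q \<notin> {S}" by (rule AE_not_in) simp
      then have "AE q in lebesgue. q \<in> {min S ?r..max S ?r} \<longrightarrow> ?w q = 0"
        by eventually_elim (use False in auto)
      then have "\<phi> ?r S 0 ?w = \<phi> ?r S 0 (\<lambda>_. 0)" by (rule phi_cong[OF L L_infty_const])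
      then have "?y = 0" using phi_flow[OF L, of ?r S \<tau> x] w0 by (simp add: phi_zero_control)
      then show ?thesis using zero_in_Contr by simp
    qed
    ultimately show "phi_a T A B t p ?w \<in> \<D>" unfolding x phi_a_apply ph by blast
  qed
  have "\<R> \<subseteq> reachable_set (phi_a T A B) controls p"
  proof
    fix q assume "q \<in> \<R>"
    then obtain t y where q: "q = (circ T t, y)" "rch 0 0 t y" unfolding Reach_iff by blast
    have "rch (0 + of_int k * T) 0 (t + of_int k * T) y" unfolding rch_shift_int by (rule q(2))
    then have "rch \<tau> x (t + of_int k * T) y" using rch_trans[OF k] by simp
    then show "q \<in> reachable_set (phi_a T A B) controls p"
      unfolding x reachable_set_iff q(1) using circ_add_int_mult[OF T_pos, of t k] by metis
  qed
  then have "cylinder closure_of \<R> \<subseteq> cylinder closure_of reachable_set (phi_a T A B) controls p"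
    by (rule closure_of_mono)
  then show "\<D> \<subseteq> cylinder closure_of reachable_set (phi_a T A B) controls p" by blast
qed

text \<open>A single point of \<open>\<R> \<inter> \<C>\<close> suffices: what \<open>q\<close>
  approaches lies in the closure of \<open>\<R>\<close>, and every other point approaches
  \<open>q\<close>, hence enters the open set \<open>\<C>\<close>. Both maximality and uniqueness
  rest on this.\<close>

lemma wica_subset:
  assumes D: "D \<subseteq> S1 \<times> UNIV" "wica D" and q: "q \<in> D" "q \<in> \<C>" "q \<in> \<R>"
  shows "D \<subseteq> \<D>"
proof (rule Int_greatest)
  have cl: "p \<in> D \<Longrightarrow> D \<subseteq> cylinder closure_of reachable_set (phi_a T A B) controls p" for p
    using D(2) unfolding weakly_invariant_and_approx_controllable_def by blast
  have "q \<in> S1 \<times> UNIV" using D(1) q(1) by blast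
  then obtain x where x: "q = (circ T (phase T (fst q)), x)" by (rule point_circ)
  have "reachable_set (phi_a T A B) controls q \<subseteq> \<R>"
  proof
    fix r assume "r \<in> reachable_set (phi_a T A B) controls q"
    then obtain t y where "r = (circ T t, y)" "rch (phase T (fst q)) x t y"
      using reachable_set_iff x by metis
    then show "r \<in> \<R>" using Reach_trans q(3) x by metis
  qed
  then show "D \<subseteq> cylinder closure_of \<R>" using cl[OF q(1)] closure_of_mono by blast
  show "D \<subseteq> \<C>"
  proof
    fix p assume p: "p \<in> D"
    then have "p \<in> S1 \<times> UNIV" using D(1) by blast
    then obtain z where z: "p = (circ T (phase T (fst p)), z)" by (rule point_circ)
    have "q \<in> cylinder closure_of reachable_set (phi_a T A B) controls p" using cl[OF p] q(1) by blast
    then obtain r where r: "r \<in> reachable_set (phi_a T A B) controls p" "r \<in> \<C>"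
      using openin_Contr q(2) unfolding in_closure_of by blast
    then obtain t y where "r = (circ T t, y)" "rch (phase T (fst p)) z t y"
      using reachable_set_iff z by metis
    then show "p \<in> \<C>" using Contr_trans r(2) z by metis
  qed
qed

lemma openin_Reach_Contr: "openin cylinder (\<R> \<inter> \<C>)"
  by (intro openin_Int openin_Reach openin_Contr)

lemma Reach_Contr_subset_control_set: "\<R> \<inter> \<C> \<subseteq> \<D>"
  using closure_of_subset[of \<R> cylinder] Reach_subset by auto

lemma Reach_Contr_subset_interior: "\<R> \<inter> \<C> \<subseteq> cylinder interior_of \<D>"
  by (rule interior_of_maximal[OF Reach_Contr_subset_control_set openin_Reach_Contr])

lemma control_set_D: "control_set_nonvoid_interior cylinder (phi_a T A B) controls \<D>"
  unfolding control_set_nonvoid_interior_def control_set_def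
proof (intro conjI allI impI)
  have 0: "(circ T 0, 0) \<in> \<R> \<inter> \<C>" using zero_in_Reach zero_in_Contr by blast
  then show "cylinder interior_of \<D> \<noteq> {}" using Reach_Contr_subset_interior by blast
  show "\<D> \<noteq> {}" using 0 Reach_Contr_subset_control_set by blast
  show "\<D> \<subseteq> topspace cylinder" using Contr_subset by auto
  show "wica \<D>" by (rule control_set_weakly_invariant)
  fix D' assume D': "\<D> \<subseteq> D' \<and> D' \<subseteq> topspace cylinder \<and> wica D'"
  then have "D' \<subseteq> \<D>"
    using 0 Reach_Contr_subset_control_set wica_subset[of D' "(circ T 0, 0)"] by auto
  then show "D' = \<D>" using D' by blast
qed

text \<open>Approximate controllability yields a return close to \<open>x\<close> at a nearby phase; prolonging or truncating
  that trajectory slightly corrects the phase.\<close>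

lemma near_return:
  assumes D: "D \<subseteq> S1 \<times> UNIV" "wica D" and q: "(circ T \<tau>, x) \<in> D" and \<tau>: "phase T (circ T \<tau>) = \<tau>" and e: "e > 0"
  obtains k z where "N \<le> k" "rch \<tau> x (\<tau> + real k * T) z" "norm (z - x) < e"
proof -
  obtain u where u: "u \<in> controls" "\<And>t. t \<ge> 0 \<Longrightarrow> phi_a T A B t (circ T \<tau>, x) u \<in> D"
    using D(2) q unfolding weakly_invariant_and_approx_controllable_def by blast
  \<comment> \<open>Moving on inside \<open>D\<close> for \<open>N + 1\<close> periods before
    returning forces the return to last long enough; the extra period outweighs the phase error,
    which is below \<open>d \<le> T\<close>.\<close>
  define r where "r = \<tau> + real (Suc N) * T"
  have \<tau>r: "\<tau> \<le> r" using T_pos by (simp add: r_def)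
  define x1 where "x1 = \<phi> r \<tau> x u"
  have r1: "rch \<tau> x r x1" unfolding x1_def by (rule rch_phi[OF u(1) \<tau>r])
  have "phi_a T A B (real (Suc N) * T) (circ T \<tau>, x) u = (circ T r, x1)"
    unfolding phi_a_apply \<tau> r_def x1_def ..
  then have "(circ T r, x1) \<in> D" using u(2)[of "real (Suc N) * T"] T_pos by simp
  then have cl: "(circ T \<tau>, x) \<in> cylinder closure_of reachable_set (phi_a T A B) controls (circ T r, x1)"
    using D(2) q unfolding weakly_invariant_and_approx_controllable_def by blast
  obtain C where C: "C > 0"
    "\<And>u s t y. u \<in> controls \<Longrightarrow> norm y \<le> norm x + 1 \<Longrightarrow> \<bar>t - s\<bar> \<le> 1 \<Longrightarrow> norm (\<phi> t s y u - y) \<le> C * \<bar>t - s\<bar>"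
    using phi_local_lipschitz[of "norm x + 1"] by metis
  \<comment> \<open>The bound 1 is the range of the displacement estimate, \<open>T\<close> keeps
    the count of periods correct, and the last entry covers the distance \<open>d\<close> of the
    return plus the displacement \<open>C * d\<close> of the phase correction.\<close>
  define d where "d = Min {1, T, e / (C + 1)}"
  have d: "d > 0" "d \<le> 1" "d \<le> T" "d \<le> e / (C + 1)" using C e T_pos by (auto simp: d_def)
  obtain t' y' where t': "(circ T t', y') \<in> reachable_set (phi_a T A B) controls (circ T r, x1)"
    "\<bar>t' - \<tau>\<bar> < d" "norm (y' - x) < d"
    using cl d(1) unfolding cylinder_closure_iff[OF T_pos reachable_subset_topspace] by blast
  then obtain t'' where t'': "circ T t'' = circ T t'" "rch r x1 t'' y'"
    unfolding reachable_set_iff by (metis prod.inject)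
  obtain k :: int where k: "t'' = t' + of_int k * T" using t''(1) circ_eq_iff[OF T_pos] by blast
  have r2: "rch \<tau> x t'' y'" by (rule rch_trans[OF r1 t''(2)])
  define s where "s = \<tau> + real_of_int k * T"
  have st: "\<bar>s - t''\<bar> < d" using t'(2) by (simp add: s_def k abs_minus_commute)
  have "real N * T < real_of_int k * T"
    using rch_le[OF t''(2)] t'(2) d(3) by (simp add: r_def k algebra_simps)
  then have "real N < real_of_int k" using T_pos by simp
  then have kN: "int N < k" by linarith
  then have \<tau>s: "\<tau> \<le> s" using T_pos by (simp add: s_def)
  have ny: "norm y' \<le> norm x + 1" using norm_triangle_ineq[of x "y' - x"] t'(3) d(2) by simp
  have "\<exists>z u. u \<in> controls \<and> rch \<tau> x s z \<and> z = \<phi> s t'' y' u"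
  proof (cases "t'' \<le> s")
    case True
    then show ?thesis using rch_trans[OF r2 rch_phi[OF zero_controls True]] zero_controls by blast
  next
    case False
    obtain v where v: "v \<in> controls" "\<phi> t'' \<tau> x v = y'" using r2 by (auto simp: rch_def)
    have "\<phi> s t'' y' v = \<phi> s \<tau> x v" using phi_flow[OF controls_L_infty[OF v(1)], of s t'' \<tau> x] v(2) by simp
    then show ?thesis using rch_phi[OF v(1) \<tau>s] v(1) by metis
  qed
  then obtain z u' where z: "u' \<in> controls" "rch \<tau> x s z" "z = \<phi> s t'' y' u'" by blast
  have "norm (z - y') \<le> C * \<bar>s - t''\<bar>" unfolding z(3) using st d(2) by (intro C(2)[OF z(1) ny]) simp
  also have "\<dots> \<le> C * d" using st C(1) by (intro mult_left_mono) auto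
  finally have "norm (z - x) < C * d + d"
    using norm_triangle_ineq[of "z - y'" "y' - x"] t'(3) by simp
  also have "\<dots> = d * (C + 1)" by (simp add: algebra_simps)
  also have "\<dots> \<le> e" using d(4) C(1) by (simp add: field_simps)
  finally have "norm (z - x) < e" .
  moreover have "s = \<tau> + real (nat k) * T" using kN by (simp add: s_def)
  ultimately show ?thesis using that[of "nat k" z] z(2) kN by simp
qed

text \<open>Scaling a control by \<open>b < 1\<close> leaves the reserve \<open>(1 - b) U\<close>. It shifts the approximate return of
  \<open>b x\<close> to neighbouring points of the ray, so that finitely many steps connect \<open>0\<close> and \<open>a x\<close>.\<close>

lemma steer_along_ray:
  assumes D: "D \<subseteq> S1 \<times> UNIV" "wica D" and q: "(circ T \<tau>, x) \<in> D" and \<tau>: "phase T (circ T \<tau>) = \<tau>"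
    and a: "0 \<le> a" "a < 1"
  shows "(circ T \<tau>, a *\<^sub>R x) \<in> \<R> \<inter> \<C>"
proof -
  obtain N e where N: "e > 0" "\<And>k b. N \<le> k \<Longrightarrow> norm b < e \<Longrightarrow> rch \<tau> 0 (\<tau> + real k * T) b"
    using rch_ball[of \<tau>] by metis
  \<comment> \<open>Half of the reserve pays for the error of the return, half for the step along
    the ray: together less than \<open>(1 - a) * e\<close>, which is at most
    \<open>(1 - b) * e\<close>.\<close>
  define h where "h = (1 - a) * e / 2"
  have h: "h > 0" using a N(1) by (simp add: h_def)
  obtain k z where k: "N \<le> k" "rch \<tau> x (\<tau> + real k * T) z" "norm (z - x) < h"
    using near_return[OF D q \<tau> h, of N] by metis
  let ?P = "\<lambda>b c. \<exists>k::nat. rch \<tau> (b *\<^sub>R x) (\<tau> + real k * T) (c *\<^sub>R x)"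
  have step: "?P b c" if b: "0 \<le> b" "b \<le> a" and c: "\<bar>c - b\<bar> * norm x < h" for b c
  proof -
    \<comment> \<open>Chosen so that \<open>b z + (1 - b) w = c x\<close>; the estimate below makes
      \<open>w\<close> reachable from 0 in the same time as \<open>z\<close> from
      \<open>x\<close>.\<close>
    define w where "w = (1 / (1 - b)) *\<^sub>R (c *\<^sub>R x - b *\<^sub>R z)"
    have "c *\<^sub>R x - b *\<^sub>R z = (c - b) *\<^sub>R x + b *\<^sub>R (x - z)" by (simp add: algebra_simps)
    then have "norm (c *\<^sub>R x - b *\<^sub>R z) \<le> \<bar>c - b\<bar> * norm x + b * norm (x - z)"
      using b by (metis abs_of_nonneg norm_scaleR norm_triangle_ineq)
    also have "b * norm (x - z) \<le> 1 * norm (x - z)" using b a by (intro mult_right_mono) auto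
    finally have "norm (c *\<^sub>R x - b *\<^sub>R z) < h + h" using c k(3) by (simp add: norm_minus_commute)
    also have "h + h = (1 - a) * e" by (simp add: h_def)
    also have "\<dots> \<le> (1 - b) * e" using b N(1) by (intro mult_right_mono) auto
    finally have "norm (c *\<^sub>R x - b *\<^sub>R z) / (1 - b) < e" using b a by (simp add: field_simps)
    moreover have "norm w = norm (c *\<^sub>R x - b *\<^sub>R z) / (1 - b)"
      unfolding w_def norm_scaleR using b a by simp
    ultimately have "norm w < e" by simp
    then have "rch \<tau> 0 (\<tau> + real k * T) w" by (rule N(2)[OF k(1)])
    from rch_convex[OF k(2) this, of b "1 - b"]
    have "rch \<tau> (b *\<^sub>R x) (\<tau> + real k * T) (b *\<^sub>R z + (1 - b) *\<^sub>R w)" using b a by simp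
    also have "b *\<^sub>R z + (1 - b) *\<^sub>R w = c *\<^sub>R x" using b a by (simp add: w_def)
    finally show ?thesis by blast
  qed
  have trans: "?P b d" if bc: "?P b c" and cd: "?P c d" for b c d
  proof -
    obtain k l :: nat where kl: "rch \<tau> (b *\<^sub>R x) (\<tau> + real k * T) (c *\<^sub>R x)"
      "rch \<tau> (c *\<^sub>R x) (\<tau> + real l * T) (d *\<^sub>R x)" using bc cd by blast
    have "rch (\<tau> + real k * T) (c *\<^sub>R x) ((\<tau> + real l * T) + real k * T) (d *\<^sub>R x)"
      unfolding rch_shift_nat by (rule kl(2))
    from rch_trans[OF kl(1) this] show ?thesis
      by (intro exI[of _ "l + k"]) (simp add: algebra_simps)
  qed
  \<comment> \<open>Enough equal subdivisions of the segment from 0 to \<open>a x\<close> for each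
    step to be shorter than \<open>h\<close>; the step condition is symmetric, so the chain can be
    run in both directions.\<close>
  obtain n :: nat where n: "a * norm x / h < real n" using reals_Archimedean2 by blast
  define b where "b = (\<lambda>i. a * real i / real (Suc n))"
  have b: "0 \<le> b i" "i \<le> Suc n \<Longrightarrow> b i \<le> a" "\<bar>b (Suc i) - b i\<bar> * norm x < h" for i
  proof -
    show "0 \<le> b i" using a by (simp add: b_def)
    show "i \<le> Suc n \<Longrightarrow> b i \<le> a" using a mult_left_mono[of "real i" "real (Suc n)" a] by (simp add: b_def field_simps)
    have "b (Suc i) - b i = (a * real (Suc i) - a * real i) / real (Suc n)"
      unfolding b_def by (rule diff_divide_distrib[symmetric])
    then have "b (Suc i) - b i = a / real (Suc n)" by (simp add: algebra_simps)
    moreover have "a * norm x < h * real (Suc n)" using n h by (simp add: field_simps)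
    then have "a * norm x / real (Suc n) < h" by (simp add: divide_less_eq mult.commute del: of_nat_Suc)
    ultimately show "\<bar>b (Suc i) - b i\<bar> * norm x < h" using a by (simp del: of_nat_Suc)
  qed
  have b0: "b 0 = 0" and bn: "b (Suc n) = a" by (simp_all add: b_def del: of_nat_Suc)
  have refl: "?P c c" for c
    using rch_zero_control[of \<tau> \<tau> "c *\<^sub>R x"] by (intro exI[of _ 0]) simp
  have "i \<le> Suc n \<Longrightarrow> ?P 0 (b i)" for i
  proof (induction i)
    case 0
    then show ?case using refl[of 0] by (simp only: b0)
  next
    case (Suc i)
    have "?P (b i) (b (Suc i))" using Suc.prems b by (intro step) auto
    moreover have "?P 0 (b i)" using Suc by simp
    ultimately show ?case using trans by blast
  qed
  then have "?P 0 a" using bn by (metis order_refl)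
  then obtain k1 :: nat where "rch \<tau> 0 (\<tau> + real k1 * T) (a *\<^sub>R x)" by auto
  then have "(circ T (\<tau> + of_int (int k1) * T), a *\<^sub>R x) \<in> \<R>" using Reach_trans[OF zero_in_Reach] by simp
  then have R: "(circ T \<tau>, a *\<^sub>R x) \<in> \<R>" unfolding circ_add_int_mult[OF T_pos] .
  have "i \<le> Suc n \<Longrightarrow> ?P (b i) 0" for i
  proof (induction i)
    case 0
    then show ?case using refl[of 0] by (simp only: b0)
  next
    case (Suc i)
    have "\<bar>b i - b (Suc i)\<bar> * norm x < h" using b(3)[of i] by (simp only: abs_minus_commute)
    then have "?P (b (Suc i)) (b i)" using Suc.prems b by (intro step) auto
    moreover have "?P (b i) 0" using Suc by simp
    ultimately show ?case using trans by blast
  qed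
  then have "?P a 0" using bn by (metis order_refl)
  then obtain k2 :: nat where "rch \<tau> (a *\<^sub>R x) (\<tau> + real k2 * T) 0" by auto
  then have "(circ T \<tau>, a *\<^sub>R x) \<in> \<C>" using Contr_trans[OF zero_in_Contr] by blast
  then show ?thesis using R by blast
qed

text \<open>A slight contraction of an interior point stays in \<open>D\<close> and lies in
  \<open>\<R> \<inter> \<C>\<close>, hence \<open>D\<close> is contained in the known control set
  and equals it by maximality.\<close>

lemma control_set_unique:
  assumes "control_set_nonvoid_interior cylinder (phi_a T A B) controls D"
  shows "D = \<D>"
proof -
  have D: "D \<subseteq> S1 \<times> UNIV" "wica D" "cylinder interior_of D \<noteq> {}"
    and max: "\<And>D'. D \<subseteq> D' \<Longrightarrow> D' \<subseteq> topspace cylinder \<Longrightarrow> wica D' \<Longrightarrow> D' = D"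
    using assms unfolding control_set_nonvoid_interior_def control_set_def by auto
  obtain q where q: "q \<in> cylinder interior_of D" using D(3) by blast
  have "openin cylinder (cylinder interior_of D)" by simp
  then obtain e where e: "e > 0" "\<And>q'. q' \<in> S1 \<times> UNIV \<Longrightarrow> dist q' q < e \<Longrightarrow> q' \<in> cylinder interior_of D"
    using q unfolding cylinder_def openin_euclidean_subtopology_iff by metis
  have qD: "q \<in> D" using q interior_of_subset[of cylinder D] by blast
  then have "q \<in> S1 \<times> UNIV" using D(1) by blast
  define \<tau> where "\<tau> = phase T (fst q)"
  obtain x where x: "q = (circ T \<tau>, x)" using point_circ[OF \<open>q \<in> S1 \<times> UNIV\<close>] unfolding \<tau>_def .
  have ph: "phase T (circ T \<tau>) = \<tau>"
    using \<open>q \<in> S1 \<times> UNIV\<close> circ_phase[OF T_pos, of "fst q"] by (auto simp: \<tau>_def)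
  \<comment> \<open>Small enough that moving \<open>x\<close> by \<open>\<eta> x\<close> stays
    within distance \<open>e\<close>; \<open>norm x + 1\<close> also covers
    \<open>x = 0\<close>.\<close>
  define \<eta> where "\<eta> = min 1 (e / (norm x + 1))"
  have \<eta>: "0 < \<eta>" "\<eta> \<le> 1" using e(1) by (auto simp: \<eta>_def add_nonneg_pos)
  have "\<eta> * norm x \<le> e / (norm x + 1) * norm x" by (intro mult_right_mono) (auto simp: \<eta>_def)
  also have "\<dots> = e * (norm x / (norm x + 1))" by simp
  also have "\<dots> < e * 1"
  proof (rule mult_strict_left_mono[OF _ e(1)])
    have "0 < norm x + 1" by (simp add: add_nonneg_pos)
    then show "norm x / (norm x + 1) < 1" by (simp add: divide_less_eq)
  qed
  finally have "\<eta> * norm x < e" by simp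
  moreover have "(1 - \<eta>) *\<^sub>R x - x = - (\<eta> *\<^sub>R x)" by (simp add: algebra_simps)
  then have "dist ((1 - \<eta>) *\<^sub>R x) x = \<eta> * norm x" using \<eta> unfolding dist_norm by simp
  ultimately have "dist (circ T \<tau>, (1 - \<eta>) *\<^sub>R x) q < e"
    using \<eta>(1) by (simp add: x dist_Pair_Pair abs_of_nonneg[of "\<eta> * norm x"])
  then have "(circ T \<tau>, (1 - \<eta>) *\<^sub>R x) \<in> cylinder interior_of D" by (intro e(2)) simp_all
  then have "(circ T \<tau>, (1 - \<eta>) *\<^sub>R x) \<in> D" using interior_of_subset[of cylinder D] by blast
  moreover have "(circ T \<tau>, (1 - \<eta>) *\<^sub>R x) \<in> \<R> \<inter> \<C>"
    using \<eta> by (intro steer_along_ray[OF D(1,2) _ ph] qD[unfolded x]) auto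
  ultimately have "D \<subseteq> \<D>" using wica_subset[OF D(1,2)] by blast
  moreover have "\<D> \<subseteq> topspace cylinder" using Contr_subset by auto
  ultimately show ?thesis using max[OF _ _ control_set_weakly_invariant] by blast
qed

lemma D_a_eq: "D_a T A B U = \<D>"
  unfolding D_a_def using control_set_D control_set_unique by (rule the_equality)

end

section \<open>Projection to the Poincare sphere\<close>

text \<open>The height of the projected point above the equator; it tends to 0 exactly when
  \<open>x\<close> goes to infinity.\<close>

definition inv_len :: "real^'d \<Rightarrow> real" where
  "inv_len x = 1 / sqrt (1 + (norm x)\<^sup>2)"

definition proj_sphere :: "real^'d \<Rightarrow> (real^'d) \<times> real" where
  "proj_sphere x = inv_len x *\<^sub>R (x, 1)"

lemma e_P_eq: "e_P p = (fst p, proj_sphere (snd p))"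
  by (simp add: e_P_def proj_sphere_def inv_len_def)

lemma inv_len_pos: "inv_len x > 0"
  by (simp add: inv_len_def add_pos_nonneg)

lemma inv_len_nonzero [simp]: "inv_len x \<noteq> 0"
  using inv_len_pos[of x] by simp

lemma inv_len_square: "(inv_len x)\<^sup>2 * (1 + (norm x)\<^sup>2) = 1"
proof -
  have "1 + (norm x)\<^sup>2 > 0" by (simp add: add_pos_nonneg)
  then show ?thesis by (simp add: inv_len_def power_divide)
qed

lemma continuous_inv_len: "continuous_on S inv_len"
proof -
  have "1 + (norm x)\<^sup>2 \<noteq> 0" for x :: "real^'d"
    by (metis add_pos_nonneg less_irrefl zero_le_power2 zero_less_one)
  then show ?thesis unfolding inv_len_def[abs_def] by (intro continuous_intros) auto
qed

lemma continuous_proj_sphere: "continuous_on S proj_sphere"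
  unfolding proj_sphere_def[abs_def] by (intro continuous_intros continuous_inv_len)

lemma inv_len_has_derivative:
  "(inv_len has_derivative (\<lambda>v. - (inv_len x ^ 3 * (x \<bullet> v)))) (at x)"
proof -
  have p: "1 + x \<bullet> x > 0" by (simp add: add_pos_nonneg)
  have e: "inv_len = (\<lambda>y. inverse (sqrt (1 + y \<bullet> y)))"
    by (simp add: inv_len_def[abs_def] power2_norm_eq_inner inverse_eq_divide)
  have d: "((\<lambda>w. inverse (sqrt w)) has_real_derivative - (inverse (sqrt (1 + x \<bullet> x)) ^ 3 / 2)) (at (1 + x \<bullet> x))"
    using p by (auto intro!: derivative_eq_intros simp: power3_eq_cube power2_eq_square field_simps)
  have "((\<lambda>y. 1 + y \<bullet> y) has_derivative (\<lambda>v. 2 * (x \<bullet> v))) (at x)"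
    by (auto intro!: derivative_eq_intros simp: inner_commute)
  from has_derivative_compose[OF this d[THEN has_field_derivative_imp_has_derivative]]
  have "((\<lambda>y. inverse (sqrt (1 + y \<bullet> y))) has_derivative
      (\<lambda>v. - (inverse (sqrt (1 + x \<bullet> x)) ^ 3 / 2) * (2 * (x \<bullet> v)))) (at x)" .
  then show ?thesis unfolding e by (simp add: mult.commute)
qed

definition proj_sphere_deriv :: "real^'d \<Rightarrow> real^'d \<Rightarrow> (real^'d) \<times> real" where
  "proj_sphere_deriv x v =
    (inv_len x *\<^sub>R v - (inv_len x ^ 3 * (x \<bullet> v)) *\<^sub>R x, - (inv_len x ^ 3 * (x \<bullet> v)))"

lemma proj_sphere_has_derivative: "(proj_sphere has_derivative proj_sphere_deriv x) (at x)"
proof -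
  have "((\<lambda>x. (inv_len x *\<^sub>R x, inv_len x)) has_derivative
     (\<lambda>v. (inv_len x *\<^sub>R v + (- (inv_len x ^ 3 * (x \<bullet> v))) *\<^sub>R x, - (inv_len x ^ 3 * (x \<bullet> v))))) (at x)"
    by (intro has_derivative_Pair has_derivative_scaleR inv_len_has_derivative has_derivative_ident)
  then show ?thesis by (simp add: proj_sphere_def[abs_def] proj_sphere_deriv_def[abs_def])
qed

lemma bounded_linear_proj_sphere_deriv: "bounded_linear (proj_sphere_deriv x)"
  using proj_sphere_has_derivative by (rule has_derivative_bounded_linear)

lemma continuous_proj_sphere_deriv: "continuous_on UNIV (\<lambda>x. Blinfun (proj_sphere_deriv x))"
proof (rule continuous_on_blinfun_componentwise)
  fix i :: "real^'d"
  have "continuous_on UNIV (\<lambda>x. proj_sphere_deriv x i)"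
    unfolding proj_sphere_deriv_def by (intro continuous_intros continuous_inv_len)
  then show "continuous_on UNIV (\<lambda>x. blinfun_apply (Blinfun (proj_sphere_deriv x)) i)"
    by (simp add: bounded_linear_Blinfun_apply[OF bounded_linear_proj_sphere_deriv])
qed

text \<open>On the sphere the induced field is the tangential part of the homogenized field
  \<open>(A s + \<sigma> B u, 0)\<close>: its component along \<open>y\<close> is subtracted. This
  coordinate-free form serves both the conjugacy and the Lipschitz estimate.\<close>

lemma sphere_rhs_eq:
  "sphere_rhs A B u t y = (let v = A t *v fst y + snd y *\<^sub>R (B t *v u t) in (v, 0) - (fst y \<bullet> v) *\<^sub>R y)"
proof -
  obtain s \<sigma> where y: "y = (s, \<sigma>)" by (cases y)
  have Bu: "B t *v u t = (\<Sum>i\<in>UNIV. (u t $ i) *\<^sub>R column i (B t))"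
    by (simp add: matrix_mult_sum scalar_mult_eq_scaleR)
  have sBu: "s \<bullet> (B t *v u t) = (\<Sum>i\<in>UNIV. (u t $ i) * (s \<bullet> column i (B t)))"
    unfolding Bu by (simp add: inner_sum_right)
  have 1: "(\<Sum>i\<in>UNIV. (u t $ i) *\<^sub>R (- ((s \<bullet> column i (B t)) * \<sigma>) *\<^sub>R s + \<sigma> *\<^sub>R column i (B t))) =
    \<sigma> *\<^sub>R (B t *v u t) - (\<sigma> * (s \<bullet> (B t *v u t))) *\<^sub>R s"
  proof -
    have "(u t $ i) *\<^sub>R (- ((s \<bullet> column i (B t)) * \<sigma>) *\<^sub>R s + \<sigma> *\<^sub>R column i (B t)) =
      \<sigma> *\<^sub>R ((u t $ i) *\<^sub>R column i (B t)) - (\<sigma> * ((u t $ i) * (s \<bullet> column i (B t)))) *\<^sub>R s" for i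
      by (simp add: algebra_simps)
    then show ?thesis unfolding sBu unfolding Bu
      by (simp only: sum_subtractf scaleR_sum_right sum_distrib_left scaleR_left.sum)
  qed
  have 2: "(\<Sum>i\<in>UNIV. (u t $ i) * (s \<bullet> column i (B t)) * \<sigma>\<^sup>2) = \<sigma>\<^sup>2 * (s \<bullet> (B t *v u t))"
    unfolding sBu sum_distrib_left by (rule sum.cong) simp_all
  show ?thesis
    unfolding y sphere_rhs_def prod.case 1 2 Let_def
    by (simp add: inner_add_right algebra_simps power2_eq_square)
qed

lemma proj_sphere_deriv_lin_rhs:
  "proj_sphere_deriv x (lin_rhs A B u t x) = sphere_rhs A B u t (proj_sphere x)"
proof -
  let ?w = "A t *v x + B t *v u t" and ?r = "inv_len x"
  have "A t *v fst (proj_sphere x) + snd (proj_sphere x) *\<^sub>R (B t *v u t) = ?r *\<^sub>R ?w"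
    by (simp add: proj_sphere_def matrix_vector_mult_scaleR scaleR_add_right)
  then show ?thesis
    unfolding sphere_rhs_eq proj_sphere_deriv_def lin_rhs_def Let_def
    by (simp add: proj_sphere_def power3_eq_cube mult_ac)
qed

text \<open>The term \<open>(s \<bullet> v) y\<close> is a product of three factors, each linear in
  the state; replacing one factor at a time costs \<open>C * K\<^sup>2\<close> per factor, which
  explains the 3.\<close>

lemma quadratic_field_lipschitz:
  fixes v v' s s' :: "'a::real_inner" and \<sigma> \<sigma>' :: real
  assumes C: "C \<ge> 0" and K: "norm (s, \<sigma>) \<le> K" "norm (s', \<sigma>') \<le> K"
    and v: "norm v \<le> C * K" "norm v' \<le> C * K" "norm (v - v') \<le> C * norm ((s, \<sigma>) - (s', \<sigma>'))"
  shows "norm ((v, 0) - (s \<bullet> v) *\<^sub>R (s, \<sigma>) - ((v', 0) - (s' \<bullet> v') *\<^sub>R (s', \<sigma>')))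
    \<le> (C + 3 * C * K\<^sup>2) * norm ((s, \<sigma>) - (s', \<sigma>'))"
proof -
  let ?y = "(s, \<sigma>)" and ?y' = "(s', \<sigma>')" let ?d = "norm (?y - ?y')"
  have K0: "K \<ge> 0" using K(1) norm_ge_zero order_trans by blast
  have ns: "norm s \<le> K" "norm s' \<le> K" and nd: "norm (s - s') \<le> ?d"
    using K norm_fst_le[of s \<sigma>] norm_fst_le[of s' \<sigma>'] norm_fst_le[of "s - s'" "\<sigma> - \<sigma>'"] by auto
  have e: "(v, 0) - (s \<bullet> v) *\<^sub>R ?y - ((v', 0) - (s' \<bullet> v') *\<^sub>R ?y') =
    (v - v', 0) - ((s \<bullet> v) *\<^sub>R (?y - ?y') + ((s - s') \<bullet> v + s' \<bullet> (v - v')) *\<^sub>R ?y')"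
    by (simp add: algebra_simps inner_diff_left inner_diff_right)
  have 1: "norm ((s \<bullet> v) *\<^sub>R (?y - ?y')) \<le> K * (C * K) * ?d"
    unfolding norm_scaleR
    by (intro mult_right_mono order_trans[OF Cauchy_Schwarz_ineq2] mult_mono ns v K0) auto
  have "\<bar>(s - s') \<bullet> v + s' \<bullet> (v - v')\<bar> \<le> ?d * (C * K) + K * (C * ?d)"
    by (intro order_trans[OF abs_triangle_ineq] add_mono order_trans[OF Cauchy_Schwarz_ineq2] mult_mono ns v nd K0) auto
  then have 2: "norm (((s - s') \<bullet> v + s' \<bullet> (v - v')) *\<^sub>R ?y') \<le> (?d * (C * K) + K * (C * ?d)) * K"
    unfolding norm_scaleR using C K0 by (intro mult_mono K) auto
  have 3: "norm (v - v', 0::real) \<le> C * ?d" using v(3) by (simp add: norm_Pair)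
  have "norm ((v, 0) - (s \<bullet> v) *\<^sub>R ?y - ((v', 0) - (s' \<bullet> v') *\<^sub>R ?y')) \<le>
    C * ?d + (K * (C * K) * ?d + (?d * (C * K) + K * (C * ?d)) * K)"
    unfolding e
    by (intro order_trans[OF norm_triangle_ineq4] add_mono 3 order_trans[OF norm_triangle_ineq] 1 2)
  also have "\<dots> = (C + 3 * C * K\<^sup>2) * ?d" by (simp add: algebra_simps power2_eq_square)
  finally show ?thesis .
qed

context periodic_control_system
begin

lemma sphere_rhs_local_lipschitz:
  assumes "u \<in> L_infty_on UNIV"
  shows "\<exists>L. AE r in lebesgue. \<forall>y y'. norm y \<le> K \<longrightarrow> norm y' \<le> K \<longrightarrow>
    norm (sphere_rhs A B u r y - sphere_rhs A B u r y') \<le> L * norm (y - y')"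
proof -
  obtain a where a: "a > 0" "AE r in lebesgue. \<forall>x. norm (A r *v x) \<le> a * norm x"
    using bounded_bilinear_AE_bound[OF bounded_bilinear_matrix_vector A_L_infty] .
  obtain b where b: "AE r in lebesgue. norm (B r *v u r) \<le> b"
    using L_infty_Bu[OF assms] unfolding L_infty_UNIV_iff by blast
  define C where "C = a + \<bar>b\<bar>"
  have "AE r in lebesgue. \<forall>y y'. norm y \<le> K \<longrightarrow> norm y' \<le> K \<longrightarrow>
    norm (sphere_rhs A B u r y - sphere_rhs A B u r y') \<le> (C + 3 * C * K\<^sup>2) * norm (y - y')"
    using a(2) b
  proof eventually_elim
    case (elim r)
    let ?v = "\<lambda>y::(real^'d) \<times> real. A r *v fst y + snd y *\<^sub>R (B r *v u r)"
    have b0: "0 \<le> b" using elim(2) norm_ge_zero order_trans by blast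
    have v: "norm (?v y) \<le> C * norm y" for y
    proof -
      have "norm (?v y) \<le> a * norm (fst y) + \<bar>snd y\<bar> * b"
        using elim by (intro norm_triangle_mono) (auto intro: mult_left_mono)
      also have "\<dots> \<le> a * norm y + norm y * \<bar>b\<bar>"
        using a(1) b0 norm_fst_le[of "fst y" "snd y"] norm_snd_le[of "snd y" "fst y"]
        by (intro add_mono mult_mono) auto
      finally show ?thesis by (simp add: C_def algebra_simps)
    qed
    have vd: "?v y - ?v y' = ?v (y - y')" for y y'
      by (simp add: matrix_vector_mult_diff_distrib algebra_simps)
    have C: "C \<ge> 0" using a(1) by (simp add: C_def)
    show ?case
    proof (intro allI impI)
      fix y y' :: "(real^'d) \<times> real" assume y: "norm y \<le> K" "norm y' \<le> K"
      have vK: "norm (?v z) \<le> C * K" if "norm z \<le> K" for z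
        using order_trans[OF v mult_left_mono[OF that C]] .
      show "norm (sphere_rhs A B u r y - sphere_rhs A B u r y') \<le> (C + 3 * C * K\<^sup>2) * norm (y - y')"
        unfolding sphere_rhs_eq Let_def
        using quadratic_field_lipschitz[OF C, of "fst y" "snd y" K "fst y'" "snd y'" "?v y" "?v y'"]
          y vK[OF y(1)] vK[OF y(2)] v[of "y - y'"] unfolding vd by simp
    qed
  qed
  then show ?thesis by blast
qed

text \<open>The chain rule shows that the projected trajectory solves the equation on the sphere,
  and local uniqueness identifies it with the solution selected by \<open>phi_P\<close>.\<close>

lemma phi_P_proj_sphere:
  assumes u: "u \<in> controls"
  shows "phi_P A B t s (proj_sphere x) u = proj_sphere (\<phi> t s x u)"
proof -
  note L = controls_L_infty[OF u]
  let ?x = "\<lambda>r. \<phi> r s x u" and ?F' = "\<lambda>y. Blinfun (proj_sphere_deriv y)"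
  have sol: "solves (lin_rhs A B u) ?x" by (rule phi_solves[OF L])
  have F': "blinfun_apply (?F' y) = proj_sphere_deriv y" for y
    by (rule bounded_linear_Blinfun_apply[OF bounded_linear_proj_sphere_deriv])
  have der: "(proj_sphere has_derivative ?F' y) (at y)" for y
    unfolding F' by (rule proj_sphere_has_derivative)
  have bnd: "\<exists>K. AE r in lebesgue. r \<in> {a..b} \<longrightarrow> norm (lin_rhs A B u r (?x r)) \<le> K" for a b
  proof -
    have "bounded (?x ` {a..b})"
      by (intro compact_imp_bounded compact_continuous_image solves_continuous[OF sol]) simp
    then obtain M where M: "\<forall>y\<in>?x ` {a..b}. norm y \<le> M" unfolding bounded_iff by blast
    obtain c where c: "c > 0" "AE r in lebesgue. \<forall>x. norm (A r *v x) \<le> c * norm x"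
      using bounded_bilinear_AE_bound[OF bounded_bilinear_matrix_vector A_L_infty] .
    obtain d where d: "AE r in lebesgue. norm (B r *v u r) \<le> d"
      using L_infty_Bu[OF L] unfolding L_infty_UNIV_iff by blast
    have "AE r in lebesgue. r \<in> {a..b} \<longrightarrow> norm (lin_rhs A B u r (?x r)) \<le> c * M + d"
      using c(2) d
    proof eventually_elim
      case (elim r)
      show ?case
      proof
        assume "r \<in> {a..b}"
        then have "norm (?x r) \<le> M" using M by blast
        then have "norm (A r *v ?x r) \<le> c * M"
          using elim(1) c(1) by (meson less_imp_le mult_left_mono order_trans)
        then show "norm (lin_rhs A B u r (?x r)) \<le> c * M + d"
          unfolding lin_rhs_def using elim(2) by (rule norm_triangle_mono)
      qed
    qed
    then show ?thesis by blast
  qed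
  note chain = solves_chain_rule[OF sol bnd der continuous_proj_sphere_deriv, unfolded F' proj_sphere_deriv_lin_rhs]
  have "solves (sphere_rhs A B u) (\<lambda>r. proj_sphere (?x r))"
    unfolding solves_def
  proof (intro conjI allI impI)
    fix a b show "(\<lambda>r. sphere_rhs A B u r (proj_sphere (?x r))) absolutely_integrable_on {a..b}"
      using chain(1)[of a b] by (cases "a \<le> b") auto
  qed (rule chain(2))
  from ode_solution_eqI[OF this sphere_rhs_local_lipschitz[OF L], of t s]
  show ?thesis by (simp add: phi_P_def phi_init[OF L])
qed

lemma phi_P_a_e_P:
  assumes "u \<in> controls"
  shows "phi_P_a T A B t (e_P p) u = e_P (phi_a T A B t p u)"
  by (simp add: phi_P_a_def phi_a_def autonomized_def e_P_eq Let_def phi_P_proj_sphere[OF assms])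

end

lemma norm_proj_sphere: "norm (proj_sphere x) = 1"
proof -
  have "(norm (proj_sphere x))\<^sup>2 = (inv_len x)\<^sup>2 * (1 + (norm x)\<^sup>2)"
    unfolding power2_norm_eq_inner by (simp add: proj_sphere_def algebra_simps power2_eq_square)
  then have "(norm (proj_sphere x))\<^sup>2 = 1" by (simp add: inv_len_square)
  then show ?thesis by (metis norm_ge_zero power2_eq_1_iff power_one power2_eq_iff_nonneg zero_le_one)
qed

lemma proj_sphere_upper: "proj_sphere x \<in> Sd_upper"
  using norm_proj_sphere[of x] inv_len_pos[of x] by (simp add: Sd_upper_def Sd_def) (simp add: proj_sphere_def)

lemma proj_sphere_surj:
  assumes "y \<in> Sd_upper"
  shows "proj_sphere ((1 / snd y) *\<^sub>R fst y) = y"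
proof -
  obtain s \<sigma> where y: "y = (s, \<sigma>)" by (cases y)
  have \<sigma>: "\<sigma> > 0" and n: "norm (s, \<sigma>) = 1" using assms by (auto simp: y Sd_upper_def Sd_def)
  have "(norm s)\<^sup>2 + \<sigma>\<^sup>2 = 1" using n by (simp add: norm_Pair)
  then have "1 + (norm ((1 / \<sigma>) *\<^sub>R s))\<^sup>2 = (1 / \<sigma>)\<^sup>2"
    using \<sigma> by (simp add: power_divide field_simps)
  then have "inv_len ((1 / \<sigma>) *\<^sub>R s) = \<sigma>" unfolding inv_len_def using \<sigma> by (simp add: real_sqrt_divide)
  then show ?thesis using \<sigma> by (simp add: y proj_sphere_def)
qed

lemma zero_height_notin_upper: "(s, 0) \<notin> Sd_upper"
  by (simp add: Sd_upper_def)

lemma continuous_e_P: "continuous_on S e_P"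
  unfolding e_P_eq[abs_def]
  by (intro continuous_intros continuous_on_compose2[OF continuous_proj_sphere[of UNIV]]) auto

lemma homeomorphic_e_P:
  "homeomorphic_maps cylinder upper_bundle e_P (\<lambda>q. (fst q, (1 / snd (snd q)) *\<^sub>R fst (snd q)))"
proof -
  have c2: "continuous_on (S1 \<times> Sd_upper) (\<lambda>q. (fst q, (1 / snd (snd q)) *\<^sub>R fst (snd q)))"
    by (intro continuous_intros) (auto simp: zero_height_notin_upper)
  show ?thesis
    unfolding homeomorphic_maps_def cylinder_def upper_bundle_def continuous_map_in_subtopology
    using continuous_e_P c2 proj_sphere_upper proj_sphere_surj inv_len_pos
    by (auto simp: e_P_eq proj_sphere_def less_imp_neq[symmetric] zero_height_notin_upper)
qed

section \<open>Behaviour at the equator\<close>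

lemma closed_sphere_bundle: "closed (S1 \<times> Sd)"
  by (simp add: Sd_def closed_Times)

lemma sphere_bundle_closure: "Y \<subseteq> S1 \<times> Sd \<Longrightarrow> sphere_bundle closure_of Y = closure Y"
  using closure_minimal[OF _ closed_sphere_bundle, of Y]
  by (auto simp: sphere_bundle_def closure_of_subtopology Int_absorb1)

lemma e_P_sphere_bundle: "S \<subseteq> S1 \<times> UNIV \<Longrightarrow> e_P ` S \<subseteq> S1 \<times> Sd"
  using norm_proj_sphere by (auto simp: e_P_eq Sd_def)

text \<open>The component of \<open>y\<close> orthogonal to \<open>V\<close> is itself an
  annihilator, and testing \<open>y\<close> with it shows that it vanishes.\<close>

lemma subspace_mem_by_annihilator:
  fixes V :: "(real^'n) set"
  assumes V: "subspace V" and ann: "\<And>p. (\<And>x. x \<in> V \<Longrightarrow> p \<bullet> x = 0) \<Longrightarrow> p \<bullet> y = 0"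
  shows "y \<in> V"
proof -
  obtain a z where z: "a \<in> span V" "\<And>w. w \<in> span V \<Longrightarrow> orthogonal z w" "y = a + z"
    using orthogonal_subspace_decomp_exists[of V y] by metis
  have zV: "z \<bullet> w = 0" if "w \<in> V" for w using z(2)[of w] span_base[OF that] by (simp add: orthogonal_def)
  have "z \<bullet> y = 0" by (rule ann) (rule zV)
  moreover have aV: "a \<in> V" using z(1) V by (simp add: span_eq_iff[THEN iffD2])
  then have "z \<bullet> a = 0" by (rule zV)
  ultimately have "z \<bullet> z = 0" using z(3) by (simp add: inner_add_right)
  then show ?thesis using z(3) aV by simp
qed

text \<open>Boundedness means that the heights \<open>inv_len\<close> stay away from 0. Conversely,
  the closure is compact, so when it misses the equator its least height is attained and
  positive.\<close>

lemma bounded_iff_closure_e_P_upper: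
  fixes S :: "(complex \<times> (real^'d)) set"
  assumes S: "S \<subseteq> S1 \<times> UNIV"
  shows "bounded S \<longleftrightarrow> closure (e_P ` S) \<subseteq> S1 \<times> Sd_upper"
proof
  let ?h = "\<lambda>q :: complex \<times> ((real^'d) \<times> real). snd (snd q)"
  have conth: "continuous_on Q ?h" for Q by (intro continuous_intros)
  have hP: "?h (e_P p) = inv_len (snd p)" for p :: "complex \<times> (real^'d)" by (simp add: e_P_eq proj_sphere_def)
  {
    assume "bounded S"
    then obtain C where C: "\<And>p. p \<in> S \<Longrightarrow> norm p \<le> C" unfolding bounded_iff by blast
    define c where "c = 1 / sqrt (1 + C\<^sup>2)"
    have c: "c > 0" by (simp add: c_def add_pos_nonneg)
    have "e_P ` S \<subseteq> (S1 \<times> Sd) \<inter> {q. c \<le> ?h q}"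
    proof (intro Int_greatest e_P_sphere_bundle[OF S] image_subsetI CollectI)
      fix p assume "p \<in> S"
      have "norm (snd p) \<le> C" using norm_snd_le[of "snd p" "fst p"] C[OF \<open>p \<in> S\<close>] by simp
      then have "(norm (snd p))\<^sup>2 \<le> C\<^sup>2" by (intro power_mono) auto
      then show "c \<le> ?h (e_P p)"
        unfolding hP inv_len_def c_def by (intro divide_left_mono) (auto simp: add_pos_nonneg intro!: mult_pos_pos)
    qed
    moreover have "closed ((S1 \<times> Sd) \<inter> {q. c \<le> ?h q})"
      by (intro closed_Int closed_sphere_bundle closed_Collect_le conth continuous_on_const)
    ultimately have "closure (e_P ` S) \<subseteq> (S1 \<times> Sd) \<inter> {q. c \<le> ?h q}" by (rule closure_minimal)
    then show "closure (e_P ` S) \<subseteq> S1 \<times> Sd_upper" using c by (fastforce simp: Sd_upper_def)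
  }
  {
    assume up: "closure (e_P ` S) \<subseteq> S1 \<times> Sd_upper"
    show "bounded S"
    proof (cases "S = {}")
      case False
      have "closure (e_P ` S) \<subseteq> S1 \<times> Sd"
        by (rule closure_minimal[OF e_P_sphere_bundle[OF S] closed_sphere_bundle])
      moreover have "compact (S1 \<times> Sd)" by (simp add: Sd_def compact_Times)
      ultimately have "compact (closure (e_P ` S))" using closed_Int_compact[of "closure (e_P ` S)"]
        by (metis closed_closure inf.absorb1)
      moreover have "closure (e_P ` S) \<noteq> {}" using False closure_subset[of "e_P ` S"] by auto
      ultimately obtain q where q: "q \<in> closure (e_P ` S)" "\<And>r. r \<in> closure (e_P ` S) \<Longrightarrow> ?h q \<le> ?h r"
        using continuous_attains_inf[OF _ _ conth] by metis
      define m where "m = ?h q"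
      have m: "m > 0" using q(1) up by (auto simp: m_def Sd_upper_def)
      show ?thesis
        unfolding bounded_iff
      proof (intro exI ballI)
        fix p assume p: "p \<in> S"
        have "m \<le> inv_len (snd p)"
          using q(2)[of "e_P p"] p closure_subset[of "e_P ` S"] by (auto simp: m_def hP)
        then have "m\<^sup>2 * (1 + (norm (snd p))\<^sup>2) \<le> (inv_len (snd p))\<^sup>2 * (1 + (norm (snd p))\<^sup>2)"
          using m by (intro mult_right_mono power_mono) auto
        also have "\<dots> = 1" by (rule inv_len_square)
        finally have "(m * norm (snd p))\<^sup>2 \<le> 1\<^sup>2" using m by (simp add: power_mult_distrib algebra_simps) (smt (verit) zero_le_power2)
        then have "m * norm (snd p) \<le> 1" by (rule power2_le_imp_le) simp
        then have "norm (snd p) \<le> 1 / m" using m by (simp add: field_simps)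
        moreover have "norm (fst p) = 1" using p S by auto
        moreover have "norm p \<le> norm (fst p) + norm (snd p)"
          by (metis norm_Pair_le prod.collapse)
        ultimately show "norm p \<le> 1 + 1 / m" by linarith
      qed
    qed simp
  }
qed

context periodic_control_system
begin

text \<open>If \<open>e_P\<close> of points of \<open>S\<close> tends to the equator, the heights
  tend to 0 and the points scaled by their heights tend to the direction \<open>w\<close>. A
  functional bounded by \<open>c\<close> on the pulled-back points is bounded by \<open>c\<close>
  times the height on the scaled ones, so it vanishes in the limit.\<close>

lemma equator_closure_subset:
  assumes S: "S \<subseteq> S1 \<times> UNIV" and V: "subspace V" and inv: "(*v) (X T 0) ` V \<subseteq> V"
    and bnd: "\<And>p. (\<And>x. x \<in> V \<Longrightarrow> p \<bullet> x = 0) \<Longrightarrow>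
      \<exists>c. \<forall>\<tau> y. \<tau> \<in> {0..<T} \<longrightarrow> (circ T \<tau>, y) \<in> S \<longrightarrow> \<bar>p \<bullet> (X 0 \<tau> *v y)\<bar> \<le> c"
    and q: "q \<in> closure (e_P ` S)" "q \<in> S1 \<times> Sd_equator"
  obtains \<tau> x where "\<tau> \<in> {0..<T}" "x \<in> V" "q = (circ T \<tau>, (X \<tau> 0 *v x, 0))" "norm (X \<tau> 0 *v x) = 1"
proof -
  obtain w where w: "q = (fst q, (w, 0))" "norm w = 1"
    using q(2) by (cases q) (auto simp: Sd_equator_def Sd_def)
  obtain f where f: "\<And>n. f n \<in> e_P ` S" "f \<longlonglongrightarrow> q" using q(1) unfolding closure_sequential by blast
  have "\<exists>g. \<forall>n. g n \<in> S \<and> f n = e_P (g n)" by (rule choice) (use f(1) in blast)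
  then obtain g where g: "\<And>n. g n \<in> S" "\<And>n. f n = e_P (g n)" by blast
  define \<tau> where "\<tau> = (\<lambda>n. phase T (fst (g n)))"
  have \<tau>: "\<tau> n \<in> {0..<T}" for n using phase_range[OF T_pos] by (simp add: \<tau>_def)
  have gc: "fst (g n) = circ T (\<tau> n)" for n
    using circ_phase[OF T_pos, of "fst (g n)"] g(1)[of n] S by (auto simp: \<tau>_def)
  \<comment> \<open>Compactness requires the closed interval: phases in \<open>{0..<T}\<close> may
    accumulate at \<open>T\<close>. That case is led back to phase 0 at the end by invariance of
    \<open>V\<close>.\<close>
  have "seq_compact {0..T}" by (rule compact_imp_seq_compact) simp
  moreover have "\<forall>n. \<tau> n \<in> {0..T}" using \<tau> by (auto simp: less_imp_le)
  ultimately obtain l r where l: "l \<in> {0..T}" and r: "strict_mono r" and lim: "(\<tau> \<circ> r) \<longlonglongrightarrow> l"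
    by (rule seq_compactE)
  let ?g = "\<lambda>n. g (r n)" let ?\<tau> = "\<lambda>n. \<tau> (r n)" let ?\<rho> = "\<lambda>n. inv_len (snd (?g n))"
  let ?w = "\<lambda>n. ?\<rho> n *\<^sub>R snd (?g n)"
  have lim\<tau>: "?\<tau> \<longlonglongrightarrow> l" using lim by (simp add: o_def)
  have fr: "(\<lambda>n. f (r n)) \<longlonglongrightarrow> q" using LIMSEQ_subseq_LIMSEQ[OF f(2) r] by (simp add: o_def)
  have limw: "?w \<longlonglongrightarrow> w" and lim\<rho>: "?\<rho> \<longlonglongrightarrow> 0" and limz: "(\<lambda>n. circ T (?\<tau> n)) \<longlonglongrightarrow> fst q"
    using tendsto_fst[OF tendsto_snd[OF fr]] tendsto_snd[OF tendsto_snd[OF fr]] tendsto_fst[OF fr]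
      arg_cong[OF w(1), of snd]
    by (simp_all add: g(2) e_P_eq proj_sphere_def gc)
  have "isCont (circ T) l" using continuous_circ[of UNIV T] by (simp add: continuous_on_eq_continuous_at)
  then have "(\<lambda>n. circ T (?\<tau> n)) \<longlonglongrightarrow> circ T l" by (rule isCont_tendsto_compose[OF _ lim\<tau>])
  then have ql: "fst q = circ T l" using limz LIMSEQ_unique by blast
  have limX: "(\<lambda>n. X 0 (?\<tau> n) *v ?w n) \<longlonglongrightarrow> X 0 l *v w"
    unfolding LIMSEQ_iff
  proof (intro allI impI)
    fix e :: real assume e: "e > 0"
    obtain d where d: "d > 0" "\<And>s x. \<bar>s - l\<bar> < d \<Longrightarrow> norm (x - w) < d \<Longrightarrow>
        norm (\<phi> 0 s x (\<lambda>_. 0) - \<phi> 0 l w (\<lambda>_. 0)) < e"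
      using phi_continuous[OF zero_controls e] by metis
    obtain n1 where n1: "\<And>n. n \<ge> n1 \<Longrightarrow> norm (?\<tau> n - l) < d" using lim\<tau> d(1) unfolding LIMSEQ_iff by blast
    obtain n2 where n2: "\<And>n. n \<ge> n2 \<Longrightarrow> norm (?w n - w) < d" using limw d(1) unfolding LIMSEQ_iff by blast
    show "\<exists>no. \<forall>n\<ge>no. norm (X 0 (?\<tau> n) *v ?w n - X 0 l *v w) < e"
      using d(2) n1 n2 by (intro exI[of _ "max n1 n2"]) (auto simp: phi_zero_control)
  qed
  have "X 0 l *v w \<in> V"
  proof (rule subspace_mem_by_annihilator[OF V])
    fix p assume "\<And>x. x \<in> V \<Longrightarrow> p \<bullet> x = 0"
    then obtain c where c: "\<And>\<tau> y. \<tau> \<in> {0..<T} \<Longrightarrow> (circ T \<tau>, y) \<in> S \<Longrightarrow> \<bar>p \<bullet> (X 0 \<tau> *v y)\<bar> \<le> c"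
      using bnd by blast
    have "\<bar>p \<bullet> (X 0 (?\<tau> n) *v ?w n)\<bar> \<le> c * ?\<rho> n" for n
    proof -
      have "(circ T (?\<tau> n), snd (?g n)) \<in> S" using g(1)[of "r n"] gc[of "r n"] by (metis prod.collapse)
      then have "\<bar>p \<bullet> (X 0 (?\<tau> n) *v snd (?g n))\<bar> \<le> c" by (rule c[OF \<tau>])
      then have "?\<rho> n * \<bar>p \<bullet> (X 0 (?\<tau> n) *v snd (?g n))\<bar> \<le> ?\<rho> n * c"
        using inv_len_pos[of "snd (?g n)"] by (intro mult_left_mono) auto
      then show ?thesis
        using inv_len_pos[of "snd (?g n)"] by (simp add: matrix_vector_mult_scaleR abs_mult mult.commute)
    qed
    moreover have "(\<lambda>n. c * ?\<rho> n) \<longlonglongrightarrow> 0" using tendsto_mult_right_zero[OF lim\<rho>] .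
    moreover have "(\<lambda>n. \<bar>p \<bullet> (X 0 (?\<tau> n) *v ?w n)\<bar>) \<longlonglongrightarrow> \<bar>p \<bullet> (X 0 l *v w)\<bar>"
      by (intro tendsto_intros limX)
    ultimately have "\<bar>p \<bullet> (X 0 l *v w)\<bar> \<le> 0" by (intro LIMSEQ_le) auto
    then show "p \<bullet> (X 0 l *v w) = 0" by simp
  qed
  moreover have return: "X l 0 *v (X 0 l *v w) = w" by (simp add: matrix_vector_mul_assoc fundamental_inverse)
  show ?thesis
  proof (cases "l < T")
    case True
    then show ?thesis using that[of l "X 0 l *v w"] l w ql \<open>X 0 l *v w \<in> V\<close> unfolding return by auto
  next
    case False
    then have "l = T" using l by simp
    then have "w \<in> V" using return inv \<open>X 0 l *v w \<in> V\<close> by (metis image_subset_iff)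
    moreover have "circ T l = circ T 0" using circ_add_int_mult[OF T_pos, of 0 1] \<open>l = T\<close> by simp
    ultimately show ?thesis using that[of 0 w] T_pos w ql by simp
  qed
qed

text \<open>The points \<open>w / h\<close> of the fibre project to the normalized vectors
  \<open>(w, h)\<close>, which tend to \<open>(w, 0)\<close> as \<open>h\<close> tends to 0.\<close>

lemma equator_in_closure:
  assumes V: "subspace V" and E: "\<And>\<tau>. E \<tau> = (*v) (X \<tau> 0) ` V"
    and \<tau>: "\<tau> \<in> {0..<T}" and x: "x \<in> V" "norm (X \<tau> 0 *v x) = 1"
  shows "(circ T \<tau>, (X \<tau> 0 *v x, 0)) \<in> closure (e_P ` subbundle T E)"
proof -
  define w where "w = X \<tau> 0 *v x"
  define G where "G = (\<lambda>h. (circ T \<tau>, (1 / sqrt (h\<^sup>2 + 1)) *\<^sub>R (w, h)))"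
  have "h\<^sup>2 + 1 \<noteq> 0" for h :: real by (metis add_nonneg_pos less_irrefl zero_le_power2 zero_less_one)
  then have "isCont G 0" unfolding G_def by (intro continuous_intros) auto
  then have lim: "(\<lambda>n. G (inverse (real (Suc n)))) \<longlonglongrightarrow> G 0"
    by (rule isCont_tendsto_compose[OF _ LIMSEQ_inverse_real_of_nat])
  have mem: "G h \<in> e_P ` subbundle T E" if h: "h > 0" for h
  proof -
    have "(1 / h) *\<^sub>R w \<in> E \<tau>"
      unfolding E using subspace_scale[OF V x(1), of "1 / h"]
      by (auto simp: w_def matrix_vector_mult_scaleR intro!: image_eqI[of _ _ "(1 / h) *\<^sub>R x"])
    then have "(circ T \<tau>, (1 / h) *\<^sub>R w) \<in> subbundle T E" using \<tau> by (auto simp: subbundle_def)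
    moreover have "e_P (circ T \<tau>, (1 / h) *\<^sub>R w) = G h"
    proof -
      have "1 + (norm ((1 / h) *\<^sub>R w))\<^sup>2 = (h\<^sup>2 + 1) / h\<^sup>2"
        using h x(2) by (simp add: w_def[symmetric] power_divide field_simps)
      then have "inv_len ((1 / h) *\<^sub>R w) = h / sqrt (h\<^sup>2 + 1)"
        unfolding inv_len_def using h by (simp add: real_sqrt_divide)
      then show ?thesis using h by (simp add: e_P_eq proj_sphere_def G_def)
    qed
    ultimately show ?thesis by (metis image_eqI)
  qed
  have "G 0 \<in> closure (e_P ` subbundle T E)"
    unfolding closure_sequential using lim mem by (intro exI[of _ "\<lambda>n. G (inverse (real (Suc n)))"]) auto
  then show ?thesis by (simp add: G_def w_def)
qed

lemma spectral_invariant: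
  "(*v) (X T 0) ` spectral_subspace P (X T 0) \<subseteq> spectral_subspace P (X T 0)"
  using spectral_fibre[of P T] spectral_fibre[of P 0] fundamental_shift[of T 0] by simp

lemma subbundle_S1: "subbundle T E \<subseteq> S1 \<times> UNIV"
  by (auto simp: subbundle_def)

lemma Reach_equator:
  assumes "q \<in> closure (e_P ` \<R>)" "q \<in> S1 \<times> Sd_equator"
  obtains \<tau> x where "\<tau> \<in> {0..<T}" "x \<in> spectral_subspace (\<lambda>r. r \<ge> 1) (X T 0)"
    "q = (circ T \<tau>, (X \<tau> 0 *v x, 0))" "norm (X \<tau> 0 *v x) = 1"
proof (rule equator_closure_subset[OF Reach_subset subspace_spectral_subspace spectral_invariant _ assms that])
  fix p assume p: "\<And>x. x \<in> spectral_subspace (\<lambda>r. r \<ge> 1) (X T 0) \<Longrightarrow> p \<bullet> x = 0"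
  show "\<exists>c. \<forall>\<tau> y. \<tau> \<in> {0..<T} \<longrightarrow> (circ T \<tau>, y) \<in> \<R> \<longrightarrow> \<bar>p \<bullet> (X 0 \<tau> *v y)\<bar> \<le> c"
    by (rule Reach_inner_bounded[OF p]) blast+
qed

lemma Contr_equator:
  assumes "q \<in> closure (e_P ` \<C>)" "q \<in> S1 \<times> Sd_equator"
  obtains \<tau> x where "\<tau> \<in> {0..<T}" "x \<in> spectral_subspace (\<lambda>r. r \<le> 1) (X T 0)"
    "q = (circ T \<tau>, (X \<tau> 0 *v x, 0))" "norm (X \<tau> 0 *v x) = 1"
proof (rule equator_closure_subset[OF Contr_subset subspace_spectral_subspace spectral_invariant _ assms that])
  fix p assume p: "\<And>x. x \<in> spectral_subspace (\<lambda>r. r \<le> 1) (X T 0) \<Longrightarrow> p \<bullet> x = 0"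
  show "\<exists>c. \<forall>\<tau> y. \<tau> \<in> {0..<T} \<longrightarrow> (circ T \<tau>, y) \<in> \<C> \<longrightarrow> \<bar>p \<bullet> (X 0 \<tau> *v y)\<bar> \<le> c"
    by (rule Contr_inner_bounded[OF p]) blast+
qed

lemma equator_Reach_eq:
  "closure (e_P ` \<R>) \<inter> (S1 \<times> Sd_equator) = closure (e_P ` subbundle T (E_plus_zero T A)) \<inter> (S1 \<times> Sd_equator)"
proof (intro subset_antisym subsetI)
  fix q assume q: "q \<in> closure (e_P ` \<R>) \<inter> (S1 \<times> Sd_equator)"
  then obtain \<tau> x where "\<tau> \<in> {0..<T}" "x \<in> spectral_subspace (\<lambda>r. r \<ge> 1) (X T 0)"
    "q = (circ T \<tau>, (X \<tau> 0 *v x, 0))" "norm (X \<tau> 0 *v x) = 1" using Reach_equator by blast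
  then show "q \<in> closure (e_P ` subbundle T (E_plus_zero T A)) \<inter> (S1 \<times> Sd_equator)"
    using equator_in_closure[OF subspace_spectral_subspace E_plus_zero_eq] q by blast
next
  fix q assume "q \<in> closure (e_P ` subbundle T (E_plus_zero T A)) \<inter> (S1 \<times> Sd_equator)"
  then show "q \<in> closure (e_P ` \<R>) \<inter> (S1 \<times> Sd_equator)"
    using closure_mono[OF image_mono[OF subbundle_plus_Reach]] by blast
qed

lemma equator_Contr_eq:
  "closure (e_P ` \<C>) \<inter> (S1 \<times> Sd_equator) = closure (e_P ` subbundle T (E_minus_zero T A)) \<inter> (S1 \<times> Sd_equator)"
proof (intro subset_antisym subsetI)
  fix q assume q: "q \<in> closure (e_P ` \<C>) \<inter> (S1 \<times> Sd_equator)"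
  then obtain \<tau> x where "\<tau> \<in> {0..<T}" "x \<in> spectral_subspace (\<lambda>r. r \<le> 1) (X T 0)"
    "q = (circ T \<tau>, (X \<tau> 0 *v x, 0))" "norm (X \<tau> 0 *v x) = 1" using Contr_equator by blast
  then show "q \<in> closure (e_P ` subbundle T (E_minus_zero T A)) \<inter> (S1 \<times> Sd_equator)"
    using equator_in_closure[OF subspace_spectral_subspace E_minus_zero_eq] q by blast
next
  fix q assume "q \<in> closure (e_P ` subbundle T (E_minus_zero T A)) \<inter> (S1 \<times> Sd_equator)"
  then show "q \<in> closure (e_P ` \<C>) \<inter> (S1 \<times> Sd_equator)"
    using closure_mono[OF image_mono[OF subbundle_minus_Contr]] by blast
qed

lemma subbundle_zero_interior: "subbundle T (E_zero T A) \<subseteq> cylinder interior_of \<D>"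
proof -
  have "subbundle T (E_zero T A) \<subseteq> subbundle T (E_plus_zero T A) \<inter> subbundle T (E_minus_zero T A)"
    unfolding subbundle_def E_plus_zero_eq E_minus_zero_eq E_zero_eq spectral_zero_Int[symmetric] by blast
  also have "\<dots> \<subseteq> \<R> \<inter> \<C>" using subbundle_plus_Reach subbundle_minus_Contr by blast
  finally show ?thesis using Reach_Contr_subset_interior by blast
qed

text \<open>A limit direction belongs to both centre-extended bundles, since the control set lies in
  the closure of \<open>\<R>\<close> and in \<open>\<C>\<close>. The point of the equator determines
  the phase in \<open>{0..<T}\<close> and, by invertibility of \<open>X \<tau> 0\<close>, the vector
  in the fibre over phase 0, so the two memberships concern the same vector.\<close>

lemma equator_control_set_eq:
  "closure (e_P ` (cylinder interior_of \<D>)) \<inter> (S1 \<times> Sd_equator) =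
    closure (e_P ` subbundle T (E_zero T A)) \<inter> (S1 \<times> Sd_equator)"
proof (intro subset_antisym subsetI)
  fix q assume q: "q \<in> closure (e_P ` (cylinder interior_of \<D>)) \<inter> (S1 \<times> Sd_equator)"
  have int: "cylinder interior_of \<D> \<subseteq> \<D>" by (rule interior_of_subset)
  have "cylinder closure_of \<R> \<subseteq> closure \<R>"
    using Reach_subset by (auto simp: cylinder_def closure_of_subtopology Int_absorb1)
  then have "e_P ` (cylinder interior_of \<D>) \<subseteq> e_P ` closure \<R>" using int by (intro image_mono) blast
  also have "\<dots> \<subseteq> closure (e_P ` \<R>)"
    by (rule image_closure_subset[OF continuous_e_P closed_closure closure_subset])
  finally have "closure (e_P ` (cylinder interior_of \<D>)) \<subseteq> closure (e_P ` \<R>)"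
    by (rule closure_minimal) simp
  then have "q \<in> closure (e_P ` \<R>)" using q by blast
  then obtain \<tau> x where 1: "\<tau> \<in> {0..<T}" "x \<in> spectral_subspace (\<lambda>r. r \<ge> 1) (X T 0)"
    "q = (circ T \<tau>, (X \<tau> 0 *v x, 0))" "norm (X \<tau> 0 *v x) = 1" using Reach_equator q by blast
  have "closure (e_P ` (cylinder interior_of \<D>)) \<subseteq> closure (e_P ` \<C>)"
    using int by (intro closure_mono image_mono) blast
  then have "q \<in> closure (e_P ` \<C>)" using q by blast
  then obtain \<tau>' x' where 2: "\<tau>' \<in> {0..<T}" "x' \<in> spectral_subspace (\<lambda>r. r \<le> 1) (X T 0)"
    "q = (circ T \<tau>', (X \<tau>' 0 *v x', 0))" using Contr_equator q by blast
  have "\<tau>' = \<tau>" using phase_circ_id[OF T_pos 1(1)] phase_circ_id[OF T_pos 2(1)] 1(3) 2(3) by simp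
  then have "X \<tau> 0 *v x' = X \<tau> 0 *v x" using 1(3) 2(3) by simp
  then have "X 0 \<tau> *v (X \<tau> 0 *v x') = X 0 \<tau> *v (X \<tau> 0 *v x)" by simp
  then have "x' = x" by (simp add: matrix_vector_mul_assoc fundamental_inverse)
  then have "x \<in> spectral_subspace (\<lambda>r. r = 1) (X T 0)" using 1(2) 2(2) spectral_zero_Int by blast
  then show "q \<in> closure (e_P ` subbundle T (E_zero T A)) \<inter> (S1 \<times> Sd_equator)"
    using equator_in_closure[OF subspace_spectral_subspace E_zero_eq 1(1) _ 1(4)] q 1(3) by blast
next
  fix q assume "q \<in> closure (e_P ` subbundle T (E_zero T A)) \<inter> (S1 \<times> Sd_equator)"
  then show "q \<in> closure (e_P ` (cylinder interior_of \<D>)) \<inter> (S1 \<times> Sd_equator)"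
    using closure_mono[OF image_mono[OF subbundle_zero_interior]] by blast
qed

lemma phi_a_in_cylinder: "phi_a T A B t p u \<in> topspace cylinder"
  by (cases p) (simp add: phi_a_apply)

lemmas control_set_e_P = control_set_transport[where \<Phi> = "phi_a T A B" and \<Phi>' = "phi_P_a T A B" and \<U> = controls,
    OF homeomorphic_e_P phi_P_a_e_P phi_a_in_cylinder]

end

theorem theorem5p3:
  fixes T :: real
    and A :: "real \<Rightarrow> real^'d^'d"
    and B :: "real \<Rightarrow> real^'m^'d"
    and U :: "(real^'m) set"
  assumes "T > 0"
    and "A \<in> L_infty_on UNIV" and "ae_periodic T A"
    and "B \<in> L_infty_on UNIV" and "ae_periodic T B"
    and "bounded U" and "convex U" and "0 \<in> interior U"
    and "controllable A B"
  shows
    "(sphere_bundle closure_of (e_P ` (cylinder interior_of Reach_a T A B U 0 0)) \<inter> (S1 \<times> Sd_equator)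
        = sphere_bundle closure_of (e_P ` subbundle T (E_plus_zero T A)) \<inter> (S1 \<times> Sd_equator)
      \<and> sphere_bundle closure_of (e_P ` (cylinder interior_of Contr_a T A B U 0 0)) \<inter> (S1 \<times> Sd_equator)
        = sphere_bundle closure_of (e_P ` subbundle T (E_minus_zero T A)) \<inter> (S1 \<times> Sd_equator))
     \<and>
     ((\<exists>!D. control_set_nonvoid_interior upper_bundle (phi_P_a T A B) (admissible_controls U) D)
      \<and> control_set_nonvoid_interior upper_bundle (phi_P_a T A B) (admissible_controls U)
          (e_P ` D_a T A B U)
      \<and> sphere_bundle closure_of (upper_bundle interior_of (e_P ` D_a T A B U)) \<inter> (S1 \<times> Sd_equator)
        = sphere_bundle closure_of (e_P ` subbundle T (E_zero T A)) \<inter> (S1 \<times> Sd_equator)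
      \<and> (bounded (cylinder interior_of D_a T A B U) \<longleftrightarrow>
          sphere_bundle closure_of (upper_bundle interior_of (e_P ` D_a T A B U)) \<subseteq> S1 \<times> Sd_upper))"
proof -
  interpret periodic_control_system T A B U
    using assms by unfold_locales
  have cl: "sphere_bundle closure_of (e_P ` S) = closure (e_P ` S)" if "S \<subseteq> S1 \<times> UNIV" for S :: "(complex \<times> (real^'d)) set"
    by (rule sphere_bundle_closure[OF e_P_sphere_bundle[OF that]])
  have Ds: "\<D> \<subseteq> topspace cylinder" using Contr_subset by auto
  have iD: "cylinder interior_of \<D> \<subseteq> S1 \<times> UNIV"
    using interior_of_subset[of cylinder \<D>] Contr_subset by blast
  have hom: "homeomorphic_map cylinder upper_bundle (e_P :: complex \<times> (real^'d) \<Rightarrow> _)"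
    using homeomorphic_e_P homeomorphic_maps_map by blast
  have intP: "upper_bundle interior_of (e_P ` \<D>) = e_P ` (cylinder interior_of \<D>)"
    by (rule homeomorphic_map_interior_of[OF hom Ds])
  have "control_set_nonvoid_interior upper_bundle (phi_P_a T A B) controls (e_P ` \<D>)"
    by (rule control_set_e_P(1)[OF _ control_set_D])
  moreover have "E = e_P ` \<D>"
    if "control_set_nonvoid_interior upper_bundle (phi_P_a T A B) controls E" for E
    using control_set_e_P(2)[OF _ that] control_set_unique by blast
  ultimately have cs: "\<exists>!D. control_set_nonvoid_interior upper_bundle (phi_P_a T A B) controls D"
    "control_set_nonvoid_interior upper_bundle (phi_P_a T A B) controls (e_P ` \<D>)" by blast+
  show ?thesis
    unfolding D_a_eq intP interior_of_openin[OF openin_Reach] interior_of_openin[OF openin_Contr]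
      cl[OF Reach_subset] cl[OF Contr_subset] cl[OF subbundle_S1] cl[OF iD]
    using equator_Reach_eq equator_Contr_eq cs equator_control_set_eq bounded_iff_closure_e_P_upper[OF iD]
    by blast
qed

end
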